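(* There is an absolute polynomial $p$ in two variables such that the following holds. Let $E>1$, let $N>0$ and $\sigma$ be real numbers, and let $\epsilon>0$. Suppose that $\mathfrak{T}$ is a set of tubes in $\mathbb{R}^3$ with radius $1$ and length $EN$, contained in a ball of radius $EN$, and that $X$ is a set of $N^{3-\sigma}$ disjoint unit cubes in this ball, such that: (1) Each tube $T\in\mathfrak{T}$ intersects between $N$ and $EN$ cubes of $X$. (2) Each cube of $X$ intersects between $\rho$ and $E\rho$ tubes of $\mathfrak{T}$, for some $\rho\ge 3$ (the same $\rho$ for all cubes). (3) Each point of $\mathbb{R}^3$ lies in at most $E\rho$ tubes of $\mathfrak{T}$. (4) For each cube $Q\in X$, and for any two unit vectors $v_1,v_2\in\mathbb{R}^3$, at least a fraction $E^{-1}$ of the tubes of $\mathfrak{T}$ that intersect $Q$ have angle $\ge E^{-1}$ with both $v_1$ and $v_2$. Then for each cube $Q\in X$ we can choose a plane $\pi(Q)$ through $Q$ so that, for at least a fraction $(1-\epsilon)$ of the cubes $Q\in X$, for at least a fraction $(1-\epsilon)$ of the tubes $T\in\mathfrak{T}$ that meet $Q$, $$\mathrm{Angle}(v(T),\pi(Q))\le p(E,\epsilon^{-1})\,N^{-\sigma}.$$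
   Context: A tube of radius $1$ and length $\ell$ in $\mathbb{R}^3$ is a solid circular cylinder of radius $1$ and length $\ell$. The direction $v(T)$ of a tube $T$ is a unit vector parallel to its central line (well defined up to sign). The angle of a tube $T$ with a unit vector $v$ is the angle, in $[0,\pi/2]$, between the lines spanned by $v(T)$ and $v$. $\mathrm{Angle}(v(T),\pi)$, for a plane $\pi$, is the angle in $[0,\pi/2]$ between the line spanned by $v(T)$ and the plane $\pi$. A unit cube is a cube of side length $1$. *)

theory Defs
  imports "HOL-Analysis.Analysis" "HOL-Computational_Algebra.Polynomial"
begin

text \<open>Closed solid circular cylinder of radius 1: the central line segment runs from
  \<open>a\<close> to \<open>a + l *\<^sub>R v\<close>, where \<open>v\<close> is meant to be a unit vector.\<close>

definition unit_cylinder :: "real \<Rightarrow> real^3 \<Rightarrow> real^3 \<Rightarrow> (real^3) set" where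
  "unit_cylinder l a v =
     {a + t *\<^sub>R v + w | t w. 0 \<le> t \<and> t \<le> l \<and> w \<bullet> v = 0 \<and> norm w \<le> 1}"

definition is_tube :: "real \<Rightarrow> (real^3) set \<Rightarrow> bool" where
  "is_tube l T \<longleftrightarrow> (\<exists>a v. norm v = 1 \<and> T = unit_cylinder l a v)"

text \<open>A tube of positive length determines its direction up to sign; one of the two signs is
  chosen here, and the angles below do not depend on it.\<close>

definition tube_direction :: "(real^3) set \<Rightarrow> real^3" where
  "tube_direction T = (SOME v. norm v = 1 \<and> (\<exists>l a. l > 0 \<and> T = unit_cylinder l a v))"

text \<open>The angle, in \<open>[0, pi/2]\<close>, between the lines spanned by two nonzero vectors.\<close>

definition line_angle :: "real^3 \<Rightarrow> real^3 \<Rightarrow> real" where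
  "line_angle v w = arccos (\<bar>v \<bullet> w\<bar> / (norm v * norm w))"

definition is_plane :: "(real^3) set \<Rightarrow> bool" where
  "is_plane P \<longleftrightarrow> affine P \<and> aff_dim P = 2"

text \<open>The angle between a line and a plane is the least angle between that line and a line
  parallel to the plane (the minimum is attained at the orthogonal projection of the line).\<close>

definition line_plane_angle :: "real^3 \<Rightarrow> (real^3) set \<Rightarrow> real" where
  "line_plane_angle v P = Inf {line_angle v (x - y) | x y. x \<in> P \<and> y \<in> P \<and> x \<noteq> y}"

text \<open>Closed cubes of side length 1, with arbitrary position and orientation;
  \<open>cbox 0 1\<close> is the standard cube, since 1 is the vector with all entries 1.\<close>

definition is_unit_cube :: "(real^3) set \<Rightarrow> bool" where
  "is_unit_cube Q \<longleftrightarrow> 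
     (\<exists>c (f :: real^3 \<Rightarrow> real^3). orthogonal_transformation f \<and>
        Q = (\<lambda>x. c + f x) ` cbox 0 1)"

text \<open>Cubes of a grid may share boundary points, so disjointness refers to the interiors.
  This includes families of closed cubes that are disjoint as sets.\<close>

definition disjoint_cubes :: "(real^3) set set \<Rightarrow> bool" where
  "disjoint_cubes X \<longleftrightarrow> pairwise (\<lambda>Q R. disjnt (interior Q) (interior R)) X"

definition tubes_meeting :: "(real^3) set set \<Rightarrow> (real^3) set \<Rightarrow> (real^3) set set" where
  "tubes_meeting TT Q = {T \<in> TT. T \<inter> Q \<noteq> {}}"

text \<open>A polynomial in two variables is a polynomial in the second variable whose coefficients
  are polynomials in the first one.\<close>

definition poly_two :: "real poly poly \<Rightarrow> real \<Rightarrow> real \<Rightarrow> real" where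
  "poly_two p x y = poly (poly p [:y:]) x"

end

theory Submission
  imports Defs "Jordan_Normal_Form.Determinant" "HOL-Probability.Probability_Measure"
    "HOL-Analysis.Cross3"
begin

text \<open>Put \<open>\<tau> = K N powr (-\<sigma>)\<close> with \<open>K\<close> polynomial in \<open>E\<close> and \<open>1/\<epsilon>\<close>, and suppose that a fraction
  \<open>\<epsilon>\<close> of the cubes has no good plane. By (4), each such cube meets three tubes whose directions span
  a parallelepiped of volume at least about \<open>\<tau>\<close>, in many ways; choosing the three tubes greedily,
  one after the other, one can take them all from a set of about \<open>N powr (2 - \<sigma>)\<close> tubes. Tile
  each of these cubes by translates of a small parallelepiped with edges along its three tubes; this
  uses at most about \<open>N powr (3 - \<sigma>) / \<tau>\<close> tiles. Let \<open>P\<close> be a polynomial whose degree \<open>D\<close> is about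
  the cube root of this number, such that a fixed fraction of the tiles is cut by the zero set of \<open>P\<close>
  into two parts, each of them not small. In such a tile one can walk from the positive to the
  negative part along three segments parallel to the edges, so for one of the three directions the
  lines on which \<open>P\<close> changes sign inside the tile fill a fixed fraction of it. On the other hand
  every line has at most about \<open>D\<close> sign changes, so all such lines along one tube fill a volume of at
  most about \<open>D\<close>. Comparing the total volumes gives \<open>N powr (3 - \<sigma>) \<le> C N powr (2 - \<sigma>) D\<close>, which
  bounds \<open>\<tau>\<close> by a multiple of \<open>N powr (-\<sigma>)\<close>.

  The polynomial is found without the ham sandwich theorem, since the dimension \<open>d\<close> of the space of
  polynomials may exceed the number \<open>J\<close> of tiles by a constant factor. An almost maximiser of
  a log-determinant functional gives a basis in which the normalised evaluation vectors \<open>u(s)\<close>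
  satisfy \<open>\<integral> (u(s) \<bullet> e)\<^sup>2 \<le> 4 J / d\<close> for all unit vectors \<open>e\<close>. Then a combination of the basis with
  random signs has small mean on each tile, compared with its absolute mean, and
  hence takes both signs there with positive probability.\<close>

text \<open>Exponent count: with \<open>x\<close> cubes, about \<open>x / N\<close> selected tubes
  and \<open>D^3\<close> about \<open>x / \<tau>\<close>, the comparison of volumes reads
  \<open>N <= C D\<close>, hence \<open>\<tau> N^3 <= C x\<close>, and
  \<open>x = N powr (3 - \<sigma>)\<close> turns this into the claim. The slanted tiles are what
  brings in \<open>\<tau>\<close>: their number grows only like the inverse of the triple product of
  the three directions. The whole family may have about \<open>\<rho> x / N\<close> tubes, and
  \<open>\<rho>\<close> is not controlled by \<open>E\<close> and \<open>N\<close>; the greedy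
  selection divides this factor out.

  As only total volumes are compared, it is enough to cut a fixed share of the tiles, weighted by
  volume, and this is why random signs can replace an exact bisection. The obstacle is that in a
  fixed basis one function of constant sign may dominate all others on a tile, and then no choice of
  signs cuts it. A second-moment bound in every direction \<open>e\<close> of coefficient space
  excludes such a dominating function.\<close>

no_notation Matrix.scalar_prod (infix "\<bullet>" 70)
no_notation Matrix.vec_index (infixl "$" 100)

section \<open>Sign-balanced combinations of functions\<close>

text \<open>The matrix determinant lemma for \<open>I - C R\<close> with the column
  \<open>C = e / 2\<close> and the row \<open>R = e^T\<close>. The block matrix with rows
  \<open>(1, R)\<close> and \<open>(C, I)\<close> is factored in two ways, once with the Schur
  complement \<open>I - C R\<close> and once with the scalar \<open>1 - R C = 1/2\<close>.\<close>

lemma det_one_minus_half_outer: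
  fixes e :: "nat \<Rightarrow> real"
  assumes e: "(\<Sum>i<d. (e i)\<^sup>2) = 1"
  shows "Determinant.det (Matrix.mat d d (\<lambda>(i,j). (if i = j then 1 else 0) - e i * e j / 2)) = 1/2"
proof -
  let ?R = "Matrix.mat 1 d (\<lambda>(i,j). e j)"
  let ?C = "Matrix.mat d 1 (\<lambda>(i,j). e i / 2)"
  let ?B = "Matrix.mat d d (\<lambda>(i,j). (if i = j then 1 else 0) - e i * e j / 2)"
  let ?I = "1\<^sub>m d :: real mat" and ?O = "1\<^sub>m 1 :: real mat"
  let ?H = "Matrix.mat 1 1 (\<lambda>_. 1/2 :: real)"
  have RC: "?R * ?C = ?H"
    using e by (intro eq_matI) (auto simp: scalar_prod_def power2_eq_square sum_divide_distrib[symmetric] atLeast0LessThan)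
  have CR: "?C * ?R + ?B = ?I"
    by (intro eq_matI) (auto simp: scalar_prod_def)
  have H: "?H + ?H = ?O" by (intro eq_matI) auto
  let ?K = "four_block_mat ?O ?R ?C ?I"
  have 1: "four_block_mat ?O (0\<^sub>m 1 d) ?C ?I * four_block_mat ?O ?R (0\<^sub>m d 1) ?B = ?K"
    by (subst mult_four_block_mat[where ?nr1.0=1 and ?n1.0=1 and ?n2.0=d and ?nr2.0=d and ?nc1.0=1 and ?nc2.0=d])
       (auto simp: CR simp del: One_nat_def)
  have 2: "four_block_mat ?H ?R (0\<^sub>m d 1) ?I * four_block_mat ?O (0\<^sub>m 1 d) ?C ?I = ?K"
    by (subst mult_four_block_mat[where ?nr1.0=1 and ?n1.0=1 and ?n2.0=d and ?nr2.0=d and ?nc1.0=1 and ?nc2.0=d])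
       (auto simp: RC H simp del: One_nat_def)
  have d1: "Determinant.det (four_block_mat ?O (0\<^sub>m 1 d) ?C ?I) = 1"
    by (subst det_four_block_mat_upper_right_zero[of _ 1 _ d]) auto
  have d2: "Determinant.det (four_block_mat ?O ?R (0\<^sub>m d 1) ?B) = Determinant.det ?B"
    by (subst det_four_block_mat_lower_left_zero[of _ 1 _ d]) auto
  have d3: "Determinant.det (four_block_mat ?H ?R (0\<^sub>m d 1) ?I) = 1/2"
    by (subst det_four_block_mat_lower_left_zero[of _ 1 _ d]) (auto simp: det_single)
  have "Determinant.det ?K = Determinant.det ?B"
    unfolding 1[symmetric] by (subst det_mult[of _ "1+d"]) (auto simp: d1 d2 simp del: One_nat_def)
  moreover have "Determinant.det ?K = 1/2"
    unfolding 2[symmetric] by (subst det_mult[of _ "1+d"]) (auto simp: d1 d3 simp del: One_nat_def)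
  ultimately show ?thesis by simp
qed

text \<open>Matrices are plain functions here, which keeps matrix types out of the analysis; only
  the logarithm of the absolute determinant is used later.\<close>

definition abs_det :: "nat \<Rightarrow> (nat \<Rightarrow> nat \<Rightarrow> real) \<Rightarrow> real" where
  "abs_det d A = \<bar>Determinant.det (Matrix.mat d d (\<lambda>(i,k). A i k))\<bar>"

lemma abs_det_identity: "abs_det d (\<lambda>i k. if i = k then 1 else 0) = 1"
proof -
  have "Matrix.mat d d (\<lambda>(i,k). if i = k then 1 else 0) = (1\<^sub>m d :: real mat)"
    by (intro eq_matI) auto
  then show ?thesis by (simp add: abs_det_def)
qed

text \<open>The factor on the left is \<open>I - e e^T / 2\<close>, which halves the component along
  \<open>e\<close> and fixes its orthogonal complement. It is the perturbation against which almost
  maximality is tested in \<open>isotropic_position\<close>.\<close>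

lemma abs_det_contract:
  fixes e :: "nat \<Rightarrow> real"
  assumes e: "(\<Sum>i<d. (e i)\<^sup>2) = 1"
  shows "abs_det d (\<lambda>i k. A i k - e i * (\<Sum>j<d. e j * A j k) / 2) = abs_det d A / 2"
proof -
  let ?B = "Matrix.mat d d (\<lambda>(i,j). (if i = j then 1 else 0) - e i * e j / 2)"
  have "Matrix.mat d d (\<lambda>(i,k). A i k - e i * (\<Sum>j<d. e j * A j k) / 2)
      = ?B * Matrix.mat d d (\<lambda>(i,k). A i k)"
  proof (intro eq_matI, goal_cases)
    case (1 i k)
    then have "(?B * Matrix.mat d d (\<lambda>(i,k). A i k)) $$ (i,k)
        = (\<Sum>j<d. (if i = j then A j k else 0) - e i * (e j * A j k) / 2)"
      by (auto simp: scalar_prod_def atLeast0LessThan algebra_simps intro!: sum.cong)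
    also have "\<dots> = A i k - e i * (\<Sum>j<d. e j * A j k) / 2"
      using 1 by (simp add: sum_subtractf sum_distrib_left sum_divide_distrib)
    finally show ?case using 1 by simp
  qed auto
  then show ?thesis
    by (simp add: abs_det_def det_mult[of _ d] det_one_minus_half_outer[OF e] abs_mult)
qed

text \<open>Leibniz expansion with every entry bounded by the Frobenius norm. Hadamard's inequality
  would be sharper, but what counts is homogeneity of degree \<open>d\<close>, which keeps the
  functional \<open>G\<close> in \<open>isotropic_position\<close> bounded above.\<close>

lemma abs_det_le:
  "abs_det d A \<le> fact d * sqrt (\<Sum>i<d. \<Sum>k<d. (A i k)\<^sup>2) ^ d"
proof -
  let ?N = "\<Sum>i<d. \<Sum>k<d. (A i k)\<^sup>2"
  have entry: "\<bar>A i k\<bar> \<le> sqrt ?N" if "i < d" "k < d" for i k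
  proof -
    have "(A i k)\<^sup>2 \<le> (\<Sum>k<d. (A i k)\<^sup>2)"
      by (rule member_le_sum) (use that in auto)
    also have "\<dots> \<le> ?N"
      by (rule member_le_sum[where f="\<lambda>i. \<Sum>k<d. (A i k)\<^sup>2"]) (use that in \<open>auto intro: sum_nonneg\<close>)
    finally show ?thesis by (metis real_le_rsqrt real_sqrt_abs real_sqrt_le_mono)
  qed
  have "abs_det d A = \<bar>\<Sum>p | p permutes {0..<d}. signof p * (\<Prod>i = 0..<d. A i (p i))\<bar>"
    unfolding abs_det_def by (subst det_def'[of _ d]) (auto intro!: arg_cong[where f=abs] sum.cong prod.cong)
  also have "\<dots> \<le> (\<Sum>p | p permutes {0..<d}. \<bar>signof p * (\<Prod>i = 0..<d. A i (p i))\<bar>)"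
    by (rule sum_abs)
  also have "\<dots> \<le> (\<Sum>p | p permutes {0..<d}. sqrt ?N ^ d)"
  proof (rule sum_mono)
    fix p assume "p \<in> {p. p permutes {0..<d}}"
    then have p: "p i < d" if "i < d" for i using that permutes_in_image[of p "{0..<d}" i] by auto
    have "(\<Prod>i = 0..<d. \<bar>A i (p i)\<bar>) \<le> (\<Prod>i = 0..<d. sqrt ?N)"
      by (rule prod_mono) (use entry p in auto)
    then show "\<bar>signof p * (\<Prod>i = 0..<d. A i (p i))\<bar> \<le> sqrt ?N ^ d"
      by (auto simp: abs_mult abs_prod sign_def)
  qed
  also have "\<dots> = fact d * sqrt ?N ^ d"
    by (simp add: card_permutations)
  finally show ?thesis .
qed

section \<open>Moments of sums with random signs\<close>

text \<open>\<open>S\<close> is the set of indices with sign plus. Sums over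
  \<open>Pow {..<d}\<close>, divided by \<open>2 ^ d\<close>, are expectations over independent
  signs, so no second probability space is introduced.\<close>

definition signed_sum :: "nat \<Rightarrow> nat set \<Rightarrow> (nat \<Rightarrow> real) \<Rightarrow> real" where
  "signed_sum d S u = (\<Sum>i<d. (if i \<in> S then 1 else -1) * u i)"

lemma sum_Pow_lessThan_Suc:
  "(\<Sum>S\<in>Pow {..<Suc d}. F S) = (\<Sum>S\<in>Pow {..<d}. F S + F (insert d S))" for F :: "nat set \<Rightarrow> real"
proof -
  have "(\<Sum>S\<in>insert d ` Pow {..<d}. F S) = (\<Sum>S\<in>Pow {..<d}. F (insert d S))"
    by (subst sum.reindex) (auto simp: inj_on_def)
  moreover have "Pow {..<d} \<inter> insert d ` Pow {..<d} = {}" by auto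
  ultimately show ?thesis
    by (simp add: lessThan_Suc Pow_insert sum.union_disjoint sum.distrib)
qed

lemma signed_sum_Suc:
  assumes "S \<subseteq> {..<d}"
  shows "signed_sum (Suc d) S u = signed_sum d S u - u d" "signed_sum (Suc d) (insert d S) u = signed_sum d S u + u d"
proof -
  have "(\<Sum>i<d. (if i = d \<or> i \<in> S then 1 else -1) * u i) = (\<Sum>i<d. (if i \<in> S then 1 else -1) * u i)"
    by (intro sum.cong) auto
  then show "signed_sum (Suc d) S u = signed_sum d S u - u d" "signed_sum (Suc d) (insert d S) u = signed_sum d S u + u d"
    using assms by (auto simp: signed_sum_def)
qed

lemma signed_sum_second_moment: "(\<Sum>S\<in>Pow {..<d}. (signed_sum d S u)\<^sup>2) = 2 ^ d * (\<Sum>i<d. (u i)\<^sup>2)"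
proof (induction d)
  case 0 then show ?case by (simp add: signed_sum_def)
next
  case (Suc d)
  have "(\<Sum>S\<in>Pow {..<Suc d}. (signed_sum (Suc d) S u)\<^sup>2)
     = (\<Sum>S\<in>Pow {..<d}. 2 * (signed_sum d S u)\<^sup>2 + 2 * (u d)\<^sup>2)"
    unfolding sum_Pow_lessThan_Suc
    by (rule sum.cong) (auto simp: signed_sum_Suc power2_eq_square algebra_simps)
  also have "\<dots> = 2 * (\<Sum>S\<in>Pow {..<d}. (signed_sum d S u)\<^sup>2) + 2 * 2 ^ d * (u d)\<^sup>2"
    by (simp add: sum.distrib sum_distrib_left card_Pow)
  finally show ?case by (simp add: Suc algebra_simps)
qed

text \<open>Khinchine's inequality for the exponent four. In the induction step the coefficient of
  \<open>(u d)^4\<close> is raised from 2 to 6, which completes the square.\<close>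

lemma signed_sum_fourth_moment: "(\<Sum>S\<in>Pow {..<d}. (signed_sum d S u)^4) \<le> 3 * 2 ^ d * (\<Sum>i<d. (u i)\<^sup>2)\<^sup>2"
proof (induction d)
  case 0 then show ?case by (simp add: signed_sum_def)
next
  case (Suc d)
  let ?s = "\<Sum>i<d. (u i)\<^sup>2"
  have "(\<Sum>S\<in>Pow {..<Suc d}. (signed_sum (Suc d) S u)^4)
     = (\<Sum>S\<in>Pow {..<d}. 2 * (signed_sum d S u)^4 + 12 * (u d)\<^sup>2 * (signed_sum d S u)\<^sup>2 + 2 * (u d)^4)"
    unfolding sum_Pow_lessThan_Suc
    by (rule sum.cong) (auto simp: signed_sum_Suc power2_eq_square power4_eq_xxxx algebra_simps)
  also have "\<dots> = 2 * (\<Sum>S\<in>Pow {..<d}. (signed_sum d S u)^4) + 12 * (u d)\<^sup>2 * (2 ^ d * ?s) + 2 * 2 ^ d * (u d)^4"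
    by (simp add: sum.distrib sum_distrib_left[symmetric] card_Pow signed_sum_second_moment)
  also have "\<dots> \<le> 2 * (3 * 2 ^ d * ?s\<^sup>2) + 12 * (u d)\<^sup>2 * (2 ^ d * ?s) + 6 * 2 ^ d * (u d)^4"
  proof -
    have "2 * (\<Sum>S\<in>Pow {..<d}. (signed_sum d S u)^4) \<le> 2 * (3 * 2 ^ d * ?s\<^sup>2)" using Suc by simp
    moreover have "2 * 2 ^ d * (u d)^4 \<le> 6 * 2 ^ d * (u d)^4" by (intro mult_right_mono) auto
    ultimately show ?thesis by linarith
  qed
  also have "\<dots> = 3 * 2 ^ Suc d * (?s + (u d)\<^sup>2)\<^sup>2"
    by (simp add: power2_eq_square power4_eq_xxxx algebra_simps)
  finally show ?case by simp
qed

text \<open>Compactness of the unit sphere of coefficient vectors. If no \<open>\<delta>\<close>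
  works, there are unit vectors \<open>c n\<close> whose sublevel sets at height
  \<open>1 / (n + 1)\<close> have probability above \<open>\<eta>\<close>; a limit \<open>l\<close>
  of a subsequence then has a zero set of probability at least \<open>\<eta>\<close>, against
  \<open>null\<close>.\<close>

lemma (in prob_space) uniform_sublevel:
  fixes b :: "nat \<Rightarrow> 'a \<Rightarrow> real"
  assumes meas[measurable]: "\<And>k. b k \<in> borel_measurable M"
    and bdd: "\<And>k s. k < d \<Longrightarrow> s \<in> space M \<Longrightarrow> \<bar>b k s\<bar> \<le> K"
    and null: "\<And>c. (\<Sum>k<d. (c k)\<^sup>2) = (1::real) \<Longrightarrow> AE s in M. (\<Sum>k<d. c k * b k s) \<noteq> 0"
    and "\<eta> > 0"
  obtains \<delta> where "\<delta> > 0"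
    "\<And>c. (\<Sum>k<d. (c k)\<^sup>2) = 1 \<Longrightarrow> prob {s \<in> space M. \<bar>\<Sum>k<d. c k * b k s\<bar> \<le> \<delta>} \<le> \<eta>"
proof (rule ccontr)
  note obtainI = that
  assume contra: "\<not> thesis"
  have neg: "\<exists>c. (\<Sum>k<d. (c k)\<^sup>2) = 1 \<and> prob {s \<in> space M. \<bar>\<Sum>k<d. c k * b k s\<bar> \<le> \<delta>} > \<eta>"
    if \<delta>: "\<delta> > 0" for \<delta>
  proof (rule ccontr)
    assume no: "\<not> ?thesis"
    have thesis
    proof (rule obtainI[OF \<delta>])
      fix c :: "nat \<Rightarrow> real"
      assume "(\<Sum>k<d. (c k)\<^sup>2) = 1"
      then show "prob {s \<in> space M. \<bar>\<Sum>k<d. c k * b k s\<bar> \<le> \<delta>} \<le> \<eta>"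
        using no by (meson not_le)
    qed
    then show False using contra by contradiction
  qed
  have "\<forall>n. \<exists>c. (\<Sum>k<d. (c k)\<^sup>2) = 1 \<and> prob {s \<in> space M. \<bar>\<Sum>k<d. c k * b k s\<bar> \<le> 1 / real (Suc n)} > \<eta>"
    by (intro allI neg) auto
  then have "\<exists>c. \<forall>n. (\<Sum>k<d. (c n k)\<^sup>2) = 1 \<and> prob {s \<in> space M. \<bar>\<Sum>k<d. c n k * b k s\<bar> \<le> 1 / real (Suc n)} > \<eta>"
    by (rule choice)
  then obtain c where c: "\<forall>n. (\<Sum>k<d. (c n k)\<^sup>2) = 1 \<and> prob {s \<in> space M. \<bar>\<Sum>k<d. c n k * b k s\<bar> \<le> 1 / real (Suc n)} > \<eta>"
    by (elim exE)
  note c1 = c[rule_format, THEN conjunct1] and cp = c[rule_format, THEN conjunct2]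
  have cb: "\<bar>c n k\<bar> \<le> 1" if "k < d" for n k
  proof -
    have "(c n k)\<^sup>2 \<le> (\<Sum>k<d. (c n k)\<^sup>2)" by (rule member_le_sum) (use that in auto)
    then show ?thesis by (simp add: c1 abs_square_le_1)
  qed
  have "\<forall>D\<subseteq>{..<d}. \<exists>l. \<exists>r::nat\<Rightarrow>nat. strict_mono r \<and>
     (\<forall>\<epsilon>>0. eventually (\<lambda>n. \<forall>i\<in>D. dist (c (r n) i) (l i) < \<epsilon>) sequentially)"
    by (rule compact_lemma_general[where unproj = "\<lambda>x. x"])
       (auto intro!: boundedI[where B = 1] cb)
  then have "\<exists>l. \<exists>r::nat\<Rightarrow>nat. strict_mono r \<and>
     (\<forall>\<epsilon>>0. eventually (\<lambda>n. \<forall>i\<in>{..<d}. dist (c (r n) i) (l i) < \<epsilon>) sequentially)"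
    by (elim allE impE) (rule order_refl)
  then obtain l and r :: "nat \<Rightarrow> nat" where lr0: "strict_mono r \<and>
     (\<forall>\<epsilon>>0. eventually (\<lambda>n. \<forall>i\<in>{..<d}. dist (c (r n) i) (l i) < \<epsilon>) sequentially)"
    by (elim exE)
  have r: "strict_mono r"
    and lr: "\<And>\<epsilon>. \<epsilon> > 0 \<Longrightarrow> eventually (\<lambda>n. \<forall>i<d. dist (c (r n) i) (l i) < \<epsilon>) sequentially"
    using lr0 by (auto simp: Ball_def)
  have lim: "(\<lambda>n. c (r n) i) \<longlonglongrightarrow> l i" if "i < d" for i
  proof (rule tendstoI)
    fix e :: real assume "e > 0"
    from lr[OF this] show "\<forall>\<^sub>F n in sequentially. dist (c (r n) i) (l i) < e"
      by (rule eventually_mono) (use that in auto)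
  qed
  have "(\<lambda>n. \<Sum>k<d. (c (r n) k)\<^sup>2) \<longlonglongrightarrow> (\<Sum>k<d. (l k)\<^sup>2)"
    by (intro tendsto_intros lim) auto
  then have l1: "(\<Sum>k<d. (l k)\<^sup>2) = 1"
    using c1 by (simp add: LIMSEQ_const_iff)
  define F where "F c s = (\<Sum>k<d. c k * b k s)" for c s
  have Fm[measurable]: "F c \<in> borel_measurable M" for c unfolding F_def by measurable
  define Z where "Z m = {s \<in> space M. \<bar>F l s\<bar> \<le> 1 / real (Suc m)}" for m
  have Zm[measurable]: "Z m \<in> sets M" for m unfolding Z_def by measurable
  have big: "prob (Z m) \<ge> \<eta>" for m
  proof -
    \<comment> \<open>Changing the coefficients by \<open>\<epsilon>\<close> costs at most half of
      \<open>1 / (m + 1)\<close>, and the index bound \<open>n >= 2 (m + 1)\<close> pays for the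
      other half. The added \<open>1\<close> keeps the denominator positive when \<open>d\<close> or
      \<open>K\<close> is zero.\<close>
    define \<epsilon> where "\<epsilon> = 1 / (2 * real (Suc m) * (real d * \<bar>K\<bar> + 1))"
    have pos: "real d * \<bar>K\<bar> + 1 > 0" by (simp add: add_nonneg_pos)
    then have "\<epsilon> > 0" unfolding \<epsilon>_def by (simp add: zero_less_mult_iff)
    obtain n where n: "\<forall>i<d. dist (c (r n) i) (l i) < \<epsilon>" and "n \<ge> 2 * Suc m"
      using eventually_happens'[OF sequentially_bot
        eventually_conj[OF lr[OF \<open>\<epsilon> > 0\<close>] eventually_ge_at_top[of "2 * Suc m"]]]
      by blast
    have rn: "r n \<ge> 2 * Suc m" using \<open>n \<ge> 2 * Suc m\<close> seq_suble[OF r, of n] by linarith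
    have "{s \<in> space M. \<bar>F (c (r n)) s\<bar> \<le> 1 / real (Suc (r n))} \<subseteq> Z m"
    proof
      fix s assume "s \<in> {s \<in> space M. \<bar>F (c (r n)) s\<bar> \<le> 1 / real (Suc (r n))}"
      then have s: "s \<in> space M" "\<bar>F (c (r n)) s\<bar> \<le> 1 / real (Suc (r n))" by auto
      have "\<bar>F l s - F (c (r n)) s\<bar> = \<bar>\<Sum>k<d. (l k - c (r n) k) * b k s\<bar>"
        by (simp add: F_def sum_subtractf algebra_simps)
      also have "\<dots> \<le> (\<Sum>k<d. \<bar>(l k - c (r n) k) * b k s\<bar>)" by (rule sum_abs)
      also have "\<dots> \<le> (\<Sum>k<d. \<epsilon> * \<bar>K\<bar>)"
      proof (intro sum_mono)
        fix k assume "k \<in> {..<d}"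
        then have "\<bar>l k - c (r n) k\<bar> \<le> \<epsilon>" "\<bar>b k s\<bar> \<le> \<bar>K\<bar>"
          using n bdd[OF _ s(1), of k] by (auto simp: dist_real_def abs_minus_commute intro: less_imp_le)
        then show "\<bar>(l k - c (r n) k) * b k s\<bar> \<le> \<epsilon> * \<bar>K\<bar>"
          unfolding abs_mult using \<open>\<epsilon> > 0\<close> by (intro mult_mono) auto
      qed
      also have "\<dots> = \<epsilon> * (real d * \<bar>K\<bar>)" by simp
      also have "\<dots> \<le> \<epsilon> * (real d * \<bar>K\<bar> + 1)" using \<open>\<epsilon> > 0\<close> by simp
      also have "\<dots> = 1 / (2 * real (Suc m))" using pos by (simp add: \<epsilon>_def)
      finally have 1: "\<bar>F l s - F (c (r n)) s\<bar> \<le> 1 / (2 * real (Suc m))" .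
      have "1 / real (Suc (r n)) \<le> 1 / (2 * real (Suc m))"
        using rn by (intro divide_left_mono) auto
      then have "\<bar>F l s\<bar> \<le> 1 / (2 * real (Suc m)) + 1 / (2 * real (Suc m))"
        using 1 s(2) by linarith
      also have "\<dots> = 1 / real (Suc m)" by (simp add: field_simps)
      finally show "s \<in> Z m" using s(1) by (simp add: Z_def)
    qed
    then have "prob {s \<in> space M. \<bar>F (c (r n)) s\<bar> \<le> 1 / real (Suc (r n))} \<le> prob (Z m)"
      by (intro finite_measure_mono) auto
    then show ?thesis using cp[of "r n"] unfolding F_def by linarith
  qed
  have "decseq Z"
    unfolding decseq_def Z_def
  proof safe
    fix m n x assume "m \<le> n" "\<bar>F l x\<bar> \<le> 1 / real (Suc n)"
    moreover have "1 / real (Suc n) \<le> 1 / real (Suc m)"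
      using \<open>m \<le> n\<close> by (intro divide_left_mono) auto
    ultimately show "\<bar>F l x\<bar> \<le> 1 / real (Suc m)" by linarith
  qed
  then have "(\<lambda>m. prob (Z m)) \<longlonglongrightarrow> prob (\<Inter>m. Z m)"
    by (intro finite_Lim_measure_decseq) auto
  then have "\<eta> \<le> prob (\<Inter>m. Z m)"
    using big by (intro LIMSEQ_le_const) auto
  also have "prob (\<Inter>m. Z m) = 0"
  proof -
    have "F l s = 0" if "s \<in> (\<Inter>m. Z m)" for s
    proof (rule ccontr)
      assume "F l s \<noteq> 0"
      then obtain m where "inverse (real (Suc m)) < \<bar>F l s\<bar>"
        using reals_Archimedean[of "\<bar>F l s\<bar>"] by auto
      moreover have "s \<in> Z m" using that by (rule INT_D) simp
      ultimately show False by (simp add: Z_def inverse_eq_divide)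
    qed
    moreover have "AE s in M. F l s \<noteq> 0" using null[OF l1] by (simp add: F_def)
    ultimately have "AE s in M. s \<notin> (\<Inter>m. Z m)" by (auto elim!: eventually_mono simp del: INT_iff)
    then show ?thesis by (subst prob_eq_0) auto
  qed
  finally show False using \<open>\<eta> > 0\<close> by simp
qed

lemma (in prob_space) square_integral_le:
  fixes g :: "'a \<Rightarrow> real"
  assumes "integrable M g" "integrable M (\<lambda>s. (g s)\<^sup>2)"
  shows "(\<integral>s. g s \<partial>M)\<^sup>2 \<le> (\<integral>s. (g s)\<^sup>2 \<partial>M)"
proof -
  let ?c = "\<integral>s. g s \<partial>M"
  have "0 \<le> (\<integral>s. (g s - ?c)\<^sup>2 \<partial>M)" by simp
  also have "\<dots> = (\<integral>s. ((g s)\<^sup>2 - 2 * ?c * g s) + ?c\<^sup>2 \<partial>M)"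
    by (intro Bochner_Integration.integral_cong) (auto simp: power2_eq_square algebra_simps)
  also have "\<dots> = (\<integral>s. (g s)\<^sup>2 \<partial>M) - 2 * ?c * ?c + ?c\<^sup>2"
    using assms by (simp add: prob_space)
  finally show ?thesis by (simp add: power2_eq_square)
qed

text \<open>Isotropy makes the mean vector of \<open>u\<close> short, so the integral
  \<open>X S\<close> of \<open>f S\<close> is small for typical signs, while the second and fourth
  moments keep the integral \<open>m S\<close> of \<open>\<bar>f S\<bar>\<close> at least
  \<open>1/4\<close> on average. A function with small mean that is rarely positive, or rarely
  negative, has a small absolute integral; hence a fixed share of the sign sets is balanced.\<close>

lemma (in prob_space) random_signs_balanced:
  fixes u :: "nat \<Rightarrow> 'a \<Rightarrow> real"
  assumes meas[measurable]: "\<And>i. u i \<in> borel_measurable M"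
    and le1: "\<And>s. s \<in> space M \<Longrightarrow> (\<Sum>i<d. (u i s)\<^sup>2) \<le> 1"
    and iso: "\<And>e. (\<Sum>i<d. (e i)\<^sup>2) = 1 \<Longrightarrow> (\<integral>s. (\<Sum>i<d. e i * u i s)\<^sup>2 \<partial>M) \<le> 1/256"
    and ge: "prob {s \<in> space M. (\<Sum>i<d. (u i s)\<^sup>2) < 1/2} \<le> 1/10"
  defines "bal \<equiv> (\<lambda>S. prob {s \<in> space M. signed_sum d S (\<lambda>i. u i s) > 0} \<ge> 1/1024 \<and>
                    prob {s \<in> space M. signed_sum d S (\<lambda>i. u i s) < 0} \<ge> 1/1024)"
  shows "real (card {S \<in> Pow {..<d}. bal S}) \<ge> 2 ^ d / 64"
proof -
  define f where "f S s = signed_sum d S (\<lambda>i. u i s)" for S s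
  define v where "v s = (\<Sum>i<d. (u i s)\<^sup>2)" for s
  have fm[measurable]: "f S \<in> borel_measurable M" for S unfolding f_def signed_sum_def by measurable
  have vm[measurable]: "v \<in> borel_measurable M" unfolding v_def by measurable
  have ub: "\<bar>u i s\<bar> \<le> 1" if "i < d" "s \<in> space M" for i s
  proof -
    have "(u i s)\<^sup>2 \<le> (\<Sum>i<d. (u i s)\<^sup>2)" by (rule member_le_sum) (use that in auto)
    also have "\<dots> \<le> 1" by (rule le1[OF that(2)])
    finally show ?thesis by (simp add: abs_square_le_1)
  qed
  have fb: "\<bar>f S s\<bar> \<le> real d" if "s \<in> space M" for S s
  proof -
    have "\<bar>f S s\<bar> \<le> (\<Sum>i<d. \<bar>(if i \<in> S then 1 else -1) * u i s\<bar>)" unfolding f_def signed_sum_def by (rule sum_abs)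
    also have "\<dots> \<le> (\<Sum>i<d. 1)" by (intro sum_mono) (use ub that in \<open>auto simp: abs_mult\<close>)
    finally show ?thesis by simp
  qed
  have bint: "integrable M g" if "g \<in> borel_measurable M" "\<And>s. s \<in> space M \<Longrightarrow> \<bar>g s\<bar> \<le> B" for g :: "'a \<Rightarrow> real" and B
    by (rule integrable_const_bound[where B = B]) (use that in auto)
  have ui: "integrable M (u i)" if "i < d" for i
    by (rule bint[of _ 1]) (use ub that in auto)
  have fp: "integrable M (\<lambda>s. \<bar>f S s\<bar> ^ n)" for S n
    by (rule bint[of _ "real d ^ n"]) (use fb in \<open>auto intro!: power_mono\<close>)
  have f1: "integrable M (f S)" for S by (rule bint[of _ "real d"]) (use fb in auto)
  have fa: "integrable M (\<lambda>s. \<bar>f S s\<bar>)" for S using f1 by simp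
  have f2: "integrable M (\<lambda>s. (f S s)\<^sup>2)" for S using fp[of S 2] by simp
  have f4: "integrable M (\<lambda>s. (f S s)^4)" for S using fp[of S 4] by simp
  have v01: "0 \<le> v s" "v s \<le> 1" if "s \<in> space M" for s using le1[OF that] by (auto simp: v_def intro: sum_nonneg)
  have vi: "integrable M v" by (rule bint[of _ 1]) (use v01 in \<open>auto simp: abs_le_iff\<close>)
  have ind: "integrable M (indicator A :: 'a \<Rightarrow> real)" "(\<integral>s. indicator A s \<partial>M) = prob A" if "A \<in> sets M" for A
    using that sets.sets_into_space[OF that] bint[of "indicator A" 1] by (auto simp: Int_absorb2)
  define X where "X S = (\<integral>s. f S s \<partial>M)" for S
  define Y where "Y S = (\<integral>s. (f S s)\<^sup>2 \<partial>M)" for S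
  define m where "m S = (\<integral>s. \<bar>f S s\<bar> \<partial>M)" for S
  let ?P = "Pow {..<d}"
  have sX: "(\<Sum>S\<in>?P. (X S)\<^sup>2) \<le> 2 ^ d / 256"
  proof -
    let ?e = "\<lambda>i. \<integral>s. u i s \<partial>M"
    let ?E = "\<Sum>i<d. (?e i)\<^sup>2"
    have "X S = signed_sum d S ?e" for S
      unfolding X_def f_def signed_sum_def by (subst Bochner_Integration.integral_sum) (auto intro: ui)
    then have "(\<Sum>S\<in>?P. (X S)\<^sup>2) = 2 ^ d * ?E" by (simp add: signed_sum_second_moment)
    moreover have "?E \<le> 1/256"
    proof (cases "?E = 0")
      case False
      then have pos: "?E > 0" by (simp add: sum_nonneg less_le)
      \<comment> \<open>Isotropy is applied in the direction of the mean vector itself; this turns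
        the second-moment bound into a bound for its squared length \<open>?E\<close>.\<close>
      define c where "c i = ?e i / sqrt ?E" for i
      define g where "g s = (\<Sum>i<d. c i * u i s)" for s
      have gi: "integrable M g" unfolding g_def by (intro Bochner_Integration.integrable_sum integrable_mult_right ui) auto
      have [measurable]: "g \<in> borel_measurable M" using gi by auto
      have gb: "\<bar>g s\<bar> \<le> (\<Sum>i<d. \<bar>c i\<bar>)" if "s \<in> space M" for s
        unfolding g_def by (rule order_trans[OF sum_abs], intro sum_mono)
          (use ub that in \<open>auto simp: abs_mult intro!: mult_left_le\<close>)
      have g2: "integrable M (\<lambda>s. (g s)\<^sup>2)"
        by (rule bint[of _ "(\<Sum>i<d. \<bar>c i\<bar>)\<^sup>2"]) (use gb in \<open>auto simp: abs_le_square_iff[symmetric] intro: order_trans\<close>)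
      have "(\<integral>s. g s \<partial>M) = (\<Sum>i<d. c i * ?e i)"
        unfolding g_def by (subst Bochner_Integration.integral_sum) (auto intro: ui)
      also have "\<dots> = ?E / sqrt ?E"
        by (simp add: c_def sum_divide_distrib[symmetric] power2_eq_square)
      also have "\<dots> = sqrt ?E" using pos by (simp add: real_div_sqrt)
      finally have "?E = (\<integral>s. g s \<partial>M)\<^sup>2" using pos by simp
      also have "\<dots> \<le> (\<integral>s. (g s)\<^sup>2 \<partial>M)" by (rule square_integral_le[OF gi g2])
      also have "\<dots> \<le> 1/256"
        unfolding g_def
      proof (rule iso)
        have "(\<Sum>i<d. (c i)\<^sup>2) = (\<Sum>i<d. (?e i)\<^sup>2) / ?E"
          using pos by (simp add: c_def power_divide sum_divide_distrib[symmetric])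
        then show "(\<Sum>i<d. (c i)\<^sup>2) = 1" using pos by simp
      qed
      finally show ?thesis .
    qed simp
    ultimately show ?thesis by simp
  qed
  have sY: "(\<Sum>S\<in>?P. Y S) \<le> 2 ^ d"
  proof -
    have "(\<Sum>S\<in>?P. Y S) = (\<integral>s. (\<Sum>S\<in>?P. (f S s)\<^sup>2) \<partial>M)"
      unfolding Y_def by (rule Bochner_Integration.integral_sum[symmetric]) (rule f2)
    also have "\<dots> = (\<integral>s. 2 ^ d * v s \<partial>M)"
      by (intro Bochner_Integration.integral_cong) (auto simp: f_def v_def signed_sum_second_moment)
    also have "\<dots> \<le> (\<integral>s. 2 ^ d * 1 \<partial>M)"
      by (intro integral_mono) (use vi v01 in auto)
    finally show ?thesis by (simp add: prob_space)
  qed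
  have sm: "(\<Sum>S\<in>?P. m S) \<ge> 2 ^ d / 4"
  proof -
    \<comment> \<open>The first absolute moment is bounded below by the second and the fourth;
      \<open>4/27\<close> is the least possible constant, with equality at \<open>r = 3/2\<close>.
      Together with the factor 3 of the fourth moment it leaves
      \<open>v - (4/9) v^2 >= (5/9) v\<close>, and the integral of \<open>v\<close> is at least
      \<open>9/20\<close>, which gives \<open>1/4\<close>.\<close>
    have key0: "r \<ge> r\<^sup>2 - 4/27 * r^4" if "r \<ge> 0" for r :: real
    proof -
      have "0 \<le> (4/27) * r * ((r - 3/2)\<^sup>2 * (r + 3))" using that by simp
      also have "\<dots> = r - r^2 + 4/27 * r^4"
        by (simp add: power2_eq_square power4_eq_xxxx algebra_simps)
      finally show ?thesis by simp
    qed
    have key: "\<bar>t\<bar> \<ge> t\<^sup>2 - 4/27 * t^4" for t :: real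
      using key0[of "\<bar>t\<bar>"] by simp
    have "(9/10) * (1/2) \<le> (\<integral>s. v s \<partial>M)"
    proof -
      let ?B = "{s \<in> space M. v s < 1/2}"
      have "9/10 \<le> prob (space M - ?B)" using ge by (subst prob_compl) (auto simp: v_def)
      then have "(9/10) * (1/2) \<le> prob (space M - ?B) * (1/2)" by simp
      also have "\<dots> = (\<integral>s. indicator (space M - ?B) s * (1/2) \<partial>M)"
        using ind[of "space M - ?B"] by simp
      also have "\<dots> \<le> (\<integral>s. v s \<partial>M)"
        by (intro integral_mono integrable_mult_left ind vi) (use v01 in \<open>auto simp: indicator_def\<close>)
      finally show ?thesis .
    qed
    then have "2 ^ d / 4 \<le> 2 ^ d * ((5/9) * (\<integral>s. v s \<partial>M))" by simp
    also have "\<dots> = (\<integral>s. 2 ^ d * ((5/9) * v s) \<partial>M)" by simp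
    also have "\<dots> \<le> (\<integral>s. (\<Sum>S\<in>?P. (f S s)\<^sup>2 - 4/27 * (f S s)^4) \<partial>M)"
    proof (rule integral_mono)
      fix s assume s: "s \<in> space M"
      have "(v s)\<^sup>2 \<le> v s" using v01[OF s] by (simp add: power2_eq_square mult_left_le)
      then have "2 ^ d * ((5/9) * v s) \<le> 2 ^ d * (v s - (4/9) * (v s)\<^sup>2)" by simp
      also have "\<dots> = 2 ^ d * v s - 4/27 * (3 * 2 ^ d * (v s)\<^sup>2)" by (simp add: algebra_simps)
      also have "\<dots> \<le> (\<Sum>S\<in>?P. (f S s)\<^sup>2) - 4/27 * (\<Sum>S\<in>?P. (f S s)^4)"
        using signed_sum_fourth_moment[of d "\<lambda>i. u i s"] by (simp add: f_def v_def signed_sum_second_moment)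
      also have "\<dots> = (\<Sum>S\<in>?P. (f S s)\<^sup>2 - 4/27 * (f S s)^4)"
        by (simp add: sum_subtractf sum_distrib_left)
      finally show "2 ^ d * ((5/9) * v s) \<le> (\<Sum>S\<in>?P. (f S s)\<^sup>2 - 4/27 * (f S s)^4)" .
    qed (use vi f2 f4 in auto)
    also have "\<dots> \<le> (\<integral>s. (\<Sum>S\<in>?P. \<bar>f S s\<bar>) \<partial>M)"
      by (intro integral_mono sum_mono Bochner_Integration.integrable_sum Bochner_Integration.integrable_diff key)
         (use f2 f4 fa in auto)
    also have "\<dots> = (\<Sum>S\<in>?P. m S)"
      unfolding m_def by (rule Bochner_Integration.integral_sum) (rule fa)
    finally show ?thesis .
  qed
  \<comment> \<open>Where \<open>h > 0\<close>, the bound \<open>h <= h^2 / 64 + 16\<close> is used;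
    the probability below \<open>1/1024\<close> of this set turns the \<open>16\<close> into
    \<open>1/64\<close>.\<close>
  have part: "(\<integral>s. max 0 (h s) \<partial>M) \<le> ((\<integral>s. (h s)\<^sup>2 \<partial>M) + 1) / 64"
    if p: "prob {s \<in> space M. h s > 0} < 1/1024" and [measurable]: "h \<in> borel_measurable M"
      and h: "integrable M h" and h2: "integrable M (\<lambda>s. (h s)\<^sup>2)" for h :: "'a \<Rightarrow> real"
  proof -
    let ?H = "{s \<in> space M. h s > 0}"
    have "(\<integral>s. max 0 (h s) \<partial>M) \<le> (\<integral>s. (h s)\<^sup>2 / 64 + 16 * indicator ?H s \<partial>M)"
    proof (rule integral_mono)
      fix s assume s: "s \<in> space M"
      have "0 \<le> (h s / 8 - 4)\<^sup>2" by simp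
      then have "h s \<le> (h s)\<^sup>2 / 64 + 16" by (simp add: power2_eq_square algebra_simps)
      then show "max 0 (h s) \<le> (h s)\<^sup>2 / 64 + 16 * indicator ?H s"
        using s by (cases "h s > 0") auto
    next
      show "integrable M (\<lambda>s. (h s)\<^sup>2 / 64 + 16 * indicator ?H s)"
        by (intro Bochner_Integration.integrable_add integrable_divide integrable_mult_right h2 ind) measurable
    qed (use h in auto)
    also have "\<dots> = (\<integral>s. (h s)\<^sup>2 / 64 \<partial>M) + (\<integral>s. 16 * indicator ?H s \<partial>M)"
      by (intro Bochner_Integration.integral_add integrable_divide integrable_mult_right h2 ind) measurable
    also have "\<dots> = (\<integral>s. (h s)\<^sup>2 \<partial>M) / 64 + 16 * prob ?H"
      using ind(2)[of ?H] by simp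
    also have "\<dots> \<le> ((\<integral>s. (h s)\<^sup>2 \<partial>M) + 1) / 64" using p by simp
    finally show ?thesis .
  qed
  \<comment> \<open>If \<open>f S\<close> is rarely positive, writing \<open>\<bar>f\<bar>\<close>
    as \<open>2 max 0 f - f\<close> bounds \<open>m S\<close> by \<open>part\<close> and by
    \<open>X S\<close>; the rarely negative case is symmetric. A balanced \<open>S\<close> pays
    \<open>Y S / 16 + 4\<close>. All costs are listed in one bound so that a single sum over
    \<open>S\<close> covers every case.\<close>
  have each: "m S \<le> (Y S + 1) / 32 + (8 * (X S)\<^sup>2 + 1/32) + Y S / 16 + (if bal S then 4 else 0)" for S
  proof -
    have "0 \<le> 8 * (\<bar>X S\<bar> - 1/16)\<^sup>2" by simp
    then have Xle: "\<bar>X S\<bar> \<le> 8 * (X S)\<^sup>2 + 1/32" by (simp add: power2_eq_square algebra_simps)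
    then have Xs: "X S \<le> 8 * (X S)\<^sup>2 + 1/32" "- X S \<le> 8 * (X S)\<^sup>2 + 1/32" "0 \<le> 8 * (X S)\<^sup>2 + 1/32"
      by (auto simp: abs_le_iff)
    have Y0: "Y S \<ge> 0" unfolding Y_def by simp
    consider "bal S" | "prob {s \<in> space M. f S s > 0} < 1/1024" | "prob {s \<in> space M. - f S s > 0} < 1/1024"
      unfolding bal_def f_def by fastforce
    then show ?thesis
    proof cases
      case 1
      have "m S \<le> (\<integral>s. (f S s)\<^sup>2 / 16 + 4 \<partial>M)"
        unfolding m_def
      proof (rule integral_mono)
        fix s
        have "0 \<le> (\<bar>f S s\<bar> / 4 - 2)\<^sup>2" by simp
        then show "\<bar>f S s\<bar> \<le> (f S s)\<^sup>2 / 16 + 4" by (simp add: power2_eq_square algebra_simps)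
      qed (use fa f2 in auto)
      also have "\<dots> = Y S / 16 + 4" using f2 by (simp add: Y_def prob_space)
      finally show ?thesis using 1 Xs Y0 by (simp only: if_True) argo
    next
      case 2
      have "m S = (\<integral>s. 2 * max 0 (f S s) - f S s \<partial>M)"
        unfolding m_def by (intro Bochner_Integration.integral_cong) auto
      also have "\<dots> = 2 * (\<integral>s. max 0 (f S s) \<partial>M) - X S" using f1 by (simp add: X_def)
      also have "\<dots> \<le> 2 * ((Y S + 1) / 64) - X S" using part[OF 2 _ f1 f2] by (simp add: Y_def)
      finally show ?thesis using Xs Y0 by (cases "bal S"; simp only: if_True if_False; argo)
    next
      case 3
      have "m S = (\<integral>s. 2 * max 0 (- f S s) + f S s \<partial>M)"
        unfolding m_def by (intro Bochner_Integration.integral_cong) auto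
      also have "\<dots> = 2 * (\<integral>s. max 0 (- f S s) \<partial>M) + X S" using f1 by (simp add: X_def)
      also have "\<dots> \<le> 2 * ((Y S + 1) / 64) + X S" using part[OF 3] f1 f2 by (simp add: Y_def)
      finally show ?thesis using Xs Y0 by (cases "bal S"; simp only: if_True if_False; argo)
    qed
  qed
  \<comment> \<open>On average over \<open>S\<close> the costs other than the last are at most
    \<open>1/16 + 1/16 + 1/16\<close>. This leaves \<open>1/16\<close> out of \<open>1/4\<close> for
    four times the share of balanced sets.\<close>
  have "2 ^ d / 4 \<le> (\<Sum>S\<in>?P. m S)" by (rule sm)
  also have "\<dots> \<le> (\<Sum>S\<in>?P. (Y S + 1) / 32 + (8 * (X S)\<^sup>2 + 1/32) + Y S / 16 + (if bal S then 4 else 0))"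
    by (intro sum_mono each)
  also have "\<dots> = ((\<Sum>S\<in>?P. Y S) + 2 ^ d) / 32 + (8 * (\<Sum>S\<in>?P. (X S)\<^sup>2) + 2 ^ d / 32) + (\<Sum>S\<in>?P. Y S) / 16
      + 4 * real (card {S \<in> ?P. bal S})"
    by (simp add: sum.distrib sum_divide_distrib[symmetric] sum_distrib_left[symmetric] card_Pow
        sum.If_cases Int_def conj_commute)
  finally show ?thesis using sX sY by argo
qed

section \<open>Isotropic position\<close>

text \<open>Over an orthonormal basis of vectors \<open>e\<close> the left-hand sides add up to at
  most \<open>J\<close>, so \<open>J / d\<close> bounds their average, and the claim is that no
  direction exceeds four times this. Maximality up to the error \<open>J / d\<close> suffices:
  contracting along \<open>e\<close> costs at most \<open>2 J / d\<close> in the determinant term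
  and gains \<open>3/4\<close> of the left-hand side \<open>?T\<close>, so
  \<open>3/4 ?T <= J / d + 2 J / d\<close>. No maximiser has to exist.\<close>

lemma (in prob_space) isotropic_position:
  fixes b :: "nat \<Rightarrow> nat \<Rightarrow> 'a \<Rightarrow> real"
  assumes meas[measurable]: "\<And>j k. b j k \<in> borel_measurable M"
    and bdd: "\<And>j k s. j < J \<Longrightarrow> k < d \<Longrightarrow> s \<in> space M \<Longrightarrow> \<bar>b j k s\<bar> \<le> K"
    and d: "d > 0" and J: "J > 0" and \<delta>: "\<delta> > 0"
  obtains A where "abs_det d A > 0"
    "\<And>e. (\<Sum>i<d. (e i)\<^sup>2) = 1 \<Longrightarrow>
      (\<Sum>j<J. \<integral>s. (\<Sum>i<d. e i * (\<Sum>k<d. A i k * b j k s))\<^sup>2 /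
        ((\<Sum>i<d. (\<Sum>k<d. A i k * b j k s)\<^sup>2) + \<delta> * (\<Sum>i<d. \<Sum>k<d. (A i k)\<^sup>2)) \<partial>M) \<le> 4 * J / d"
proof -
  define N where "N A = (\<Sum>i<d. \<Sum>k<d. (A i k)\<^sup>2)" for A :: "nat \<Rightarrow> nat \<Rightarrow> real"
  define \<phi> where "\<phi> A j i s = (\<Sum>k<d. A i k * b j k s)" for A :: "nat \<Rightarrow> nat \<Rightarrow> real" and j i s
  define q where "q A j s = (\<Sum>i<d. (\<phi> A j i s)\<^sup>2) + \<delta> * N A" for A j s
  have [measurable]: "\<phi> A j i \<in> borel_measurable M" for A j i unfolding \<phi>_def by measurable
  have [measurable]: "q A j \<in> borel_measurable M" for A j unfolding q_def by measurable
  have bint: "integrable M g" if "g \<in> borel_measurable M" "\<And>s. s \<in> space M \<Longrightarrow> \<bar>g s\<bar> \<le> B" for g :: "'a \<Rightarrow> real" and B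
    by (rule integrable_const_bound[where B = B]) (use that in auto)
  have N0: "N A \<ge> 0" for A unfolding N_def by (intro sum_nonneg) auto
  have Npos: "N A > 0" if "abs_det d A > 0" for A
  proof (rule ccontr)
    assume "\<not> N A > 0"
    then have "N A = 0" using N0[of A] by simp
    then show False using abs_det_le[of d A] that d by (simp add: N_def zero_power)
  qed
  have qge: "q A j s \<ge> \<delta> * N A" for A j s unfolding q_def by (simp add: sum_nonneg)
  have \<phi>b: "\<exists>U. \<forall>j<J. \<forall>i<d. \<forall>s\<in>space M. \<bar>\<phi> A j i s\<bar> \<le> U" for A
  proof (intro exI allI impI ballI)
    fix j i s assume *: "j < J" "i < d" "s \<in> space M"
    have "\<bar>\<phi> A j i s\<bar> \<le> (\<Sum>k<d. \<bar>A i k * b j k s\<bar>)" unfolding \<phi>_def by (rule sum_abs)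
    also have "\<dots> \<le> (\<Sum>k<d. \<bar>A i k\<bar> * K)"
      by (intro sum_mono) (use bdd * in \<open>auto simp: abs_mult intro!: mult_left_mono\<close>)
    also have "\<dots> \<le> (\<Sum>i<d. \<Sum>k<d. \<bar>A i k\<bar> * \<bar>K\<bar>)"
      by (rule order_trans[OF _ member_le_sum[of i]])
         (use * in \<open>auto intro!: sum_mono mult_left_mono sum_nonneg\<close>)
    finally show "\<bar>\<phi> A j i s\<bar> \<le> (\<Sum>i<d. \<Sum>k<d. \<bar>A i k\<bar> * \<bar>K\<bar>)" .
  qed
  have lnq: "integrable M (\<lambda>s. ln (q A j s))" if "abs_det d A > 0" "j < J" for A j
  proof -
    obtain U where U: "\<forall>j<J. \<forall>i<d. \<forall>s\<in>space M. \<bar>\<phi> A j i s\<bar> \<le> U" using \<phi>b[of A] by (elim exE)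
    define L where "L = \<delta> * N A"
    define R where "R = real d * U\<^sup>2 + L"
    have L: "L > 0" using Npos[OF that(1)] \<delta> by (simp add: L_def)
    show ?thesis
    proof (rule bint)
      fix s assume s: "s \<in> space M"
      have "(\<Sum>i<d. (\<phi> A j i s)\<^sup>2) \<le> (\<Sum>i<d. U\<^sup>2)"
        using U that(2) s by (intro sum_mono) (auto simp: abs_le_square_iff[symmetric] intro: order_trans[OF _ abs_ge_self])
      then have q: "L \<le> q A j s" "q A j s \<le> R" using qge[of A j s] by (auto simp: q_def R_def L_def)
      then have "ln L \<le> ln (q A j s)" "ln (q A j s) \<le> ln R" using L by simp_all
      then show "\<bar>ln (q A j s)\<bar> \<le> max \<bar>ln L\<bar> \<bar>ln R\<bar>" by auto
    qed measurable
  qed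
  \<comment> \<open>Stationarity of \<open>G\<close> means isotropy. The term with \<open>\<delta>\<close> in \<open>q\<close> bounds \<open>G\<close> from above; a step
    \<open>A \<mapsto> (1 - e e\<^sup>T / 2) A\<close> from a point where \<open>G\<close> is almost maximal cannot increase \<open>G\<close> much.\<close>
  define G where "G A = 2 * J / d * ln (abs_det d A) - (\<Sum>j<J. \<integral>s. ln (q A j s) \<partial>M)" for A
  \<comment> \<open>\<open>G\<close> is invariant under scaling of \<open>A\<close>: the bounds for
    its two terms both contain \<open>J * ln (N A)\<close>, which cancels.\<close>
  have Gle: "G A \<le> 2 * J / d * ln (fact d) - J * ln \<delta>" if v: "abs_det d A > 0" for A
  proof -
    have np: "N A > 0" by (rule Npos[OF v])
    have "ln (abs_det d A) \<le> ln (fact d * sqrt (N A) ^ d)"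
      using abs_det_le[of d A] v by (simp add: N_def)
    also have "\<dots> = ln (fact d) + d * ln (sqrt (N A))"
      using np by (subst ln_mult) (auto simp: ln_realpow)
    also have "\<dots> = ln (fact d) + d * ln (N A) / 2" using np by (simp add: ln_sqrt)
    finally have "2 * J / d * ln (abs_det d A) \<le> 2 * J / d * (ln (fact d) + d * ln (N A) / 2)"
      by (intro mult_left_mono) auto
    also have "\<dots> = 2 * J / d * ln (fact d) + J * ln (N A)" using d by (simp add: field_simps)
    finally have 1: "2 * J / d * ln (abs_det d A) \<le> 2 * J / d * ln (fact d) + J * ln (N A)" .
    have "(\<Sum>j<J. ln (\<delta> * N A)) \<le> (\<Sum>j<J. \<integral>s. ln (q A j s) \<partial>M)"
    proof (rule sum_mono)
      fix j assume j: "j \<in> {..<J}"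
      have "ln (\<delta> * N A) = (\<integral>s. ln (\<delta> * N A) \<partial>M)" by (simp add: prob_space)
      also have "\<dots> \<le> (\<integral>s. ln (q A j s) \<partial>M)"
      proof (rule integral_mono)
        fix s show "ln (\<delta> * N A) \<le> ln (q A j s)"
          using qge[of A j s] np \<delta> by (subst ln_le_cancel_iff) (auto intro: less_le_trans[of 0 "\<delta> * N A"])
      qed (use lnq[OF v] j in auto)
      finally show "ln (\<delta> * N A) \<le> (\<integral>s. ln (q A j s) \<partial>M)" .
    qed
    then have "J * (ln \<delta> + ln (N A)) \<le> (\<Sum>j<J. \<integral>s. ln (q A j s) \<partial>M)"
      using np \<delta> by (simp add: ln_mult)
    then show ?thesis using 1 by (simp add: G_def algebra_simps)
  qed
  let ?S = "G ` {A. abs_det d A > 0}"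
  have ne: "?S \<noteq> {}" using abs_det_identity[of d] by (auto intro!: exI[of _ "\<lambda>i k. if i = k then 1 else 0"])
  have bd: "bdd_above ?S" by (rule bdd_aboveI[where M = "2 * J / d * ln (fact d) - J * ln \<delta>"]) (use Gle in auto)
  have "Sup ?S - J / d < Sup ?S" using J d by simp
  then obtain A where A: "abs_det d A > 0" "Sup ?S - J / d < G A"
    using less_cSup_iff[OF ne bd] by auto
  have near: "G A' \<le> G A + J / d" if "abs_det d A' > 0" for A'
    using cSup_upper[OF _ bd, of "G A'"] A(2) that by auto
  have "(\<Sum>j<J. \<integral>s. (\<Sum>i<d. e i * \<phi> A j i s)\<^sup>2 / q A j s \<partial>M) \<le> 4 * J / d"
    if e: "(\<Sum>i<d. (e i)\<^sup>2) = 1" for e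
  proof -
    define A' where "A' = (\<lambda>i k. A i k - e i * (\<Sum>l<d. e l * A l k) / 2)"
    have v': "abs_det d A' = abs_det d A / 2" unfolding A'_def by (rule abs_det_contract[OF e])
    then have vp: "abs_det d A' > 0" using A by simp
    \<comment> \<open>Halving the component along \<open>e\<close> leaves a quarter of its
      square.\<close>
    have shrink: "(\<Sum>i<d. (x i - e i * (\<Sum>l<d. e l * x l) / 2)\<^sup>2) = (\<Sum>i<d. (x i)\<^sup>2) - 3/4 * (\<Sum>i<d. e i * x i)\<^sup>2"
      for x :: "nat \<Rightarrow> real"
    proof -
      let ?L = "\<Sum>l<d. e l * x l"
      have "(\<Sum>i<d. (x i - e i * ?L / 2)\<^sup>2) = (\<Sum>i<d. (x i)\<^sup>2 - ?L * (e i * x i) + ?L\<^sup>2 / 4 * (e i)\<^sup>2)"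
        by (intro sum.cong) (auto simp: power2_eq_square field_simps)
      also have "\<dots> = (\<Sum>i<d. (x i)\<^sup>2) - ?L * ?L + ?L\<^sup>2 / 4 * (\<Sum>i<d. (e i)\<^sup>2)"
        by (simp only: sum.distrib sum_subtractf sum_distrib_left[symmetric])
      finally show ?thesis unfolding e by (simp add: power2_eq_square)
    qed
    have "N A' = (\<Sum>k<d. \<Sum>i<d. (A' i k)\<^sup>2)" unfolding N_def by (rule sum.swap)
    also have "\<dots> \<le> (\<Sum>k<d. \<Sum>i<d. (A i k)\<^sup>2)"
    proof (rule sum_mono)
      fix k
      show "(\<Sum>i<d. (A' i k)\<^sup>2) \<le> (\<Sum>i<d. (A i k)\<^sup>2)"
        using shrink[of "\<lambda>i. A i k"] by (simp add: A'_def)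
    qed
    also have "\<dots> = N A" unfolding N_def by (rule sum.swap)
    finally have NN: "N A' \<le> N A" .
    define L where "L j s = (\<Sum>i<d. e i * \<phi> A j i s)" for j s
    have [measurable]: "L j \<in> borel_measurable M" for j unfolding L_def by measurable
    have \<phi>': "\<phi> A' j i s = \<phi> A j i s - e i * (\<Sum>l<d. e l * \<phi> A j l s) / 2" for j i s
    proof -
      have "(\<Sum>k<d. e i * (\<Sum>l<d. e l * A l k) / 2 * b j k s) = e i * (\<Sum>l<d. e l * (\<Sum>k<d. A l k * b j k s)) / 2"
        unfolding sum_distrib_left sum_distrib_right sum_divide_distrib
        by (subst sum.swap) (simp add: algebra_simps)
      then show ?thesis by (simp add: \<phi>_def A'_def left_diff_distrib sum_subtractf)
    qed
    have qq: "q A' j s \<le> q A j s - 3/4 * (L j s)\<^sup>2" for j s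
      unfolding q_def \<phi>' shrink L_def using NN \<delta> by (simp add: mult_left_mono)
    have qp: "q A j s > 0" "q A' j s > 0" for j s
      using qge[of A j s] qge[of A' j s] Npos[OF A(1)] Npos[OF vp] \<delta> by (auto intro: less_le_trans[OF mult_pos_pos])
    have Lq: "3/4 * ((L j s)\<^sup>2 / q A j s) \<le> 1" for j s
      using qq[of j s] qp[of j s] by (simp add: field_simps)
    have Li: "integrable M (\<lambda>s. (L j s)\<^sup>2 / q A j s)" for j
    proof (rule bint[of _ "4/3"])
      fix s
      have "0 \<le> (L j s)\<^sup>2 / q A j s" using qp(1)[of j s] by simp
      then show "\<bar>(L j s)\<^sup>2 / q A j s\<bar> \<le> 4/3" using Lq[of j s] by linarith
    qed measurable
    have step: "(\<integral>s. ln (q A' j s) \<partial>M) \<le> (\<integral>s. ln (q A j s) \<partial>M) - 3/4 * (\<integral>s. (L j s)\<^sup>2 / q A j s \<partial>M)"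
      if j: "j < J" for j
    proof -
      have "(\<integral>s. ln (q A' j s) \<partial>M) \<le> (\<integral>s. ln (q A j s) - 3/4 * ((L j s)\<^sup>2 / q A j s) \<partial>M)"
      proof (rule integral_mono)
        fix s
        have "ln (q A' j s) - ln (q A j s) = ln (q A' j s / q A j s)" using qp(1)[of j s] qp(2)[of j s] by (simp add: ln_div)
        also have "\<dots> \<le> q A' j s / q A j s - 1" using qp(1)[of j s] qp(2)[of j s] by (intro ln_le_minus_one) simp
        also have "\<dots> \<le> (q A j s - 3/4 * (L j s)\<^sup>2) / q A j s - 1"
          using qq[of j s] qp(1)[of j s] by (simp add: divide_right_mono)
        also have "\<dots> = - (3/4 * ((L j s)\<^sup>2 / q A j s))" using qp(1)[of j s] by (simp add: field_simps)
        finally show "ln (q A' j s) \<le> ln (q A j s) - 3/4 * ((L j s)\<^sup>2 / q A j s)" by linarith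
      next
        show "integrable M (\<lambda>s. ln (q A j s) - 3/4 * ((L j s)\<^sup>2 / q A j s))"
          by (intro Bochner_Integration.integrable_diff integrable_mult_right Li lnq[OF A(1) j])
      qed (use lnq[OF vp j] in auto)
      then show ?thesis
        by (subst (asm) Bochner_Integration.integral_diff[OF lnq[OF A(1) j] integrable_mult_right[OF Li]])
           (simp only: integral_mult_right_zero)
    qed
    let ?T = "\<Sum>j<J. \<integral>s. (L j s)\<^sup>2 / q A j s \<partial>M"
    have "(\<Sum>j<J. \<integral>s. ln (q A' j s) \<partial>M) \<le> (\<Sum>j<J. (\<integral>s. ln (q A j s) \<partial>M) - 3/4 * (\<integral>s. (L j s)\<^sup>2 / q A j s \<partial>M))"
      by (intro sum_mono step) simp
    also have "\<dots> = (\<Sum>j<J. \<integral>s. ln (q A j s) \<partial>M) - 3/4 * ?T"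
      by (simp add: sum_subtractf sum_distrib_left)
    finally have "(\<Sum>j<J. \<integral>s. ln (q A' j s) \<partial>M) \<le> (\<Sum>j<J. \<integral>s. ln (q A j s) \<partial>M) - 3/4 * ?T" .
    moreover have "2 * J / d * ln (abs_det d A') = 2 * J / d * ln (abs_det d A) - 2 * J / d * ln 2"
      using A(1) by (simp add: v' ln_div right_diff_distrib)
    moreover have "2 * J / d * ln 2 \<le> 2 * J / d * 1"
      using ln_le_minus_one[of "2::real"] by (intro mult_left_mono) auto
    ultimately have "G A' \<ge> G A - 2 * J / d + 3/4 * ?T" unfolding G_def by linarith
    then have "3/4 * ?T \<le> J / d + 2 * J / d" using near[OF vp] by linarith
    moreover have "2 * J / d = 2 * (J / d)" "4 * J / d = 4 * (J / d)" by simp_all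
    ultimately have "?T \<le> 4 * J / d" by linarith
    then show ?thesis by (simp add: L_def)
  qed
  then show ?thesis using A(1) by (intro that[of A]) (auto simp: q_def \<phi>_def N_def)
qed

text \<open>Division by the positive number \<open>sqrt (q j s)\<close> does not change signs, so
  balance of the normalised vectors \<open>u\<close> is balance of a true combination of the
  functions \<open>b\<close>, with coefficients \<open>C S\<close>. As each tile is balanced by a
  share \<open>1/64\<close> of all \<open>S\<close>, averaging the balanced weight over
  \<open>S\<close> yields one good \<open>S\<close>. The condition \<open>d >= 1024 * J\<close>
  makes \<open>4 * J / d\<close> at most \<open>1/256\<close>, so the isotropy bound for the sum
  over all tiles serves each single tile.\<close>

lemma (in prob_space) balanced_combination:
  fixes b :: "nat \<Rightarrow> nat \<Rightarrow> 'a \<Rightarrow> real" and w :: "nat \<Rightarrow> real"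
  assumes meas[measurable]: "\<And>j k. b j k \<in> borel_measurable M"
    and bdd: "\<And>j k s. j < J \<Longrightarrow> k < d \<Longrightarrow> s \<in> space M \<Longrightarrow> \<bar>b j k s\<bar> \<le> K"
    and null: "\<And>j c. j < J \<Longrightarrow> (\<Sum>k<d. (c k)\<^sup>2) = (1::real) \<Longrightarrow> AE s in M. (\<Sum>k<d. c k * b j k s) \<noteq> 0"
    and J: "J > 0" and dJ: "d \<ge> 1024 * J" and w: "\<And>j. w j \<ge> 0"
  defines "bal \<equiv> (\<lambda>c j. prob {s \<in> space M. (\<Sum>k<d. c k * b j k s) > 0} \<ge> 1/1024 \<and>
                    prob {s \<in> space M. (\<Sum>k<d. c k * b j k s) < 0} \<ge> 1/1024)"
  shows "\<exists>c. (\<Sum>j | j < J \<and> bal c j. w j) \<ge> (\<Sum>j<J. w j) / 64"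
proof -
  have d: "d > 0" using J dJ by simp
  have "\<exists>\<delta>>0. \<forall>c. (\<Sum>k<d. (c k)\<^sup>2) = 1 \<longrightarrow> prob {s \<in> space M. \<bar>\<Sum>k<d. c k * b j k s\<bar> \<le> \<delta>} \<le> 1/10" if j: "j < J" for j
  proof -
    obtain \<delta> where "\<delta> > 0" "\<And>c. (\<Sum>k<d. (c k)\<^sup>2) = 1 \<Longrightarrow> prob {s \<in> space M. \<bar>\<Sum>k<d. c k * b j k s\<bar> \<le> \<delta>} \<le> 1/10"
      by (rule uniform_sublevel[of "b j" d K "1/10"]) (use bdd[OF j] null[OF j] in auto)
    then show ?thesis by auto
  qed
  then have "\<forall>j\<in>{..<J}. \<exists>\<delta>. \<delta> > 0 \<and> (\<forall>c. (\<Sum>k<d. (c k)\<^sup>2) = 1 \<longrightarrow> prob {s \<in> space M. \<bar>\<Sum>k<d. c k * b j k s\<bar> \<le> \<delta>} \<le> 1/10)"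
    by simp
  from bchoice[OF this] obtain D where D: "\<forall>j\<in>{..<J}. D j > 0 \<and> (\<forall>c. (\<Sum>k<d. (c k)\<^sup>2) = 1 \<longrightarrow> prob {s \<in> space M. \<bar>\<Sum>k<d. c k * b j k s\<bar> \<le> D j} \<le> 1/10)"
    by (elim exE)
  define \<delta>0 where "\<delta>0 = Min (D ` {..<J})"
  have \<delta>0: "\<delta>0 > 0" unfolding \<delta>0_def using J D by (subst Min_gr_iff) auto
  have small: "prob {s \<in> space M. \<bar>\<Sum>k<d. c k * b j k s\<bar> \<le> \<delta>0} \<le> 1/10"
    if "j < J" "(\<Sum>k<d. (c k)\<^sup>2) = 1" for j c
  proof -
    have "\<delta>0 \<le> D j" unfolding \<delta>0_def using that by (intro Min_le) auto
    then have "prob {s \<in> space M. \<bar>\<Sum>k<d. c k * b j k s\<bar> \<le> \<delta>0} \<le> prob {s \<in> space M. \<bar>\<Sum>k<d. c k * b j k s\<bar> \<le> D j}"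
      by (intro finite_measure_mono) auto
    also have "\<dots> \<le> 1/10" using D that by auto
    finally show ?thesis .
  qed
  \<comment> \<open>Some row of \<open>A\<close> has squared norm at least \<open>N A / d\<close>,
    and outside an event of probability \<open>1/10\<close> its combination exceeds
    \<open>\<delta>0\<close> times that norm. With this \<open>\<delta>\<close> the term
    \<open>\<delta> * N A\<close> is then at most the sum of squares in \<open>q\<close>, so
    \<open>u\<close> has squared length at least \<open>1/2\<close>.\<close>
  define \<delta> where "\<delta> = \<delta>0\<^sup>2 / d"
  have \<delta>: "\<delta> > 0" using \<delta>0 d by (simp add: \<delta>_def)
  define N where "N A = (\<Sum>i<d. \<Sum>k<d. (A i k)\<^sup>2)" for A :: "nat \<Rightarrow> nat \<Rightarrow> real"
  define \<phi> where "\<phi> A j i s = (\<Sum>k<d. A i k * b j k s)" for A :: "nat \<Rightarrow> nat \<Rightarrow> real" and j i s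
  obtain A where A: "abs_det d A > 0" and iso0: "\<And>e. (\<Sum>i<d. (e i)\<^sup>2) = 1 \<Longrightarrow>
      (\<Sum>j<J. \<integral>s. (\<Sum>i<d. e i * \<phi> A j i s)\<^sup>2 / ((\<Sum>i<d. (\<phi> A j i s)\<^sup>2) + \<delta> * N A) \<partial>M) \<le> 4 * J / d"
    unfolding \<phi>_def N_def
    by (rule isotropic_position[OF meas bdd d J \<delta>]) auto
  define q where "q j s = (\<Sum>i<d. (\<phi> A j i s)\<^sup>2) + \<delta> * N A" for j s
  have [measurable]: "\<phi> A j i \<in> borel_measurable M" for j i unfolding \<phi>_def by measurable
  have [measurable]: "q j \<in> borel_measurable M" for j unfolding q_def by measurable
  have Npos: "N A > 0"
  proof (rule ccontr)
    assume "\<not> N A > 0"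
    moreover have "N A \<ge> 0" unfolding N_def by (intro sum_nonneg) auto
    ultimately have "N A = 0" by simp
    then show False using abs_det_le[of d A] A d by (simp add: N_def zero_power)
  qed
  have qpos: "q j s > 0" for j s unfolding q_def using \<delta> Npos by (intro add_nonneg_pos) (auto intro: sum_nonneg)
  define u where "u j i s = \<phi> A j i s / sqrt (q j s)" for j i s
  have [measurable]: "u j i \<in> borel_measurable M" for j i unfolding u_def by measurable
  have u2: "(\<Sum>i<d. (u j i s)\<^sup>2) = (\<Sum>i<d. (\<phi> A j i s)\<^sup>2) / q j s" for j s
    using qpos[of j s] by (simp add: u_def power_divide sum_divide_distrib)
  define Bl where "Bl S j \<longleftrightarrow> prob {s \<in> space M. signed_sum d S (\<lambda>i. u j i s) > 0} \<ge> 1/1024 \<and>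
                    prob {s \<in> space M. signed_sum d S (\<lambda>i. u j i s) < 0} \<ge> 1/1024" for S j
  have many: "real (card {S \<in> Pow {..<d}. Bl S j}) \<ge> 2 ^ d / 64" if j: "j < J" for j
    unfolding Bl_def
  proof (rule random_signs_balanced)
    fix s
    show "(\<Sum>i<d. (u j i s)\<^sup>2) \<le> 1"
      unfolding u2 using qpos[of j s] \<delta> Npos by (simp add: q_def)
  next
    fix e :: "nat \<Rightarrow> real" assume e: "(\<Sum>i<d. (e i)\<^sup>2) = 1"
    have eq: "(\<Sum>i<d. e i * u j' i s)\<^sup>2 = (\<Sum>i<d. e i * \<phi> A j' i s)\<^sup>2 / q j' s" for j' s
    proof -
      have "(\<Sum>i<d. e i * u j' i s) = (\<Sum>i<d. e i * \<phi> A j' i s) / sqrt (q j' s)"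
        by (simp add: u_def sum_divide_distrib)
      then show ?thesis using qpos[of j' s] by (simp add: power_divide)
    qed
    have "(\<integral>s. (\<Sum>i<d. e i * u j i s)\<^sup>2 \<partial>M) \<le> (\<Sum>j'<J. \<integral>s. (\<Sum>i<d. e i * u j' i s)\<^sup>2 \<partial>M)"
      by (rule member_le_sum[of j "{..<J}" "\<lambda>j'. \<integral>s. (\<Sum>i<d. e i * u j' i s)\<^sup>2 \<partial>M"]) (use j in auto)
    also have "\<dots> \<le> 4 * J / d" unfolding eq using iso0[OF e] by (simp add: q_def)
    also have "\<dots> \<le> 1/256" using dJ d by (simp add: field_simps)
    finally show "(\<integral>s. (\<Sum>i<d. e i * u j i s)\<^sup>2 \<partial>M) \<le> 1/256" .
  next
    have "\<exists>i<d. (\<Sum>k<d. (A i k)\<^sup>2) \<ge> N A / d"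
    proof (rule ccontr)
      assume "\<not> ?thesis"
      then have "(\<Sum>i<d. \<Sum>k<d. (A i k)\<^sup>2) < (\<Sum>i<d. N A / d)" using d by (intro sum_strict_mono) auto
      then show False using d by (simp add: N_def)
    qed
    then obtain i where i: "i < d" "(\<Sum>k<d. (A i k)\<^sup>2) \<ge> N A / d" by auto
    define r where "r = sqrt (\<Sum>k<d. (A i k)\<^sup>2)"
    have "N A / d > 0" using Npos d by simp
    then have r2: "r\<^sup>2 = (\<Sum>k<d. (A i k)\<^sup>2)" and rpos: "r > 0" using i(2) by (auto simp: r_def sum_nonneg)
    have "prob {s \<in> space M. (\<Sum>i<d. (u j i s)\<^sup>2) < 1/2} \<le> prob {s \<in> space M. \<bar>\<Sum>k<d. A i k / r * b j k s\<bar> \<le> \<delta>0}"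
    proof (rule finite_measure_mono)
      show "{s \<in> space M. (\<Sum>i<d. (u j i s)\<^sup>2) < 1/2} \<subseteq> {s \<in> space M. \<bar>\<Sum>k<d. A i k / r * b j k s\<bar> \<le> \<delta>0}"
      proof safe
        fix s assume "(\<Sum>i<d. (u j i s)\<^sup>2) < 1/2"
        then have "(\<Sum>i<d. (\<phi> A j i s)\<^sup>2) < \<delta> * N A" using qpos[of j s] by (simp add: u2 q_def field_simps)
        moreover have "(\<phi> A j i s)\<^sup>2 \<le> (\<Sum>i<d. (\<phi> A j i s)\<^sup>2)" using i(1) by (intro member_le_sum) auto
        moreover have "\<delta> * N A \<le> \<delta>0\<^sup>2 * r\<^sup>2"
          using mult_left_mono[OF i(2), of "\<delta>0\<^sup>2"] d by (simp add: \<delta>_def r2)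
        ultimately have "(\<phi> A j i s)\<^sup>2 \<le> (\<delta>0 * r)\<^sup>2" by (simp add: power_mult_distrib)
        then have "\<bar>\<phi> A j i s\<bar> \<le> \<delta>0 * r" using \<delta>0 rpos by (simp add: abs_le_square_iff[symmetric])
        moreover have "(\<Sum>k<d. A i k / r * b j k s) = \<phi> A j i s / r" by (simp add: \<phi>_def sum_divide_distrib)
        ultimately show "\<bar>\<Sum>k<d. A i k / r * b j k s\<bar> \<le> \<delta>0"
          by (simp only: abs_divide abs_of_pos[OF rpos] pos_divide_le_eq[OF rpos])
      qed
    qed measurable
    also have "\<dots> \<le> 1/10"
    proof (rule small[OF j])
      have "(\<Sum>k<d. (A i k / r)\<^sup>2) = (\<Sum>k<d. (A i k)\<^sup>2) / r\<^sup>2" by (simp add: power_divide sum_divide_distrib)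
      then show "(\<Sum>k<d. (A i k / r)\<^sup>2) = 1" using rpos by (simp add: r2[symmetric])
    qed
    finally show "prob {s \<in> space M. (\<Sum>i<d. (u j i s)\<^sup>2) < 1/2} \<le> 1/10" .
  qed measurable
  define C where "C S k = (\<Sum>i<d. (if i \<in> S then 1 else -1) * A i k)" for S k
  have Bl_bal: "bal (C S) j" if "Bl S j" for S j
  proof -
    have "signed_sum d S (\<lambda>i. u j i s) = (\<Sum>k<d. C S k * b j k s) / sqrt (q j s)" for s
    proof -
      have "(\<Sum>k<d. C S k * b j k s) = (\<Sum>i<d. (if i \<in> S then 1 else -1) * \<phi> A j i s)"
        unfolding C_def \<phi>_def sum_distrib_left sum_distrib_right by (subst sum.swap) (simp add: mult.assoc)
      then show ?thesis by (simp add: signed_sum_def u_def sum_divide_distrib)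
    qed
    then have "signed_sum d S (\<lambda>i. u j i s) > 0 \<longleftrightarrow> (\<Sum>k<d. C S k * b j k s) > 0"
      "signed_sum d S (\<lambda>i. u j i s) < 0 \<longleftrightarrow> (\<Sum>k<d. C S k * b j k s) < 0" for s
      using qpos[of j s] by (simp_all add: zero_less_divide_iff divide_less_0_iff)
    then show ?thesis using that by (simp add: Bl_def bal_def)
  qed
  let ?W = "\<Sum>j<J. w j"
  have "2 ^ d * (?W / 64) = ?W * (2 ^ d / 64)" by simp
  also have "\<dots> = (\<Sum>j<J. w j * (2 ^ d / 64))" by (rule sum_distrib_right)
  also have "\<dots> \<le> (\<Sum>j<J. w j * real (card {S \<in> Pow {..<d}. Bl S j}))"
    by (intro sum_mono mult_left_mono many w) auto
  also have "\<dots> = (\<Sum>j<J. \<Sum>S\<in>Pow {..<d}. if Bl S j then w j else 0)"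
    by (intro sum.cong refl) (simp add: sum.If_cases Int_def mult.commute)
  also have "\<dots> = (\<Sum>S\<in>Pow {..<d}. \<Sum>j<J. if Bl S j then w j else 0)" by (rule sum.swap)
  finally have tot: "2 ^ d * (?W / 64) \<le> (\<Sum>S\<in>Pow {..<d}. \<Sum>j<J. if Bl S j then w j else 0)" .
  have "\<exists>S\<in>Pow {..<d}. ?W / 64 \<le> (\<Sum>j<J. if Bl S j then w j else 0)"
  proof (rule ccontr)
    assume "\<not> ?thesis"
    then have "(\<Sum>S\<in>Pow {..<d}. \<Sum>j<J. if Bl S j then w j else 0) < (\<Sum>S\<in>Pow {..<d}. ?W / 64)"
      by (intro sum_strict_mono) (auto simp: not_le[symmetric])
    then show False using tot by (simp add: card_Pow)
  qed
  then obtain S where S: "?W / 64 \<le> (\<Sum>j<J. if Bl S j then w j else 0)" by auto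
  also have "\<dots> \<le> (\<Sum>j<J. if bal (C S) j then w j else 0)"
    using Bl_bal w by (intro sum_mono) auto
  also have "\<dots> = (\<Sum>j | j < J \<and> bal (C S) j. w j)"
    by (simp add: sum.If_cases Int_def)
  finally show ?thesis by (intro exI[of _ "C S"])
qed

section \<open>Sign changes along the axes of a cube\<close>

text \<open>\<open>a\<close> weighs the start of a walk, \<open>b\<close> its end, and
  \<open>c1\<close>, \<open>c2\<close>, \<open>c3\<close> pay for its three legs, each of which
  changes one coordinate. The six variables are independent and every term on the right sees three
  of them, so the others integrate to 1.\<close>

lemma nn_integral_crossing:
  fixes a b c1 c2 c3 :: "real \<times> real \<times> real \<Rightarrow> ennreal"
  assumes M: "prob_space M" and sets[measurable_cong]: "sets M = sets borel"
  defines "M3 \<equiv> M \<Otimes>\<^sub>M (M \<Otimes>\<^sub>M M)"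
  assumes "a \<in> borel_measurable borel" "b \<in> borel_measurable borel"
    "c1 \<in> borel_measurable borel" "c2 \<in> borel_measurable borel" "c3 \<in> borel_measurable borel"
    and le: "\<And>x1 y1 x2 y2 x3 y3. a (x1,x2,x3) * b (y1,y2,y3) \<le> c1 (x1,x2,x3) + c2 (y1,x2,x3) + c3 (y1,y2,x3)"
  shows "(\<integral>\<^sup>+s. a s \<partial>M3) * (\<integral>\<^sup>+s. b s \<partial>M3)
    \<le> (\<integral>\<^sup>+s. c1 s \<partial>M3) + (\<integral>\<^sup>+s. c2 s \<partial>M3) + (\<integral>\<^sup>+s. c3 s \<partial>M3)"
proof -
  interpret prob_space M by fact
  interpret P: pair_prob_space M M ..
  have [simp]: "space M = UNIV" using sets_eq_imp_space_eq[OF sets] by simp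
  have M3: "sets (M \<Otimes>\<^sub>M (M \<Otimes>\<^sub>M M)) = sets borel"
    by (simp add: borel_prod[symmetric] sets cong: sets_pair_measure_cong)
  have borelD: "f \<in> borel_measurable (M \<Otimes>\<^sub>M (M \<Otimes>\<^sub>M M))" if "f \<in> borel_measurable borel"
    for f :: "real \<times> real \<times> real \<Rightarrow> ennreal"
    using that M3 by (simp cong: measurable_cong_sets)
  note [measurable] = assms(4-8)[THEN borelD]
  have triple: "(\<integral>\<^sup>+s. f s \<partial>M3) = (\<integral>\<^sup>+x. \<integral>\<^sup>+y. \<integral>\<^sup>+z. f (x,y,z) \<partial>M \<partial>M \<partial>M)"
    if f[measurable]: "f \<in> borel_measurable (M \<Otimes>\<^sub>M (M \<Otimes>\<^sub>M M))" for f
  proof -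
    have "(\<integral>\<^sup>+s. f s \<partial>M3) = (\<integral>\<^sup>+x. \<integral>\<^sup>+q. f (x,q) \<partial>(M \<Otimes>\<^sub>M M) \<partial>M)"
      unfolding M3_def by (subst P.nn_integral_fst[symmetric]) measurable
    also have "\<dots> = (\<integral>\<^sup>+x. \<integral>\<^sup>+y. \<integral>\<^sup>+z. f (x,y,z) \<partial>M \<partial>M \<partial>M)"
      by (intro nn_integral_cong, subst nn_integral_fst[symmetric])
         (auto intro: measurable_compose[OF measurable_Pair1' f])
    finally show ?thesis .
  qed
  \<comment> \<open>Each of the points \<open>(x1,x2,x3)\<close>, \<open>(y1,x2,x3)\<close>, \<open>(y1,y2,x3)\<close>, \<open>(y1,y2,y3)\<close> lists its coordinates
    in the order of integration, so no exchange of integrals is needed.\<close>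
  let ?I = "\<lambda>g. \<integral>\<^sup>+x1. \<integral>\<^sup>+y1. \<integral>\<^sup>+x2. \<integral>\<^sup>+y2. \<integral>\<^sup>+x3. \<integral>\<^sup>+y3. g x1 y1 x2 y2 x3 y3 \<partial>M \<partial>M \<partial>M \<partial>M \<partial>M \<partial>M"
  have "(\<integral>\<^sup>+s. a s \<partial>M3) * (\<integral>\<^sup>+s. b s \<partial>M3) = ?I (\<lambda>x1 y1 x2 y2 x3 y3. a (x1,x2,x3) * b (y1,y2,y3))"
    by (simp add: triple nn_integral_cmult nn_integral_multc)
  also have "\<dots> \<le> ?I (\<lambda>x1 y1 x2 y2 x3 y3. c1 (x1,x2,x3) + c2 (y1,x2,x3) + c3 (y1,y2,x3))"
    by (intro nn_integral_mono le)
  also have "\<dots> = (\<integral>\<^sup>+s. c1 s \<partial>M3) + (\<integral>\<^sup>+s. c2 s \<partial>M3) + (\<integral>\<^sup>+s. c3 s \<partial>M3)"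
    by (simp add: triple nn_integral_add emeasure_space_1[simplified])
  finally show ?thesis .
qed

definition unit3 :: "(real \<times> real \<times> real) set" where
  "unit3 = {0<..<1} \<times> {0<..<1} \<times> {0<..<1}"

text \<open>A product of uniform measures rather than the uniform measure on \<open>unit3\<close>,
  so that theorems on product measures apply directly; \<open>emeasure_cube_measure\<close>
  identifies the two.\<close>

definition cube_measure :: "(real \<times> real \<times> real) measure" where
  "cube_measure = uniform_measure lborel {0<..<1} \<Otimes>\<^sub>M (uniform_measure lborel {0<..<1} \<Otimes>\<^sub>M uniform_measure lborel {0<..<1})"

lemma open_unit3: "open unit3" unfolding unit3_def by (intro open_Times) auto

lemma sets_cube_measure[measurable_cong]: "sets cube_measure = sets borel"
  unfolding cube_measure_def borel_prod[symmetric] by (intro sets_pair_measure_cong) simp_all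

lemma space_cube_measure[simp]: "space cube_measure = UNIV"
  using sets_eq_imp_space_eq[OF sets_cube_measure] by simp

lemma prob_space_unit: "prob_space (uniform_measure lborel {0<..<1::real})"
  by (rule prob_space_uniform_measure) auto

lemma prob_space_cube_measure: "prob_space cube_measure"
proof -
  interpret U: prob_space "uniform_measure lborel {0<..<1::real}" by (rule prob_space_unit)
  interpret P: pair_prob_space "uniform_measure lborel {0<..<1::real}" "uniform_measure lborel {0<..<1::real}" ..
  interpret Q: pair_prob_space "uniform_measure lborel {0<..<1::real}"
    "uniform_measure lborel {0<..<1::real} \<Otimes>\<^sub>M uniform_measure lborel {0<..<1::real}" ..
  show ?thesis unfolding cube_measure_def by (rule Q.prob_space_axioms)
qed

lemma emeasure_cube_measure:
  assumes [measurable]: "S \<in> sets borel"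
  shows "emeasure cube_measure S = emeasure lborel (S \<inter> unit3)"
proof -
  interpret U: prob_space "uniform_measure lborel {0<..<1::real}" by (rule prob_space_unit)
  interpret P: pair_prob_space "uniform_measure lborel {0<..<1::real}" "uniform_measure lborel {0<..<1::real}" ..
  let ?u = "\<lambda>x::real. indicator {0<..<1} x / emeasure lborel {0<..<1::real} :: ennreal"
  have u: "?u = indicator {0<..<1}" by (auto simp: fun_eq_iff indicator_def divide_ennreal)
  have U: "uniform_measure lborel {0<..<1::real} = density lborel (indicator {0<..<1})"
    unfolding uniform_measure_def u ..
  have 2: "uniform_measure lborel {0<..<1::real} \<Otimes>\<^sub>M uniform_measure lborel {0<..<1::real}
     = density lborel (\<lambda>(x,y). indicator {0<..<1} x * indicator {0<..<1} y)"
    using U.sigma_finite_measure_axioms unfolding U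
    by (subst pair_measure_density) (auto simp: lborel_prod intro: lborel.sigma_finite_measure_axioms)
  have "cube_measure = density lborel (\<lambda>(x,y). indicator {0<..<1} x * (case y of (y, z) \<Rightarrow> indicator {0<..<1} y * indicator {0<..<1} z))"
    using P.sigma_finite_measure_axioms unfolding cube_measure_def 2 unfolding U
    by (subst pair_measure_density) (auto simp: lborel_prod borel_prod[symmetric] intro: lborel.sigma_finite_measure_axioms)
  also have "(\<lambda>(x,y). indicator {0<..<1} x * (case y of (y, z) \<Rightarrow> indicator {0<..<1} y * indicator {0<..<1} z)) = (indicator unit3 :: _ \<Rightarrow> ennreal)"
    by (auto simp: fun_eq_iff unit3_def indicator_def)
  finally have cm: "cube_measure = density lborel (indicator unit3)" .
  have [measurable]: "unit3 \<in> sets borel" using open_unit3 by simp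
  have "emeasure cube_measure S = (\<integral>\<^sup>+x. indicator unit3 x * indicator S x \<partial>lborel)"
    unfolding cm by (rule emeasure_density) measurable
  also have "\<dots> = (\<integral>\<^sup>+x. indicator (S \<inter> unit3) x \<partial>lborel)"
    by (intro nn_integral_cong) (auto simp: indicator_def)
  also have "\<dots> = emeasure lborel (S \<inter> unit3)" by (rule nn_integral_indicator) measurable
  finally show ?thesis .
qed

lemma measure_cube_measure:
  assumes "S \<in> sets borel"
  shows "measure cube_measure S = measure lborel (S \<inter> unit3)"
  using emeasure_cube_measure[OF assms] by (simp add: measure_def)

text \<open>The three sets are cylinders: the coordinate along the axis is free and only the
  parameters \<open>t\<close>, \<open>t'\<close> are confined to the unit interval. The restriction
  to the unit cube is left to \<open>cube_measure\<close>.\<close>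

definition axis_cross1 :: "(real \<times> real \<times> real \<Rightarrow> real) \<Rightarrow> (real \<times> real \<times> real) set" where
  "axis_cross1 F = {(x,y,z). \<exists>t\<in>{0<..<1}. \<exists>t'\<in>{0<..<1}. F (t,y,z) > 0 \<and> F (t',y,z) < 0}"
definition axis_cross2 :: "(real \<times> real \<times> real \<Rightarrow> real) \<Rightarrow> (real \<times> real \<times> real) set" where
  "axis_cross2 F = {(x,y,z). \<exists>t\<in>{0<..<1}. \<exists>t'\<in>{0<..<1}. F (x,t,z) > 0 \<and> F (x,t',z) < 0}"
definition axis_cross3 :: "(real \<times> real \<times> real \<Rightarrow> real) \<Rightarrow> (real \<times> real \<times> real) set" where
  "axis_cross3 F = {(x,y,z). \<exists>t\<in>{0<..<1}. \<exists>t'\<in>{0<..<1}. F (x,y,t) > 0 \<and> F (x,y,t') < 0}"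

text \<open>Each set is a union of open sets over \<open>t\<close> and \<open>t'\<close>; this gives
  measurability without projections of Borel sets.\<close>

lemma open_axis_cross:
  assumes F: "continuous_on UNIV F"
  shows "open (axis_cross1 F)" "open (axis_cross2 F)" "open (axis_cross3 F)"
proof -
  have c: "continuous_on UNIV (\<lambda>s. F (g s))" if "continuous_on UNIV g" for g :: "real \<times> real \<times> real \<Rightarrow> _"
    by (rule continuous_on_compose2[OF F that]) auto
  have o: "open (\<Union>t\<in>{0<..<1::real}. \<Union>t'\<in>{0<..<1::real}. {s. 0 < F (g t s)} \<inter> {s. F (g t' s) < 0})"
    if "\<And>t. continuous_on UNIV (g t)" for g :: "real \<Rightarrow> real \<times> real \<times> real \<Rightarrow> _"
    by (intro open_UN ballI open_Int open_Collect_less c that continuous_on_const)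
  have "axis_cross1 F = (\<Union>t\<in>{0<..<1::real}. \<Union>t'\<in>{0<..<1::real}. {s. 0 < F (t, fst (snd s), snd (snd s))} \<inter> {s. F (t', fst (snd s), snd (snd s)) < 0})"
    unfolding axis_cross1_def by force
  then show "open (axis_cross1 F)" by (simp only:) (rule o, intro continuous_intros)
  have "axis_cross2 F = (\<Union>t\<in>{0<..<1::real}. \<Union>t'\<in>{0<..<1::real}. {s. 0 < F (fst s, t, snd (snd s))} \<inter> {s. F (fst s, t', snd (snd s)) < 0})"
    unfolding axis_cross2_def by force
  then show "open (axis_cross2 F)" by (simp only:) (rule o, intro continuous_intros)
  have "axis_cross3 F = (\<Union>t\<in>{0<..<1::real}. \<Union>t'\<in>{0<..<1::real}. {s. 0 < F (fst s, fst (snd s), t)} \<inter> {s. F (fst s, fst (snd s), t') < 0})"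
    unfolding axis_cross3_def by force
  then show "open (axis_cross3 F)" by (simp only:) (rule o, intro continuous_intros)
qed

text \<open>If \<open>F\<close> is positive at \<open>x\<close> and negative at \<open>y\<close>,
  the walk through \<open>(y1,x2,x3)\<close> and \<open>(y1,y2,x3)\<close> changes sign along one of
  its legs unless it stops at a zero of \<open>F\<close>. The null set \<open>?Z\<close> in two of
  the three cost functions accounts for such stops.\<close>

lemma cube_crossing:
  assumes F: "continuous_on UNIV F" and null: "AE s in cube_measure. F s \<noteq> 0"
    and pos: "measure cube_measure {s. F s > 0} \<ge> \<kappa>" and neg: "measure cube_measure {s. F s < 0} \<ge> \<kappa>" and \<kappa>: "\<kappa> \<ge> 0"
  shows "\<kappa>\<^sup>2 \<le> measure cube_measure (axis_cross1 F) + measure cube_measure (axis_cross2 F) + measure cube_measure (axis_cross3 F)"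
proof -
  interpret prob_space cube_measure by (rule prob_space_cube_measure)
  have Fm[measurable]: "F \<in> borel_measurable borel" using F by (rule borel_measurable_continuous_onI)
  have [measurable]: "axis_cross1 F \<in> sets borel" "axis_cross2 F \<in> sets borel" "axis_cross3 F \<in> sets borel"
    using open_axis_cross[OF F] by auto
  have [measurable]: "unit3 \<in> sets borel" using open_unit3 by simp
  have [measurable]: "{s. F s > 0} \<in> sets borel" "{s. F s < 0} \<in> sets borel" "{s. F s = 0} \<in> sets borel"
    by measurable
  let ?P = "{s. F s > 0}" and ?N = "{s. F s < 0}" and ?Z = "{s. F s = 0}"
  have Z0: "emeasure cube_measure ?Z = 0"
    using null by (subst (asm) AE_iff_measurable[of ?Z]) auto
  have full: "emeasure cube_measure (S \<inter> unit3) = emeasure cube_measure S" if "S \<in> sets borel" for S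
    using that by (simp add: emeasure_cube_measure Int_assoc)
  have ind: "(indicator A :: real \<times> real \<times> real \<Rightarrow> ennreal) \<in> borel_measurable borel" if "A \<in> sets borel" for A
    using that by (rule borel_measurable_indicator)
  have m: "(indicator (?P \<inter> unit3) :: _ \<Rightarrow> ennreal) \<in> borel_measurable borel"
    "(indicator (?N \<inter> unit3) :: _ \<Rightarrow> ennreal) \<in> borel_measurable borel"
    "(indicator (axis_cross1 F) :: _ \<Rightarrow> ennreal) \<in> borel_measurable borel"
    "(\<lambda>s. indicator (axis_cross2 F) s + indicator ?Z s :: ennreal) \<in> borel_measurable borel"
    "(\<lambda>s. indicator (axis_cross3 F) s + indicator ?Z s :: ennreal) \<in> borel_measurable borel"
    by (intro ind borel_measurable_add; measurable)+
  have "(\<integral>\<^sup>+s. indicator (?P \<inter> unit3) s \<partial>cube_measure) * (\<integral>\<^sup>+s. indicator (?N \<inter> unit3) s \<partial>cube_measure)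
    \<le> (\<integral>\<^sup>+s. indicator (axis_cross1 F) s \<partial>cube_measure)
     + (\<integral>\<^sup>+s. indicator (axis_cross2 F) s + indicator ?Z s \<partial>cube_measure)
     + (\<integral>\<^sup>+s. indicator (axis_cross3 F) s + indicator ?Z s \<partial>cube_measure)"
    unfolding cube_measure_def
  proof (rule nn_integral_crossing[OF prob_space_unit _ m(1-5)])
    fix x1 y1 x2 y2 x3 y3 :: real
    show "indicator (?P \<inter> unit3) (x1,x2,x3) * indicator (?N \<inter> unit3) (y1,y2,y3)
      \<le> indicator (axis_cross1 F) (x1,x2,x3) + (indicator (axis_cross2 F) (y1,x2,x3) + indicator ?Z (y1,x2,x3))
        + (indicator (axis_cross3 F) (y1,y2,x3) + indicator ?Z (y1,y2,x3) :: ennreal)"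
    proof (cases "(x1,x2,x3) \<in> ?P \<inter> unit3 \<and> (y1,y2,y3) \<in> ?N \<inter> unit3")
      case True
      then have "(x1,x2,x3) \<in> axis_cross1 F \<or> (y1,x2,x3) \<in> axis_cross2 F \<or> (y1,x2,x3) \<in> ?Z
        \<or> (y1,y2,x3) \<in> axis_cross3 F \<or> (y1,y2,x3) \<in> ?Z"
        unfolding axis_cross1_def axis_cross2_def axis_cross3_def unit3_def
        by (simp add: not_less) (smt (verit) greaterThanLessThan_iff)
      then show ?thesis by (auto simp: indicator_def)
    qed (auto simp: indicator_def)
  qed simp
  then have "emeasure cube_measure ?P * emeasure cube_measure ?N
     \<le> emeasure cube_measure (axis_cross1 F) + emeasure cube_measure (axis_cross2 F) + emeasure cube_measure (axis_cross3 F)"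
    by (simp add: nn_integral_add Z0 full)
  then have "measure cube_measure ?P * measure cube_measure ?N
     \<le> measure cube_measure (axis_cross1 F) + measure cube_measure (axis_cross2 F) + measure cube_measure (axis_cross3 F)"
    by (simp add: emeasure_eq_measure ennreal_mult[symmetric] ennreal_plus[symmetric] del: ennreal_plus)
  moreover have "\<kappa>\<^sup>2 \<le> measure cube_measure ?P * measure cube_measure ?N"
    unfolding power2_eq_square using pos neg \<kappa> by (intro mult_mono) auto
  ultimately show ?thesis by linarith
qed

section \<open>Volumes in linear coordinates\<close>

lemma prod_UNIV_3: "prod f (UNIV :: 3 set) = f 1 * f 2 * f 3"
  unfolding UNIV_3 by (simp add: ac_simps)

text \<open>Product measures live on triples, the determinant formula for volumes on
  \<open>real^3\<close>. The coordinate map carries one Lebesgue measure to the other, which is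
  checked on boxes.\<close>

lemma measure_linear_coords:
  fixes f :: "real^3 \<Rightarrow> real^3" and S :: "(real \<times> real \<times> real) set"
  assumes f: "linear f" and S: "S \<in> sets borel" "bounded S"
  shows "(\<lambda>(x,y,z). c + f (vector [x,y,z])) ` S \<in> lmeasurable"
    "measure lebesgue ((\<lambda>(x,y,z). c + f (vector [x,y,z])) ` S) = \<bar>Determinants.det (matrix f)\<bar> * measure lborel S"
proof -
  let ?k = "\<lambda>v::real^3. (v$1, v$2, v$3)" and ?h = "\<lambda>(x,y,z). vector [x,y,z] :: real^3"
  have kc: "continuous_on UNIV ?k" by (intro continuous_intros)
  have [measurable]: "?k \<in> borel_measurable borel" by (rule borel_measurable_continuous_onI[OF kc])
  have hS: "?h ` S = ?k -` S"
  proof (safe, goal_cases)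
    case (2 v)
    have "v = ?h (?k v)" by (simp add: Finite_Cartesian_Product.vec_eq_iff forall_3)
    with 2 show ?case by blast
  qed simp
  have B: "(Basis :: (real \<times> real \<times> real) set) = {(1,0,0),(0,1,0),(0,0,1)}"
    by (auto simp: Basis_prod_def zero_prod_def)
  have "lborel = distr lborel borel ?k"
  proof (rule lborel_eqI)
    fix l u :: "real \<times> real \<times> real" assume lu: "\<And>b. b \<in> Basis \<Longrightarrow> l \<bullet> b \<le> u \<bullet> b"
    obtain l1 l2 l3 u1 u2 u3 where lu': "l = (l1,l2,l3)" "u = (u1,u2,u3)" by (metis prod.exhaust)
    have le: "l1 \<le> u1" "l2 \<le> u2" "l3 \<le> u3"
      using lu[of "(1,0,0)"] lu[of "(0,1,0)"] lu[of "(0,0,1)"] by (auto simp: lu' B)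
    have "?k -` box l u = box (vector [l1,l2,l3]) (vector [u1,u2,u3])"
    proof (intro Set.set_eqI)
      fix v :: "real^3"
      have "?k v \<in> box l u \<longleftrightarrow> l1 < v$1 \<and> v$1 < u1 \<and> l2 < v$2 \<and> v$2 < u2 \<and> l3 < v$3 \<and> v$3 < u3"
        by (auto simp: lu' mem_box B)
      moreover have "v \<in> box (vector [l1,l2,l3]) (vector [u1,u2,u3]) \<longleftrightarrow> l1 < v$1 \<and> v$1 < u1 \<and> l2 < v$2 \<and> v$2 < u2 \<and> l3 < v$3 \<and> v$3 < u3"
        by (auto simp: mem_box_cart forall_3)
      ultimately show "v \<in> ?k -` box l u \<longleftrightarrow> v \<in> box (vector [l1,l2,l3]) (vector [u1,u2,u3])" by simp
    qed
    then have "emeasure (distr lborel borel ?k) (box l u) = emeasure lborel (box (vector [l1,l2,l3]) (vector [u1,u2,u3] :: real^3))"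
      by (simp add: emeasure_distr)
    also have "\<dots> = (u1 - l1) * ((u2 - l2) * (u3 - l3))"
    proof -
      have Bv: "(Basis :: (real^3) set) = range (\<lambda>i. axis i 1)" by (auto simp: Basis_vec_def)
      have inj: "inj (\<lambda>i::3. axis i (1::real))" by (auto simp: inj_on_def axis_eq_axis)
      have "\<forall>b\<in>Basis. vector [l1,l2,l3] \<bullet> b \<le> (vector [u1,u2,u3] :: real^3) \<bullet> b"
        using le by (simp add: Bv inner_axis forall_3)
      moreover have "(\<Prod>b\<in>Basis. (vector [u1,u2,u3] - vector [l1,l2,l3] :: real^3) \<bullet> b) = (u1 - l1) * ((u2 - l2) * (u3 - l3))"
        unfolding Bv prod.reindex[OF inj] by (simp add: prod_UNIV_3 inner_axis)
      ultimately show ?thesis by (subst emeasure_lborel_box) auto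
    qed
    also have "\<dots> = (\<Prod>b\<in>Basis. (u - l) \<bullet> b)" by (simp add: B lu')
    finally show "emeasure (distr lborel borel ?k) (box l u) = (\<Prod>b\<in>Basis. (u - l) \<bullet> b)" .
  qed simp
  then have "measure lborel S = measure (distr lborel borel ?k) S" by simp
  also have "\<dots> = measure lborel (?h ` S)" using S(1) by (simp add: measure_distr hS)
  finally have m1: "measure lborel S = measure lborel (?h ` S)" .
  have hb: "?h ` S \<in> sets borel" unfolding hS using measurable_sets[of ?k borel borel S] S(1) by simp
  have "bounded (?h ` S)"
  proof -
    have "linear ?h" by (rule linearI) (auto simp: Finite_Cartesian_Product.vec_eq_iff forall_3)
    then show ?thesis using bounded_linear_image[OF S(2)] by (simp add: linear_conv_bounded_linear)
  qed
  then have hl: "?h ` S \<in> lmeasurable" using hb by (intro bounded_set_imp_lmeasurable) auto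
  have eq: "(\<lambda>(x,y,z). c + f (vector [x,y,z])) ` S = (+) c ` (f ` (?h ` S))"
    by (force simp: image_image)
  show "(\<lambda>(x,y,z). c + f (vector [x,y,z])) ` S \<in> lmeasurable"
    unfolding eq by (intro measurable_translation measurable_linear_image f hl)
  show "measure lebesgue ((\<lambda>(x,y,z). c + f (vector [x,y,z])) ` S) = \<bar>Determinants.det (matrix f)\<bar> * measure lborel S"
    unfolding eq measure_translation measure_linear_image[OF f hl] m1 using hb by simp
qed

section \<open>Monomials and their restrictions to lines\<close>

text \<open>The exponents are the base \<open>m\<close> digits of \<open>k\<close>, so
  \<open>k < m^3\<close> enumerates the monomials with all exponents below \<open>m\<close>. The
  last quotient is a digit only for such \<open>k\<close>.\<close>

definition mono3 :: "nat \<Rightarrow> nat \<Rightarrow> real^3 \<Rightarrow> real" where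
  "mono3 m k x = x $ 1 ^ (k mod m) * x $ 2 ^ ((k div m) mod m) * x $ 3 ^ (k div m div m)"

lemma poly_sum_monom_zero:
  fixes c :: "nat \<Rightarrow> real"
  assumes "\<And>t. (\<Sum>k<d. c k * t ^ k) = 0" "k < d"
  shows "c k = 0"
proof -
  let ?p = "\<Sum>k<d. Polynomial.monom (c k) k"
  have "poly ?p t = 0" for t using assms(1)[of t] by (simp add: poly_sum poly_monom)
  then have "?p = 0" using poly_all_0_iff_0 by blast
  then have "coeff ?p k = 0" by simp
  then show ?thesis using assms(2) by (simp add: coeff_sum)
qed

text \<open>Kronecker substitution: along the curve \<open>(t, t ^ m, t ^ m\<^sup>2)\<close> the monomials become
  the distinct powers of \<open>t\<close>.\<close>

lemma mono3_independent:
  fixes c :: "nat \<Rightarrow> real"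
  assumes "\<And>x. (\<Sum>k<m^3. c k * mono3 m k x) = 0" "k < m^3"
  shows "c k = 0"
proof -
  have "(\<Sum>k<m^3. c k * t ^ k) = 0" for t :: real
  proof -
    have "mono3 m k (vector [t, t ^ m, t ^ (m * m)]) = t ^ k" for k
    proof -
      have "k mod m + m * ((k div m) mod m) + m * m * (k div m div m) = k"
        by (metis ab_semigroup_mult_class.mult_ac(1) distrib_left add.assoc mod_mult_div_eq)
      then show ?thesis
        by (simp add: mono3_def power_mult[symmetric] power_add[symmetric])
    qed
    then show ?thesis using assms(1)[of "vector [t, t ^ m, t ^ (m * m)]"] by simp
  qed
  then show ?thesis using poly_sum_monom_zero[of c "m^3" k] assms(2) by blast
qed

text \<open>Counting sign changes needs only that restrictions to lines are polynomials of bounded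
  degree in one variable; this avoids a type of polynomials in three variables.\<close>

definition line_poly :: "nat \<Rightarrow> (real^3 \<Rightarrow> real) \<Rightarrow> bool" where
  "line_poly n f \<longleftrightarrow> (\<forall>a v. \<exists>p :: real poly. degree p \<le> n \<and> (\<forall>t. f (a + t *\<^sub>R v) = poly p t))"

lemma line_poly_mono3:
  assumes "k < m^3"
  shows "line_poly (3 * (m - 1)) (mono3 m k)"
  unfolding line_poly_def
proof (intro allI)
  fix a v :: "real^3"
  let ?p = "[:a$1, v$1:] ^ (k mod m) * [:a$2, v$2:] ^ ((k div m) mod m) * [:a$3, v$3:] ^ (k div m div m)"
  have m: "m > 0" using assms by (cases m) auto
  have "k div m div m < m"
    using assms m by (simp add: div_mult2_eq[symmetric] less_mult_imp_div_less power3_eq_cube)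
  moreover have "degree ([:x, y:] ^ j) \<le> j" for x y :: real and j
    by (rule order_trans[OF degree_power_le]) simp
  moreover have "k mod m \<le> m - 1" "(k div m) mod m \<le> m - 1"
    using m mod_less_divisor[OF m, of k] mod_less_divisor[OF m, of "k div m"] by linarith+
  moreover have "k div m div m \<le> m - 1" using calculation by linarith
  ultimately have "degree ?p \<le> (m - 1) + (m - 1) + (m - 1)"
    by (intro degree_mult_le[THEN order_trans] add_mono) (meson le_trans)+
  then show "\<exists>p. degree p \<le> 3 * (m - 1) \<and> (\<forall>t. mono3 m k (a + t *\<^sub>R v) = poly p t)"
    by (intro exI[of _ ?p]) (auto simp: mono3_def poly_power algebra_simps)
qed

lemma line_poly_sum:
  fixes f :: "nat \<Rightarrow> real^3 \<Rightarrow> real"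
  assumes "\<And>k. k < d \<Longrightarrow> line_poly n (f k)"
  shows "line_poly n (\<lambda>x. \<Sum>k<d. c k * f k x)"
  unfolding line_poly_def
proof (intro allI)
  fix a v :: "real^3"
  have "\<forall>k. \<exists>p. k < d \<longrightarrow> degree p \<le> n \<and> (\<forall>t. f k (a + t *\<^sub>R v) = poly p t)"
    using assms by (auto simp: line_poly_def)
  then obtain p where p: "\<And>k. k < d \<Longrightarrow> degree (p k) \<le> n \<and> (\<forall>t. f k (a + t *\<^sub>R v) = poly (p k) t)"
    by metis
  have "degree (\<Sum>k<d. Polynomial.smult (c k) (p k)) \<le> n"
    by (intro degree_sum_le finite_lessThan) (use p in \<open>auto intro: order_trans[OF degree_smult_le]\<close>)
  then show "\<exists>q. degree q \<le> n \<and> (\<forall>t. (\<Sum>k<d. c k * f k (a + t *\<^sub>R v)) = poly q t)"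
    using p by (intro exI[of _ "\<Sum>k<d. Polynomial.smult (c k) (p k)"]) (auto simp: poly_sum)
qed

lemma continuous_mono3: "continuous_on UNIV (mono3 m k)"
  unfolding mono3_def by (intro continuous_intros)

section \<open>Sign changes of a polynomial along a tube\<close>

lemma poly_sign_change:
  fixes p :: "real poly"
  assumes "poly p a > 0" "poly p b < 0"
  obtains r where "poly p r = 0" "r \<in> closed_segment a b"
proof (cases "a < b")
  case True
  then obtain r where "r > a" "r < b" "poly p r = 0" using poly_IVT_neg[of a b p] assms by auto
  then show ?thesis using that[of r] by (auto simp: closed_segment_eq_real_ivl)
next
  case False
  then have "b < a" using assms by (cases "a = b") auto
  then obtain r where "r > b" "r < a" "poly p r = 0" using poly_IVT_pos[of b a p] assms by auto
  then show ?thesis using that[of r] by (auto simp: closed_segment_eq_real_ivl)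
qed

definition line_cross :: "(real^3 \<Rightarrow> real) \<Rightarrow> real^3 \<Rightarrow> (real^3) set \<Rightarrow> (real^3) set" where
  "line_cross P v B = {x \<in> B. \<exists>s s'. x + s *\<^sub>R v \<in> B \<and> x + s' *\<^sub>R v \<in> B \<and> P (x + s *\<^sub>R v) > 0 \<and> P (x + s' *\<^sub>R v) < 0}"

lemma open_line_cross:
  assumes P: "continuous_on UNIV P" and B: "open B"
  shows "open (line_cross P v B)"
proof -
  have t: "open {x. x + s *\<^sub>R v \<in> B}" for s
    using open_vimage[OF B, of "\<lambda>x. x + s *\<^sub>R v"] by (simp add: vimage_def continuous_intros)
  have c: "continuous_on UNIV (\<lambda>x. P (x + s *\<^sub>R v))" for s
    by (rule continuous_on_compose2[OF P]) (auto intro!: continuous_intros)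
  have "line_cross P v B = B \<inter> (\<Union>s. \<Union>s'. {x. x + s *\<^sub>R v \<in> B} \<inter> {x. x + s' *\<^sub>R v \<in> B} \<inter>
     {x. 0 < P (x + s *\<^sub>R v)} \<inter> {x. P (x + s' *\<^sub>R v) < 0})"
    by (auto simp: line_cross_def)
  then show ?thesis by (simp only:) (intro open_Int B open_UN ballI t open_Collect_less c continuous_on_const)
qed

text \<open>A piece that contributes contains, by convexity, a root of \<open>P\<close> on the line.
  Disjointness makes these roots distinct, so at most \<open>n\<close> pieces contribute; each has
  diameter at most 1, so its parameters lie within 1 of any one of them.\<close>

lemma line_crossing_length:
  fixes B :: "'i \<Rightarrow> (real^3) set"
  assumes P: "line_poly n P" and v: "norm v = 1" and I: "finite I"
    and conv: "\<And>i. i \<in> I \<Longrightarrow> convex (B i)"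
    and disj: "\<And>i j. i \<in> I \<Longrightarrow> j \<in> I \<Longrightarrow> i \<noteq> j \<Longrightarrow> B i \<inter> B j = {}"
    and diam: "\<And>i x y. i \<in> I \<Longrightarrow> x \<in> B i \<Longrightarrow> y \<in> B i \<Longrightarrow> dist x y \<le> 1"
  shows "(\<Sum>i\<in>I. emeasure lborel {t. a + t *\<^sub>R v \<in> line_cross P v (B i)}) \<le> ennreal (2 * real n)"
proof -
  obtain p where p: "degree p \<le> n" "\<And>t. P (a + t *\<^sub>R v) = poly p t"
    using P unfolding line_poly_def by metis
  define L where "L i = {t. a + t *\<^sub>R v \<in> line_cross P v (B i)}" for i
  define I' where "I' = {i \<in> I. L i \<noteq> {}}"
  have root: "p \<noteq> 0 \<and> (\<exists>r. poly p r = 0 \<and> a + r *\<^sub>R v \<in> B i)" if i: "i \<in> I'" for i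
  proof -
    obtain t where "a + t *\<^sub>R v \<in> line_cross P v (B i)" using i by (auto simp: I'_def L_def)
    then obtain s s' where s: "a + (t + s) *\<^sub>R v \<in> B i" "a + (t + s') *\<^sub>R v \<in> B i" "P (a + (t + s) *\<^sub>R v) > 0" "P (a + (t + s') *\<^sub>R v) < 0"
      unfolding line_cross_def by (auto simp: scaleR_add_left add.assoc)
    obtain r where r: "poly p r = 0" "r \<in> closed_segment (t + s) (t + s')"
      by (rule poly_sign_change[of p "t + s" "t + s'"]) (use s in \<open>auto simp: p\<close>)
    obtain w where w: "r = (1 - w) * (t + s) + w * (t + s')" "0 \<le> w" "w \<le> 1"
      using r(2) by (auto simp: closed_segment_def)
    have "a + r *\<^sub>R v = (1 - w) *\<^sub>R (a + (t + s) *\<^sub>R v) + w *\<^sub>R (a + (t + s') *\<^sub>R v)"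
      unfolding w(1) by (simp add: algebra_simps)
    also have "\<dots> \<in> B i"
      using conv[of i] s w i by (intro convexD) (auto simp: I'_def)
    finally have "a + r *\<^sub>R v \<in> B i" .
    moreover have "p \<noteq> 0" using s(3) by (auto simp: p)
    ultimately show ?thesis using r by auto
  qed
  have cardI: "card I' \<le> n"
  proof (cases "I' = {}")
    case False
    then have p0: "p \<noteq> 0" using root by auto
    have "\<forall>i\<in>I'. \<exists>r. poly p r = 0 \<and> a + r *\<^sub>R v \<in> B i" using root by auto
    from bchoice[OF this] obtain R where R: "\<forall>i\<in>I'. poly p (R i) = 0 \<and> a + R i *\<^sub>R v \<in> B i" by (elim exE)
    have "inj_on R I'"
    proof (rule inj_onI, rule ccontr)
      fix i j assume ij: "i \<in> I'" "j \<in> I'" "R i = R j" "i \<noteq> j"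
      then have "a + R i *\<^sub>R v \<in> B i \<inter> B j" using R by fastforce
      then show False using disj[of i j] ij by (auto simp: I'_def)
    qed
    then have "card I' = card (R ` I')" by (simp add: card_image)
    also have "\<dots> \<le> card {r. poly p r = 0}"
      by (intro card_mono poly_roots_finite p0) (use R in auto)
    also have "\<dots> \<le> degree p" by (rule card_poly_roots_bound[OF p0])
    finally show ?thesis using p(1) by simp
  qed simp
  have len: "emeasure lborel (L i) \<le> (if i \<in> I' then 2 else 0)" if i: "i \<in> I" for i
  proof (cases "L i = {}")
    case False
    then obtain t0 where t0: "t0 \<in> L i" by auto
    have "L i \<subseteq> {t0 - 1..t0 + 1}"
    proof
      fix t assume "t \<in> L i"
      then have "dist (a + t *\<^sub>R v) (a + t0 *\<^sub>R v) \<le> 1"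
        using t0 i by (intro diam) (auto simp: L_def line_cross_def)
      moreover have "a + t *\<^sub>R v - (a + t0 *\<^sub>R v) = (t - t0) *\<^sub>R v" by (simp add: algebra_simps)
      ultimately have "\<bar>t - t0\<bar> \<le> 1" using v by (simp add: dist_norm)
      then show "t \<in> {t0 - 1..t0 + 1}" by auto
    qed
    then have "emeasure lborel (L i) \<le> emeasure lborel {t0 - 1..t0 + 1}" by (intro emeasure_mono) auto
    also have "\<dots> = 2" by simp
    finally show ?thesis using i False by (simp add: I'_def)
  qed (use i in \<open>simp add: I'_def\<close>)
  have "(\<Sum>i\<in>I. emeasure lborel (L i)) \<le> (\<Sum>i\<in>I. if i \<in> I' then 2 else 0)"
    by (intro sum_mono len)
  also have "\<dots> = (\<Sum>i\<in>I'. 2)"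
    using I by (subst sum.inter_filter[symmetric]) (auto simp: I'_def intro!: sum.cong)
  also have "\<dots> = ennreal (2 * real (card I'))" by (simp add: ennreal_of_nat_eq_real_of_nat ennreal_mult' mult.commute)
  also have "\<dots> \<le> ennreal (2 * real n)" using cardI by (intro ennreal_leI) simp
  finally show ?thesis by (simp add: L_def)
qed

text \<open>A rotation moves the third axis to \<open>v\<close>, and Fubini slices the pieces into
  lines parallel to \<open>v\<close>. By \<open>near\<close> the relevant lines meet the square
  \<open>[-3,3]^2\<close> of area 36, and each carries length at most \<open>2 * n\<close>.\<close>

lemma tube_crossing_bound:
  fixes B :: "'i \<Rightarrow> (real^3) set"
  assumes P: "line_poly n P" "continuous_on UNIV P" and v: "norm v = 1" and I: "finite I"
    and opn: "\<And>i. i \<in> I \<Longrightarrow> open (B i)" and conv: "\<And>i. i \<in> I \<Longrightarrow> convex (B i)"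
    and disj: "\<And>i j. i \<in> I \<Longrightarrow> j \<in> I \<Longrightarrow> i \<noteq> j \<Longrightarrow> B i \<inter> B j = {}"
    and diam: "\<And>i x y. i \<in> I \<Longrightarrow> x \<in> B i \<Longrightarrow> y \<in> B i \<Longrightarrow> dist x y \<le> 1"
    and near: "\<And>i x. i \<in> I \<Longrightarrow> x \<in> B i \<Longrightarrow> \<exists>t. dist x (c + t *\<^sub>R v) \<le> 3"
  shows "(\<Sum>i\<in>I. measure lebesgue (line_cross P v (B i))) \<le> 72 * real n"
proof -
  obtain f :: "real^3 \<Rightarrow> real^3" where f: "orthogonal_transformation f" "f (axis 3 1) = v"
    using orthogonal_transformation_exists_1[of "axis 3 1" v] v by (auto simp: norm_axis_1)
  have lf: "linear f" using f(1) by (simp add: orthogonal_transformation_def)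
  have fn: "norm (f x) = norm x" for x using f(1) by (simp add: orthogonal_transformation)
  have det: "\<bar>Determinants.det (matrix f)\<bar> = 1" using f(1) by (simp add: orthogonal_transformation_det)
  define \<tau> where "\<tau> = (\<lambda>(x,y,z). c + f (vector [x,y,z]))"
  have \<tau>e: "\<tau> (x,y,z) = \<tau> (x,y,0) + z *\<^sub>R v" for x y z
  proof -
    have "(vector [x,y,z] :: real^3) = vector [x,y,0] + z *\<^sub>R axis 3 1"
      by (simp add: Finite_Cartesian_Product.vec_eq_iff forall_3 axis_def)
    then show ?thesis by (simp add: \<tau>_def linear_add[OF lf] linear_scale[OF lf] f(2))
  qed
  have \<tau>c: "continuous_on UNIV \<tau>"
  proof -
    have "continuous_on UNIV (\<lambda>(x,y,z). vector [x,y,z] :: real^3)"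
    proof -
      have "linear (\<lambda>(x,y,z). vector [x,y,z] :: real^3)"
        by (rule linearI) (auto simp: Finite_Cartesian_Product.vec_eq_iff forall_3)
      then show ?thesis by (rule linear_continuous_on[OF linear_conv_bounded_linear[THEN iffD1]])
    qed
    then have "continuous_on UNIV (\<lambda>s. f ((\<lambda>(x,y,z). vector [x,y,z]) s))"
      by (rule continuous_on_compose2[OF linear_continuous_on[OF linear_conv_bounded_linear[THEN iffD1, OF lf]], of UNIV]) auto
    then show ?thesis unfolding \<tau>_def by (auto simp: case_prod_unfold intro!: continuous_intros)
  qed
  have \<tau>s: "\<exists>s. \<tau> s = p" for p
  proof -
    obtain q where q: "f q = p - c" using orthogonal_transformation_surj[OF f(1)] by (metis surjD)
    have "vector [q$1,q$2,q$3] = q" by (simp add: Finite_Cartesian_Product.vec_eq_iff forall_3)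
    then have "\<tau> (q$1,q$2,q$3) = p" by (simp add: \<tau>_def q)
    then show ?thesis by blast
  qed
  define L where "L i = \<tau> -` line_cross P v (B i)" for i
  have Lo: "open (L i)" if "i \<in> I" for i
    unfolding L_def by (rule open_vimage[OF open_line_cross[OF P(2) opn[OF that]] \<tau>c])
  have Lb: "L i \<subseteq> {-3..3} \<times> {-3..3} \<times> UNIV" if i: "i \<in> I" for i
  proof
    fix s assume "s \<in> L i"
    obtain x y z where s: "s = (x,y,z)" by (cases s)
    have "\<tau> (x,y,z) \<in> B i" using \<open>s \<in> L i\<close> by (auto simp: L_def s line_cross_def)
    then obtain t where t: "dist (\<tau> (x,y,z)) (c + t *\<^sub>R v) \<le> 3" using near[OF i] by blast
    have "\<tau> (x,y,z) - (c + t *\<^sub>R v) = f (vector [x,y,z - t])"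
    proof -
      have "(vector [x,y,z - t] :: real^3) = vector [x,y,z] - t *\<^sub>R axis 3 1"
        by (simp add: Finite_Cartesian_Product.vec_eq_iff forall_3 axis_def)
      then show ?thesis by (simp add: \<tau>_def linear_diff[OF lf] linear_scale[OF lf] f(2))
    qed
    then have "norm (vector [x,y,z - t] :: real^3) \<le> 3" using t by (simp add: dist_norm fn)
    then have "\<bar>x\<bar> \<le> 3" "\<bar>y\<bar> \<le> 3"
      using component_le_norm_cart[of "vector [x,y,z - t] :: real^3" 1] component_le_norm_cart[of "vector [x,y,z - t] :: real^3" 2]
      by auto
    then show "s \<in> {-3..3} \<times> {-3..3} \<times> UNIV" by (auto simp: s)
  qed
  \<comment> \<open>In the direction of \<open>v\<close> it is the diameter bound, not
    \<open>near\<close>, that confines a single piece.\<close>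
  have Lbd: "bounded (L i)" if i: "i \<in> I" for i
  proof (cases "L i = {}")
    case False
    then obtain s0 where s0: "s0 \<in> L i" by auto
    obtain x0 y0 z0 where s0': "s0 = (x0,y0,z0)" by (cases s0)
    have "L i \<subseteq> {-3..3} \<times> {-3..3} \<times> {z0-1..z0+1}"
    proof
      fix s assume s: "s \<in> L i"
      obtain x y z where s': "s = (x,y,z)" by (cases s)
      have "dist (\<tau> s) (\<tau> s0) \<le> 1" using s s0 i by (intro diam) (auto simp: L_def line_cross_def)
      moreover have "\<tau> s - \<tau> s0 = f (vector [x - x0,y - y0,z - z0])"
      proof -
        have "(vector [x - x0,y - y0,z - z0] :: real^3) = vector [x,y,z] - vector [x0,y0,z0]"
          by (simp add: Finite_Cartesian_Product.vec_eq_iff forall_3)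
        then show ?thesis by (simp add: \<tau>_def s' s0' linear_diff[OF lf])
      qed
      ultimately have "norm (vector [x - x0,y - y0,z - z0] :: real^3) \<le> 1" by (simp add: dist_norm fn)
      then have "\<bar>z - z0\<bar> \<le> 1" using component_le_norm_cart[of "vector [x - x0,y - y0,z - z0] :: real^3" 3] by auto
      then show "s \<in> {-3..3} \<times> {-3..3} \<times> {z0-1..z0+1}" using Lb[OF i] s by (auto simp: s')
    qed
    moreover have "bounded ({-3..3::real} \<times> {-3..3::real} \<times> {z0-1..z0+1})" by (intro bounded_Times) auto
    ultimately show ?thesis by (rule bounded_subset[rotated])
  qed simp
  have mL: "measure lebesgue (line_cross P v (B i)) = measure lborel (L i)" if i: "i \<in> I" for i
  proof -
    have "\<tau> ` L i = line_cross P v (B i)" unfolding L_def using \<tau>s by (auto simp: image_iff) (metis)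
    then show ?thesis
      using measure_linear_coords(2)[OF lf _ Lbd[OF i], of c] Lo[OF i] by (simp add: \<tau>_def det)
  qed
  have fin: "emeasure lborel (L i) < \<infinity>" if "i \<in> I" for i
    using Lbd[OF that] by (rule emeasure_bounded_finite)
  have "ennreal (\<Sum>i\<in>I. measure lborel (L i)) = (\<Sum>i\<in>I. emeasure lborel (L i))"
    using fin by (subst sum_ennreal[symmetric]) (auto intro!: sum.cong simp: emeasure_eq_ennreal_measure less_top)
  also have "\<dots> = (\<Sum>i\<in>I. \<integral>\<^sup>+x. \<integral>\<^sup>+y. emeasure lborel {z. (x,y,z) \<in> L i} \<partial>lborel \<partial>lborel)"
  proof (rule sum.cong[OF refl])
    fix i assume i: "i \<in> I"
    have [measurable]: "L i \<in> sets borel" using Lo[OF i] by simp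
    have m1: "L i \<in> sets (lborel \<Otimes>\<^sub>M lborel)" unfolding lborel_prod sets_lborel by measurable
    have "emeasure lborel (L i) = emeasure (lborel \<Otimes>\<^sub>M lborel) (L i)" by (simp add: lborel_prod)
    also have "\<dots> = (\<integral>\<^sup>+x. emeasure lborel (Pair x -` L i) \<partial>lborel)"
      by (rule lborel.emeasure_pair_measure_alt[OF m1])
    also have "\<dots> = (\<integral>\<^sup>+x. \<integral>\<^sup>+y. emeasure lborel {z. (x,y,z) \<in> L i} \<partial>lborel \<partial>lborel)"
    proof (rule nn_integral_cong)
      fix x :: real
      have "Pair x -` L i \<in> sets (lborel \<Otimes>\<^sub>M lborel)" using sets_Pair1[OF m1, of x] unfolding lborel_prod sets_lborel .
      then have "emeasure (lborel \<Otimes>\<^sub>M lborel) (Pair x -` L i) = (\<integral>\<^sup>+y. emeasure lborel (Pair y -` Pair x -` L i) \<partial>lborel)"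
        by (rule lborel.emeasure_pair_measure_alt)
      then show "emeasure lborel (Pair x -` L i) = (\<integral>\<^sup>+y. emeasure lborel {z. (x,y,z) \<in> L i} \<partial>lborel)"
        by (simp add: lborel_prod vimage_def)
    qed
    finally show "emeasure lborel (L i) = (\<integral>\<^sup>+x. \<integral>\<^sup>+y. emeasure lborel {z. (x,y,z) \<in> L i} \<partial>lborel \<partial>lborel)" .
  qed
  also have "\<dots> = (\<integral>\<^sup>+x. \<integral>\<^sup>+y. (\<Sum>i\<in>I. emeasure lborel {z. (x,y,z) \<in> L i}) \<partial>lborel \<partial>lborel)"
  proof -
    have A: "(\<lambda>(x,y). emeasure lborel {z. (x,y,z) \<in> L i}) \<in> borel_measurable (lborel \<Otimes>\<^sub>M lborel)" if i: "i \<in> I" for i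
    proof -
      let ?g = "\<lambda>((x,y),z). (x,y,z) :: real \<times> real \<times> real"
      have "continuous_on UNIV ?g" unfolding case_prod_unfold by (intro continuous_intros)
      then have "open (?g -` L i)" using Lo[OF i] by (rule open_vimage[rotated])
      then have "?g -` L i \<in> sets ((lborel \<Otimes>\<^sub>M lborel) \<Otimes>\<^sub>M lborel)" unfolding lborel_prod sets_lborel by (rule borel_open)
      from lborel.measurable_emeasure_Pair[OF this] show ?thesis
        by (simp add: vimage_def case_prod_unfold)
    qed
    show ?thesis
      by (subst nn_integral_sum[symmetric]; (subst nn_integral_sum[symmetric])?)
         (use A in \<open>auto simp: lborel.borel_measurable_nn_integral\<close>)
  qed
  also have "\<dots> \<le> (\<integral>\<^sup>+x. \<integral>\<^sup>+y. ennreal (2 * real n) * (indicator {-3..3} (x::real) * indicator {-3..3} (y::real)) \<partial>lborel \<partial>lborel)"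
  proof (rule nn_integral_mono, rule nn_integral_mono)
    fix x y :: real
    show "(\<Sum>i\<in>I. emeasure lborel {z. (x,y,z) \<in> L i}) \<le> ennreal (2 * real n) * (indicator {-3..3} x * indicator {-3..3} y)"
    proof (cases "x \<in> {-3..3} \<and> y \<in> {-3..3}")
      case True
      have "{z. (x,y,z) \<in> L i} = {z. \<tau> (x,y,0) + z *\<^sub>R v \<in> line_cross P v (B i)}" for i
        by (simp add: L_def \<tau>e[symmetric])
      then show ?thesis
        using True line_crossing_length[OF P(1) v I conv disj diam, where a = "\<tau> (x,y,0)"] by simp
    next
      case False
      then have "{z. (x,y,z) \<in> L i} = {}" if "i \<in> I" for i using Lb[OF that] by auto
      then show ?thesis by simp
    qed
  qed
  also have "\<dots> = ennreal (2 * real n) * (ennreal 6 * ennreal 6)"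
    by (simp add: nn_integral_cmult nn_integral_multc)
  also have "\<dots> = ennreal (72 * real n)" by (subst ennreal_mult'[symmetric], simp, subst ennreal_mult'[symmetric], simp, simp)
  finally have "(\<Sum>i\<in>I. measure lborel (L i)) \<le> 72 * real n" by simp
  then show ?thesis using mL by simp
qed

section \<open>Tiling a cube by parallelepipeds\<close>

definition frame :: "real^3 \<Rightarrow> real^3 \<Rightarrow> real^3 \<Rightarrow> real^3 \<Rightarrow> real^3" where
  "frame w1 w2 w3 x = x$1 *\<^sub>R w1 + x$2 *\<^sub>R w2 + x$3 *\<^sub>R w3"

lemma linear_frame: "linear (frame w1 w2 w3)"
  unfolding frame_def by (rule linearI) (auto simp: algebra_simps)

lemma det_frame: "Determinants.det (matrix (frame w1 w2 w3)) = w1 \<bullet> cross3 w2 w3"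
  by (simp add: det_3 matrix_def frame_def axis_def cross3_def inner_vec_def sum_3 vector_def algebra_simps)

text \<open>The integer triple \<open>k\<close> is a lattice cell. Parameters are real triples, so a
  tile is an image of \<open>unit3\<close> and \<open>cube_measure\<close> becomes the uniform
  distribution on it.\<close>

definition tile :: "real^3 \<Rightarrow> real^3 \<Rightarrow> real^3 \<Rightarrow> real^3 \<Rightarrow> int \<times> int \<times> int \<Rightarrow> real \<times> real \<times> real \<Rightarrow> real^3" where
  "tile m w1 w2 w3 k = (\<lambda>(x,y,z). m + frame w1 w2 w3 (vector [of_int (fst k) + x, of_int (fst (snd k)) + y, of_int (snd (snd k)) + z]))"

lemma tile_eq:
  "tile m w1 w2 w3 k = (\<lambda>(x,y,z). tile m w1 w2 w3 k (0,0,0) + frame w1 w2 w3 (vector [x,y,z]))"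
  by (auto simp: tile_def frame_def fun_eq_iff algebra_simps)

lemma tile_shift:
  "tile m w1 w2 w3 k (x,y,z) = tile m w1 w2 w3 k (0,0,0) + x *\<^sub>R w1 + y *\<^sub>R w2 + z *\<^sub>R w3"
  by (simp add: tile_def frame_def algebra_simps)

lemma frame_inj:
  assumes "w1 \<bullet> cross3 w2 w3 \<noteq> 0"
  shows "inj (frame w1 w2 w3)" "surj (frame w1 w2 w3)"
proof -
  show "inj (frame w1 w2 w3)" using assms det_nz_iff_inj[OF linear_frame] by (simp add: det_frame)
  then show "surj (frame w1 w2 w3)" by (rule linear_inj_imp_surj[OF linear_frame])
qed

text \<open>\<open>K\<close> consists of the cells whose closed version meets
  \<open>ball m (1/4)\<close>. Edges of length at most \<open>1/20\<close> give diameter at most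
  \<open>3/20\<close>, so these cells stay inside \<open>ball m (1/2)\<close>. Packing into a cube
  of volume 1 bounds their number above; covering the cube of side \<open>1/4\<close> about
  \<open>m\<close> bounds it below, whence \<open>1/64\<close>.\<close>

lemma tile_family:
  assumes det: "w1 \<bullet> cross3 w2 w3 \<noteq> 0"
    and w: "norm w1 \<le> 1/20" "norm w2 \<le> 1/20" "norm w3 \<le> 1/20"
  obtains K where "finite K"
    "\<And>k. k \<in> K \<Longrightarrow> tile m w1 w2 w3 k ` unit3 \<subseteq> ball m (1/2)"
    "\<And>k k'. k \<noteq> k' \<Longrightarrow> tile m w1 w2 w3 k ` unit3 \<inter> tile m w1 w2 w3 k' ` unit3 = {}"
    "real (card K) * \<bar>w1 \<bullet> cross3 w2 w3\<bar> \<le> 1" "1/64 \<le> real (card K) * \<bar>w1 \<bullet> cross3 w2 w3\<bar>"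
proof -
  let ?T = "tile m w1 w2 w3" and ?D = "\<bar>w1 \<bullet> cross3 w2 w3\<bar>"
  let ?C = "{0..1} \<times> {0..1} \<times> {0..1} :: (real \<times> real \<times> real) set"
  define K where "K = {k. ?T k ` ?C \<inter> ball m (1/4) \<noteq> {}}"
  have D: "?D > 0" using det by simp
  have close: "dist (?T k s) (?T k s') \<le> 3/20" if "s \<in> ?C" "s' \<in> ?C" for k s s'
  proof -
    obtain x y z x' y' z' where s: "s = (x,y,z)" "s' = (x',y',z')" by (metis prod.exhaust)
    have "?T k s - ?T k s' = (x - x') *\<^sub>R w1 + (y - y') *\<^sub>R w2 + (z - z') *\<^sub>R w3"
      unfolding s tile_shift[of m w1 w2 w3 k x y z] tile_shift[of m w1 w2 w3 k x' y' z'] by (simp add: algebra_simps)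
    also have "norm \<dots> \<le> \<bar>x - x'\<bar> * norm w1 + \<bar>y - y'\<bar> * norm w2 + \<bar>z - z'\<bar> * norm w3"
      by (rule norm_triangle_le, rule add_mono, rule norm_triangle_le) auto
    also have "\<dots> \<le> 1 * (1/20) + 1 * (1/20) + 1 * (1/20)"
      using that w unfolding s by (intro add_mono mult_mono) auto
    finally show ?thesis by (simp add: dist_norm)
  qed
  have Cb: "?C \<in> sets borel" "bounded ?C"
    by (auto intro!: borel_closed closed_Times bounded_Times)
  have Ub: "unit3 \<in> sets borel" "bounded unit3"
    using open_unit3 by (auto simp: unit3_def intro!: bounded_Times)
  have UC: "unit3 \<subseteq> ?C" by (auto simp: unit3_def)
  have mC: "measure lborel ?C = 1"
  proof -
    have "measure lborel (cbox (0,0,0) (1,1,1) :: (real\<times>real\<times>real) set) = 1"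
      by (subst measure_lborel_cbox_eq) (auto simp: Basis_prod_def zero_prod_def)
    moreover have "cbox (0,0,0) (1,1,1) = ?C" by (auto simp: cbox_Pair_eq[symmetric] cbox_Pair_eq)
    ultimately show ?thesis by simp
  qed
  have mU: "measure lborel unit3 = 1"
    using measure_cube_measure[of UNIV] prob_space.prob_space[OF prob_space_cube_measure] by simp
  have TC: "?T k ` ?C \<in> lmeasurable" "measure lebesgue (?T k ` ?C) = ?D" for k
    using measure_linear_coords[OF linear_frame Cb, of "?T k (0,0,0)" w1 w2 w3]
    by (simp_all add: tile_eq[symmetric] det_frame mC)
  have TU: "?T k ` unit3 \<in> lmeasurable" "measure lebesgue (?T k ` unit3) = ?D" for k
    using measure_linear_coords[OF linear_frame Ub, of "?T k (0,0,0)" w1 w2 w3]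
    by (simp_all add: tile_eq[symmetric] det_frame mU)
  have sub: "?T k ` ?C \<subseteq> ball m (1/2)" if "k \<in> K" for k
  proof
    fix p assume "p \<in> ?T k ` ?C"
    then obtain s where s: "s \<in> ?C" "p = ?T k s" by blast
    have "?T k ` ?C \<inter> ball m (1/4) \<noteq> {}" using \<open>k \<in> K\<close> unfolding K_def mem_Collect_eq .
    then have "\<exists>p'. p' \<in> ?T k ` ?C \<inter> ball m (1/4)" by (rule ex_in_conv[THEN iffD2])
    then obtain p' where p': "p' \<in> ?T k ` ?C" "p' \<in> ball m (1/4)" by (elim exE IntE)
    obtain s' where "p' = ?T k s'" "s' \<in> ?C" using p'(1) by (rule imageE)
    then have s': "s' \<in> ?C" "dist m (?T k s') < 1/4" using p'(2) by auto
    have "dist m p \<le> dist m (?T k s') + dist (?T k s') (?T k s)" unfolding s(2) by (rule dist_triangle)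
    also have "\<dots> < 1/2" using close[OF s'(1) s(1), of k] s'(2) by simp
    finally show "p \<in> ball m (1/2)" by simp
  qed
  have disj: "?T k ` unit3 \<inter> ?T k' ` unit3 = {}" if "k \<noteq> k'" for k k'
  proof (rule ccontr)
    assume "\<not> ?thesis"
    then obtain s s' where s: "s \<in> unit3" "s' \<in> unit3" "?T k s = ?T k' s'" by blast
    obtain x y z x' y' z' a b c a' b' c' where e: "s = (x,y,z)" "s' = (x',y',z')" "k = (a,b,c)" "k' = (a',b',c')"
      by (metis prod.exhaust)
    have "frame w1 w2 w3 (vector [of_int a + x, of_int b + y, of_int c + z]) = frame w1 w2 w3 (vector [of_int a' + x', of_int b' + y', of_int c' + z'])"
      using s(3) by (simp add: e tile_def)
    then have "(vector [of_int a + x, of_int b + y, of_int c + z] :: real^3) = vector [of_int a' + x', of_int b' + y', of_int c' + z']"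
      using frame_inj(1)[OF det] by (simp add: inj_eq)
    then have "of_int a + x = of_int a' + x'" "of_int b + y = of_int b' + y'" "of_int c + z = of_int c' + z'"
      by (simp_all add: Finite_Cartesian_Product.vec_eq_iff forall_3)
    moreover have "0 < x" "x < 1" "0 < x'" "x' < 1" "0 < y" "y < 1" "0 < y'" "y' < 1" "0 < z" "z < 1" "0 < z'" "z' < 1"
      using s(1,2) by (auto simp: e unit3_def)
    ultimately have "a = a'" "b = b'" "c = c'" by linarith+
    then show False using that by (simp add: e)
  qed
  have ballsub: "ball m (1/2) \<subseteq> cbox (m - Finite_Cartesian_Product.vec (1/2)) (m + Finite_Cartesian_Product.vec (1/2))"
  proof
    fix p assume "p \<in> ball m (1/2)"
    then have "norm (p - m) < 1/2" by (simp add: dist_norm norm_minus_commute)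
    then have "\<bar>(p - m) $ i\<bar> \<le> 1/2" for i using component_le_norm_cart[of "p - m" i] by linarith
    then have "m $ i - 1/2 \<le> p $ i \<and> p $ i \<le> m $ i + 1/2" for i
      by (metis abs_diff_le_iff vector_minus_component)
    then show "p \<in> cbox (m - Finite_Cartesian_Product.vec (1/2)) (m + Finite_Cartesian_Product.vec (1/2))"
      by (simp add: mem_box_cart)
  qed
  have mcb: "measure lebesgue (cbox (m - Finite_Cartesian_Product.vec r) (m + Finite_Cartesian_Product.vec r)) = (2 * r) ^ 3" if "r \<ge> 0" for r
  proof -
    have "cbox (m - Finite_Cartesian_Product.vec r) (m + Finite_Cartesian_Product.vec r) \<noteq> {}" using that by (simp add: interval_ne_empty_cart)
    then show ?thesis by (simp add: content_cbox_cart prod_constant)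
  qed
  \<comment> \<open>Stated for finite subfamilies because the finiteness of \<open>K\<close> is
    derived from it.\<close>
  have cardle: "real (card K') * ?D \<le> 1" if K': "finite K'" "K' \<subseteq> K" for K'
  proof -
    have "real (card K') * ?D = (\<Sum>k\<in>K'. measure lebesgue (?T k ` unit3))" by (simp add: TU)
    also have "\<dots> = measure lebesgue (\<Union>k\<in>K'. ?T k ` unit3)"
      by (rule measure_UNION'[symmetric]) (use K' TU disj in \<open>auto simp: pairwise_def disjnt_def\<close>)
    also have "\<dots> \<le> measure lebesgue (cbox (m - Finite_Cartesian_Product.vec (1/2)) (m + Finite_Cartesian_Product.vec (1/2)))"
      by (rule measure_mono_fmeasurable)
         (use K' sub ballsub UC TU in \<open>auto intro!: fmeasurableD fmeasurable.finite_UN\<close>, blast)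
    also have "\<dots> = 1" using mcb[of "1/2"] by simp
    finally show ?thesis .
  qed
  have finK: "finite K"
  proof (rule ccontr)
    assume "infinite K"
    then obtain K' where K': "K' \<subseteq> K" "finite K'" "card K' = nat \<lceil>1 / ?D\<rceil> + 1"
      using infinite_arbitrarily_large by blast
    have "1 / ?D < real (nat \<lceil>1 / ?D\<rceil> + 1)" by linarith
    then have "1 < real (card K') * ?D" unfolding K'(3) using D by (simp add: pos_divide_less_eq)
    then show False using cardle[OF K'(2,1)] by simp
  qed
  have cover: "ball m (1/4) \<subseteq> (\<Union>k\<in>K. ?T k ` ?C)"
  proof
    fix p assume p: "p \<in> ball m (1/4)"
    obtain q where q: "p - m = frame w1 w2 w3 q" using frame_inj(2)[OF det] by (metis surjD)
    define k where "k = (\<lfloor>q$1\<rfloor>, \<lfloor>q$2\<rfloor>, \<lfloor>q$3\<rfloor>)"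
    define s where "s = (frac (q$1), frac (q$2), frac (q$3))"
    have "(vector [q$1,q$2,q$3] :: real^3) = q" by (simp add: Finite_Cartesian_Product.vec_eq_iff forall_3)
    then have "?T k s = m + frame w1 w2 w3 q" by (simp add: tile_def k_def s_def frac_def)
    then have e: "p = ?T k s" using q by (simp add: algebra_simps)
    have "frac x \<le> 1" for x :: real using frac_lt_1[of x] by linarith
    then have "s \<in> ?C" by (simp add: s_def frac_ge_0)
    then have "p \<in> ?T k ` ?C" using e by blast
    moreover have "k \<in> K" using calculation p by (auto simp: K_def)
    ultimately show "p \<in> (\<Union>k\<in>K. ?T k ` ?C)" by blast
  qed
  have "cbox (m - Finite_Cartesian_Product.vec (1/8)) (m + Finite_Cartesian_Product.vec (1/8)) \<subseteq> ball m (1/4)"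
  proof
    fix p assume "p \<in> cbox (m - Finite_Cartesian_Product.vec (1/8)) (m + Finite_Cartesian_Product.vec (1/8))"
    then have c: "\<bar>(m - p) $ i\<bar> \<le> 1/8" for i
    proof -
      have "m $ i - 1/8 \<le> p $ i \<and> p $ i \<le> m $ i + 1/8"
        using \<open>p \<in> cbox _ _\<close> by (simp add: mem_box_cart)
      then show ?thesis unfolding vector_minus_component by linarith
    qed
    have "(norm (m - p))\<^sup>2 = (m - p) \<bullet> (m - p)" by (rule power2_norm_eq_inner)
    also have "\<dots> = ((m - p)$1)\<^sup>2 + ((m - p)$2)\<^sup>2 + ((m - p)$3)\<^sup>2"
      by (simp add: inner_vec_def sum_3 power2_eq_square)
    also have "\<dots> \<le> (1/8)\<^sup>2 + (1/8)\<^sup>2 + (1/8)\<^sup>2"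
      using c by (intro add_mono) (metis power2_abs power_mono abs_ge_zero)+
    also have "\<dots> < (1/4)\<^sup>2" by (simp add: power2_eq_square)
    finally have "norm (m - p) < 1/4" by (rule power_less_imp_less_base) simp
    then show "p \<in> ball m (1/4)" by (simp add: dist_norm)
  qed
  then have "measure lebesgue (cbox (m - Finite_Cartesian_Product.vec (1/8)) (m + Finite_Cartesian_Product.vec (1/8))) \<le> measure lebesgue (\<Union>k\<in>K. ?T k ` ?C)"
    by (intro measure_mono_fmeasurable fmeasurable.finite_UN finK TC) (use cover in auto)
  also have "\<dots> \<le> (\<Sum>k\<in>K. measure lebesgue (?T k ` ?C))"
    by (rule measure_UNION_le) (use finK TC in \<open>auto intro: fmeasurableD\<close>)
  also have "\<dots> = real (card K) * ?D" by (simp add: TC)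
  finally have "1/64 \<le> real (card K) * ?D" using mcb[of "1/8"] by (simp add: power3_eq_cube)
  then show ?thesis
    by (intro that[of K] finK disj cardle order_refl order_trans[OF image_mono[OF UC] sub])
qed

section \<open>Zero sets and crossings inside a tile\<close>

lemma AE_unit_poly_nonzero:
  fixes p :: "real poly"
  assumes "p \<noteq> 0"
  shows "AE t in uniform_measure lborel {0<..<1::real}. poly p t \<noteq> 0"
proof (rule AE_uniform_measureI)
  have "AE t in lborel. t \<notin> {t. poly p t = 0}"
    using poly_roots_finite[OF assms] by (intro AE_not_in finite_imp_null_set_lborel)
  then show "AE t in lborel. t \<in> {0<..<1} \<longrightarrow> poly p t \<noteq> 0" by (auto elim!: eventually_mono)
qed simp

text \<open>A single nonzero value is propagated one coordinate at a time, since a nonzero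
  polynomial in one variable has finitely many roots. The point \<open>p\<close> may lie outside the
  tile; surjectivity of the frame still gives it real parameters \<open>(x0,y0,z0)\<close>.\<close>

lemma AE_line_poly_nonzero:
  assumes f: "line_poly n f" "continuous_on UNIV f" and p: "f p \<noteq> 0" and det: "w1 \<bullet> cross3 w2 w3 \<noteq> 0"
  shows "AE s in cube_measure. f (tile m w1 w2 w3 k s) \<noteq> 0"
proof -
  define F where "F = (\<lambda>s. f (tile m w1 w2 w3 k s))"
  let ?U = "uniform_measure lborel {0<..<1::real}"
  interpret U: prob_space ?U by (rule prob_space_unit)
  interpret P: pair_prob_space ?U ?U ..
  interpret Q: pair_prob_space ?U "?U \<Otimes>\<^sub>M ?U" ..
  have tc: "continuous_on UNIV (tile m w1 w2 w3 k)"
    unfolding tile_def frame_def case_prod_unfold vector_3 by (intro continuous_intros)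
  have Fc: "continuous_on UNIV F" unfolding F_def by (rule continuous_on_compose2[OF f(2) tc]) auto
  have lp: "\<exists>q. \<forall>t. f (a + t *\<^sub>R v) = poly q t" for a v using f(1) unfolding line_poly_def by blast
  note sh = tile_shift[of m w1 w2 w3 k]
  have l1: "\<exists>q. \<forall>t. F (t,y,z) = poly q t" for y z
  proof -
    have "tile m w1 w2 w3 k (t,y,z) = (tile m w1 w2 w3 k (0,0,0) + y *\<^sub>R w2 + z *\<^sub>R w3) + t *\<^sub>R w1" for t
      by (subst sh) (simp add: ac_simps)
    then show ?thesis unfolding F_def by (simp only: lp)
  qed
  have l2: "\<exists>q. \<forall>t. F (x,t,z) = poly q t" for x z
  proof -
    have "tile m w1 w2 w3 k (x,t,z) = (tile m w1 w2 w3 k (0,0,0) + x *\<^sub>R w1 + z *\<^sub>R w3) + t *\<^sub>R w2" for t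
      by (subst sh) (simp add: ac_simps)
    then show ?thesis unfolding F_def by (simp only: lp)
  qed
  have l3: "\<exists>q. \<forall>t. F (x,y,t) = poly q t" for x y
    unfolding F_def sh[of x y] by (rule lp)
  have gen: "AE t in ?U. g t \<noteq> 0" if ex: "\<exists>q. \<forall>t. g t = poly q t" and g0: "g t0 \<noteq> 0" for g :: "real \<Rightarrow> real" and t0
  proof -
    obtain q where q: "\<forall>t. g t = poly q t" using ex by (elim exE)
    then have "q \<noteq> 0" using g0 by auto
    then show ?thesis using AE_unit_poly_nonzero[of q] by (simp add: q)
  qed
  obtain q where q: "p - m = frame w1 w2 w3 q" using frame_inj(2)[OF det] by (metis surjD)
  define x0 y0 z0 where "x0 = q$1 - of_int (fst k)" and "y0 = q$2 - of_int (fst (snd k))" and "z0 = q$3 - of_int (snd (snd k))"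
  have "(vector [q$1,q$2,q$3] :: real^3) = q" by (simp add: Finite_Cartesian_Product.vec_eq_iff forall_3)
  then have "tile m w1 w2 w3 k (x0,y0,z0) = p" using q by (simp add: tile_def x0_def y0_def z0_def) (simp add: algebra_simps)
  then have F0: "F (x0,y0,z0) \<noteq> 0" using p by (simp add: F_def)
  have "AE x in ?U. F (x,y0,z0) \<noteq> 0" by (rule gen[OF l1 F0])
  then have "AE x in ?U. AE y in ?U. F (x,y,z0) \<noteq> 0"
    by (rule eventually_mono) (rule gen[OF l2])
  then have tri: "AE x in ?U. AE y in ?U. AE z in ?U. F (x,y,z) \<noteq> 0"
    by (rule eventually_mono) (erule eventually_mono, rule gen[OF l3])
  have nz: "{s. F s \<noteq> 0} \<in> sets borel"
    by (intro borel_open open_Collect_neq Fc continuous_on_const)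
  have s2: "sets (?U \<Otimes>\<^sub>M ?U) = sets borel"
    unfolding borel_prod[symmetric] by (intro sets_pair_measure_cong) simp_all
  have sp2: "space (?U \<Otimes>\<^sub>M ?U) = UNIV" and sp3: "space (?U \<Otimes>\<^sub>M ?U \<Otimes>\<^sub>M ?U) = UNIV"
    by (simp_all add: space_pair_measure)
  have inner: "AE r in ?U \<Otimes>\<^sub>M ?U. F (x,r) \<noteq> 0" if x: "AE y in ?U. AE z in ?U. F (x,y,z) \<noteq> 0" for x
  proof (rule P.AE_pair_measure)
    have "continuous_on UNIV (\<lambda>r. F (x,r))" by (rule continuous_on_compose2[OF Fc]) (auto intro!: continuous_intros)
    then have "{r. F (x,r) \<noteq> 0} \<in> sets borel" by (intro borel_open open_Collect_neq continuous_on_const)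
    then show "{r \<in> space (?U \<Otimes>\<^sub>M ?U). F (x,r) \<noteq> 0} \<in> sets (?U \<Otimes>\<^sub>M ?U)"
      unfolding s2 sp2 by simp
  qed (use x in simp)
  have "AE x in ?U. AE r in ?U \<Otimes>\<^sub>M ?U. F (x,r) \<noteq> 0" using tri by (rule eventually_mono) (rule inner)
  then have "AE s in cube_measure. F s \<noteq> 0"
    unfolding cube_measure_def
  proof (rule Q.AE_pair_measure[rotated])
    show "{s \<in> space (?U \<Otimes>\<^sub>M ?U \<Otimes>\<^sub>M ?U). F s \<noteq> 0} \<in> sets (?U \<Otimes>\<^sub>M ?U \<Otimes>\<^sub>M ?U)"
      using nz unfolding sets_cube_measure[unfolded cube_measure_def] sp3 by simp
  qed
  then show ?thesis by (simp add: F_def)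
qed

lemma AE_cube_measure_unit3: "AE s in cube_measure. s \<in> unit3"
proof -
  interpret prob_space cube_measure by (rule prob_space_cube_measure)
  have u: "unit3 \<in> sets cube_measure" using open_unit3 by (simp add: sets_cube_measure)
  have "emeasure cube_measure unit3 = emeasure cube_measure UNIV"
    using open_unit3 by (simp add: emeasure_cube_measure)
  then have "prob unit3 = 1" using prob_space by (simp add: measure_def)
  then show ?thesis using u by (subst AE_in_set_eq_1) auto
qed

text \<open>A tile map sends segments along the axes to segments along \<open>w1\<close>,
  \<open>w2\<close>, \<open>w3\<close> and multiplies volumes by the triple product. The factors
  \<open>a1\<close>, \<open>a2\<close>, \<open>a3\<close> allow the edges to be multiples of the
  direction vectors.\<close>

lemma measure_cube_le_line_cross:
  fixes m :: "real^3" and k :: "int \<times> int \<times> int"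
  assumes det: "w1 \<bullet> cross3 w2 w3 \<noteq> 0"
    and P: "continuous_on UNIV P"
    and v: "w1 = a1 *\<^sub>R v1" "w2 = a2 *\<^sub>R v2" "w3 = a3 *\<^sub>R v3"
  defines "B \<equiv> tile m w1 w2 w3 k ` unit3" and "F \<equiv> (\<lambda>s. P (tile m w1 w2 w3 k s))"
  shows "\<bar>w1 \<bullet> cross3 w2 w3\<bar> * measure cube_measure (axis_cross1 F) \<le> measure lebesgue (line_cross P v1 B)"
    "\<bar>w1 \<bullet> cross3 w2 w3\<bar> * measure cube_measure (axis_cross2 F) \<le> measure lebesgue (line_cross P v2 B)"
    "\<bar>w1 \<bullet> cross3 w2 w3\<bar> * measure cube_measure (axis_cross3 F) \<le> measure lebesgue (line_cross P v3 B)"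
    "open B" "convex B" 
proof -
  let ?T = "tile m w1 w2 w3 k"
  have tc: "continuous_on UNIV ?T"
    unfolding tile_def frame_def case_prod_unfold vector_3 by (intro continuous_intros)
  have Fc: "continuous_on UNIV F" unfolding F_def by (rule continuous_on_compose2[OF P tc]) auto
  have Ub: "unit3 \<in> sets borel" "bounded unit3"
    using open_unit3 by (auto simp: unit3_def intro!: bounded_Times)
  have BI: "B = (+) (?T (0,0,0)) ` (frame w1 w2 w3 ` ((\<lambda>(x,y,z). vector [x,y,z]) ` unit3))"
    unfolding B_def by (subst tile_eq) (force simp: image_image)
  have hB: "(\<lambda>(x,y,z). vector [x,y,z]) ` unit3 = box 0 (Finite_Cartesian_Product.vec 1 :: real^3)"
  proof (safe, goal_cases)
    case (1 p x y z) then show ?case by (simp add: unit3_def mem_box_cart forall_3)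
  next
    case (2 p)
    then have "(p$1,p$2,p$3) \<in> unit3" by (auto simp: unit3_def mem_box_cart)
    moreover have "p = (\<lambda>(x,y,z). vector [x,y,z]) (p$1,p$2,p$3)" by (simp add: Finite_Cartesian_Product.vec_eq_iff forall_3)
    ultimately show ?case by blast
  qed
  show Bo: "open B"
    unfolding BI hB
    by (intro open_translation open_surjective_linear_image open_box linear_frame frame_inj(2)[OF det])
  show "convex B"
    unfolding BI hB by (intro convex_translation convex_linear_image linear_frame convex_box)
  have key: "\<bar>w1 \<bullet> cross3 w2 w3\<bar> * measure cube_measure C \<le> measure lebesgue (line_cross P v B)"
    if C: "open C" and sub: "?T ` (C \<inter> unit3) \<subseteq> line_cross P v B" for C v
  proof -
    have CU: "C \<inter> unit3 \<in> sets borel" "bounded (C \<inter> unit3)"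
      using C open_unit3 Ub(2) by (auto intro: bounded_subset)
    have "\<bar>w1 \<bullet> cross3 w2 w3\<bar> * measure cube_measure C = measure lebesgue (?T ` (C \<inter> unit3))"
      using measure_linear_coords(2)[OF linear_frame CU, of "?T (0,0,0)" w1 w2 w3] C
      by (simp add: tile_eq[symmetric] det_frame measure_cube_measure)
    also have "\<dots> \<le> measure lebesgue (line_cross P v B)"
    proof (rule measure_mono_fmeasurable[OF sub])
      show "?T ` (C \<inter> unit3) \<in> sets lebesgue"
        using measure_linear_coords(1)[OF linear_frame CU, of "?T (0,0,0)" w1 w2 w3]
        by (simp add: tile_eq[symmetric] fmeasurableD)
      have "bounded B" unfolding BI hB
        by (intro bounded_translation bounded_linear_image bounded_box linear_conv_bounded_linear[THEN iffD1] linear_frame)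
      then have "bounded (line_cross P v B)" by (rule bounded_subset) (auto simp: line_cross_def)
      then show "line_cross P v B \<in> lmeasurable"
        using open_line_cross[OF P Bo, of v] by (intro lmeasurable_open)
    qed
    finally show ?thesis .
  qed
  have inB: "?T s \<in> B" if "s \<in> unit3" for s using that by (simp add: B_def)
  note sh = tile_shift[of m w1 w2 w3 k]
  show "\<bar>w1 \<bullet> cross3 w2 w3\<bar> * measure cube_measure (axis_cross1 F) \<le> measure lebesgue (line_cross P v1 B)"
  proof (rule key[OF open_axis_cross(1)[OF Fc]], safe)
    fix x y z assume a: "(x,y,z) \<in> axis_cross1 F" "(x,y,z) \<in> unit3"
    then obtain t t' where t: "t \<in> {0<..<1}" "t' \<in> {0<..<1}" "F (t,y,z) > 0" "F (t',y,z) < 0"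
      by (auto simp: axis_cross1_def)
    have e: "?T (r,y,z) = ?T (x,y,z) + ((r - x) * a1) *\<^sub>R v1" for r
    proof -
      have "?T (r,y,z) = ?T (x,y,z) + (r - x) *\<^sub>R w1"
        unfolding sh[of r y z] sh[of x y z] by (simp add: algebra_simps)
      then show ?thesis unfolding v(1) by simp
    qed
    have u: "(t,y,z) \<in> unit3" "(t',y,z) \<in> unit3" using a t by (auto simp: unit3_def)
    show "?T (x,y,z) \<in> line_cross P v1 B"
      unfolding line_cross_def mem_Collect_eq
    proof (intro conjI exI)
      show "?T (x,y,z) \<in> B" by (rule inB[OF a(2)])
      show "?T (x,y,z) + ((t - x) * a1) *\<^sub>R v1 \<in> B" unfolding e[symmetric] by (rule inB[OF u(1)])
      show "?T (x,y,z) + ((t' - x) * a1) *\<^sub>R v1 \<in> B" unfolding e[symmetric] by (rule inB[OF u(2)])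
      show "P (?T (x,y,z) + ((t - x) * a1) *\<^sub>R v1) > 0" unfolding e[symmetric] using t(3) by (simp add: F_def)
      show "P (?T (x,y,z) + ((t' - x) * a1) *\<^sub>R v1) < 0" unfolding e[symmetric] using t(4) by (simp add: F_def)
    qed
  qed
  show "\<bar>w1 \<bullet> cross3 w2 w3\<bar> * measure cube_measure (axis_cross2 F) \<le> measure lebesgue (line_cross P v2 B)"
  proof (rule key[OF open_axis_cross(2)[OF Fc]], safe)
    fix x y z assume a: "(x,y,z) \<in> axis_cross2 F" "(x,y,z) \<in> unit3"
    then obtain t t' where t: "t \<in> {0<..<1}" "t' \<in> {0<..<1}" "F (x,t,z) > 0" "F (x,t',z) < 0"
      by (auto simp: axis_cross2_def)
    have e: "?T (x,r,z) = ?T (x,y,z) + ((r - y) * a2) *\<^sub>R v2" for r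
    proof -
      have "?T (x,r,z) = ?T (x,y,z) + (r - y) *\<^sub>R w2"
        unfolding sh[of x r z] sh[of x y z] by (simp add: algebra_simps)
      then show ?thesis unfolding v(2) by simp
    qed
    have u: "(x,t,z) \<in> unit3" "(x,t',z) \<in> unit3" using a t by (auto simp: unit3_def)
    show "?T (x,y,z) \<in> line_cross P v2 B"
      unfolding line_cross_def mem_Collect_eq
    proof (intro conjI exI)
      show "?T (x,y,z) \<in> B" by (rule inB[OF a(2)])
      show "?T (x,y,z) + ((t - y) * a2) *\<^sub>R v2 \<in> B" unfolding e[symmetric] by (rule inB[OF u(1)])
      show "?T (x,y,z) + ((t' - y) * a2) *\<^sub>R v2 \<in> B" unfolding e[symmetric] by (rule inB[OF u(2)])
      show "P (?T (x,y,z) + ((t - y) * a2) *\<^sub>R v2) > 0" unfolding e[symmetric] using t(3) by (simp add: F_def)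
      show "P (?T (x,y,z) + ((t' - y) * a2) *\<^sub>R v2) < 0" unfolding e[symmetric] using t(4) by (simp add: F_def)
    qed
  qed
  show "\<bar>w1 \<bullet> cross3 w2 w3\<bar> * measure cube_measure (axis_cross3 F) \<le> measure lebesgue (line_cross P v3 B)"
  proof (rule key[OF open_axis_cross(3)[OF Fc]], safe)
    fix x y z assume a: "(x,y,z) \<in> axis_cross3 F" "(x,y,z) \<in> unit3"
    then obtain t t' where t: "t \<in> {0<..<1}" "t' \<in> {0<..<1}" "F (x,y,t) > 0" "F (x,y,t') < 0"
      by (auto simp: axis_cross3_def)
    have e: "?T (x,y,r) = ?T (x,y,z) + ((r - z) * a3) *\<^sub>R v3" for r
    proof -
      have "?T (x,y,r) = ?T (x,y,z) + (r - z) *\<^sub>R w3"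
        unfolding sh[of x y r] sh[of x y z] by (simp add: algebra_simps)
      then show ?thesis unfolding v(3) by simp
    qed
    have u: "(x,y,t) \<in> unit3" "(x,y,t') \<in> unit3" using a t by (auto simp: unit3_def)
    show "?T (x,y,z) \<in> line_cross P v3 B"
      unfolding line_cross_def mem_Collect_eq
    proof (intro conjI exI)
      show "?T (x,y,z) \<in> B" by (rule inB[OF a(2)])
      show "?T (x,y,z) + ((t - z) * a3) *\<^sub>R v3 \<in> B" unfolding e[symmetric] by (rule inB[OF u(1)])
      show "?T (x,y,z) + ((t' - z) * a3) *\<^sub>R v3 \<in> B" unfolding e[symmetric] by (rule inB[OF u(2)])
      show "P (?T (x,y,z) + ((t - z) * a3) *\<^sub>R v3) > 0" unfolding e[symmetric] using t(3) by (simp add: F_def)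
      show "P (?T (x,y,z) + ((t' - z) * a3) *\<^sub>R v3) < 0" unfolding e[symmetric] using t(4) by (simp add: F_def)
    qed
  qed
qed

section \<open>Angles and triple products\<close>

unbundle cross3_syntax

text \<open>With \<open>y = x / 2\<close>, the inequality \<open>y <= tan y\<close> gives
  \<open>sin x = 2 sin y cos y >= x (cos y)^2\<close>, and \<open>(cos y)^2 >= 1/2\<close> because
  \<open>cos x >= 0\<close>.\<close>

lemma half_le_sin:
  fixes x :: real
  assumes "0 \<le> x" "x \<le> pi/2"
  shows "x / 2 \<le> sin x"
proof -
  let ?y = "x/2"
  have y: "0 \<le> ?y" "?y \<le> pi/4" using assms by auto
  have c: "cos ?y > 0" by (rule cos_gt_zero_pi) (use y pi_gt_zero in linarith)+
  have "cos x \<ge> 0" by (rule cos_ge_zero) (use assms in auto)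
  then have c2: "2 * (cos ?y)\<^sup>2 \<ge> 1" using cos_double_cos[of ?y] by simp
  have "?y * cos ?y \<le> sin ?y"
  proof -
    have "?y \<le> tan ?y"
      using abs_tan_ge[of ?y] y pi_gt_zero c tan_pos_pi2_le[of ?y] by (cases "?y = 0") auto
    then show ?thesis using c by (simp add: tan_def pos_le_divide_eq)
  qed
  then have "2 * (?y * cos ?y) * cos ?y \<le> 2 * sin ?y * cos ?y"
    using c by (intro mult_right_mono) auto
  also have "\<dots> = sin x" using sin_double[of ?y] by simp
  finally have "x * (cos ?y)\<^sup>2 \<le> sin x" by (simp add: power2_eq_square algebra_simps)
  moreover have "x * (1/2) \<le> x * (cos ?y)\<^sup>2" using c2 assms by (intro mult_left_mono) auto
  ultimately show ?thesis by simp
qed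

lemma sin_arccos_ge:
  assumes "0 \<le> a" "a \<le> 1" "\<tau> \<le> arccos a"
  shows "\<tau> / 2 \<le> sqrt (1 - a\<^sup>2)"
proof -
  have "arccos a / 2 \<le> sin (arccos a)"
    using assms arccos_le_pi2[of a] arccos_lbound[of a] by (intro half_le_sin) auto
  then show ?thesis using assms by (simp add: sin_arccos)
qed

lemma norm_cross_ge_angle:
  assumes v: "norm v1 = 1" "norm v2 = 1" and a: "\<alpha> \<le> line_angle v1 v2"
  shows "\<alpha> / 2 \<le> norm (v1 \<times> v2)"
proof -
  let ?a = "\<bar>v1 \<bullet> v2\<bar>"
  have a1: "?a \<le> 1" using Cauchy_Schwarz_ineq2[of v1 v2] v by simp
  have "(norm (v1 \<times> v2))\<^sup>2 = 1 - ?a\<^sup>2" using norm_cross_dot[of v1 v2] v by simp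
  then have "norm (v1 \<times> v2) = sqrt (1 - ?a\<^sup>2)" by (metis norm_ge_zero real_sqrt_unique)
  then show ?thesis using sin_arccos_ge[of ?a \<alpha>] a1 a v by (simp add: line_angle_def)
qed

definition span_plane :: "real^3 \<Rightarrow> real^3 \<Rightarrow> real^3 \<Rightarrow> (real^3) set" where
  "span_plane q v1 v2 = (+) q ` span {v1, v2}"

lemma is_plane_span_plane:
  assumes "v1 \<times> v2 \<noteq> 0"
  shows "is_plane (span_plane q v1 v2)"
proof -
  have v2: "v2 \<noteq> 0" using assms by auto
  have "independent {v2}" using v2 by (simp add: dependent_single)
  moreover have "v1 \<notin> span {v2}"
  proof
    assume "v1 \<in> span {v2}"
    then obtain k where "v1 = k *\<^sub>R v2" by (auto simp: span_singleton)
    then show False using assms by (simp add: cross_mult_left)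
  qed
  ultimately have ind: "independent {v1, v2}" by (simp add: independent_insert)
  have "v1 \<noteq> v2" using assms by auto
  then have "dim (span {v1,v2}) = 2" using ind by (simp add: dim_eq_card_independent)
  then have "aff_dim (span {v1,v2}) = 2" by (simp add: aff_dim_subspace)
  then show ?thesis unfolding is_plane_def span_plane_def
    by (simp add: affine_translation[symmetric] subspace_imp_affine aff_dim_translation_eq)
qed

text \<open>The triple product is the length of the normal \<open>m\<close> times the sine of the
  angle between \<open>v\<close> and the plane. As \<open>line_plane_angle\<close> is an infimum,
  comparison with one direction suffices, namely with the projection \<open>u\<close> of
  \<open>v\<close>.\<close>

lemma triple_product_ge:
  assumes v: "norm v1 = 1" "norm v2 = 1" "norm v = 1"
    and n: "norm (v1 \<times> v2) \<ge> \<beta>" "\<beta> > 0"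
    and a: "line_plane_angle v (span_plane q v1 v2) > \<tau>"
  shows "\<bar>v \<bullet> (v1 \<times> v2)\<bar> \<ge> \<beta> * (\<tau> / 2)"
proof -
  define m where "m = v1 \<times> v2"
  have m0: "m \<noteq> 0" using n by (auto simp: m_def)
  have perp: "m \<bullet> x = 0" if "x \<in> span {v1,v2}" for x
    using that by (auto simp: span_breakdown_eq span_singleton m_def inner_diff_right inner_add_right dot_cross_self algebra_simps)
  have angle: "\<tau> \<le> line_angle v u" if u: "u \<in> span {v1,v2}" "u \<noteq> 0" for u
  proof -
    let ?S = "{line_angle v (x - y) | x y. x \<in> span_plane q v1 v2 \<and> y \<in> span_plane q v1 v2 \<and> x \<noteq> y}"
    have "line_angle v u \<in> ?S"
    proof -
      have "q + u \<in> span_plane q v1 v2" "q + 0 \<in> span_plane q v1 v2" using u by (auto simp: span_plane_def intro: span_zero)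
      moreover have "u = (q + u) - (q + 0)" "q + u \<noteq> q + 0" using u by auto
      ultimately show ?thesis by (intro CollectI exI[of _ "q + u"] exI[of _ "q + 0"]) simp
    qed
    moreover have "bdd_below ?S"
    proof (rule bdd_belowI)
      fix r assume "r \<in> ?S"
      then obtain x y where "r = line_angle v (x - y)" by blast
      moreover have "\<bar>v \<bullet> (x - y)\<bar> / (norm v * norm (x - y)) \<le> 1"
        using Cauchy_Schwarz_ineq2[of v "x - y"] by (auto intro: divide_le_eq_1[THEN iffD2])
      moreover have "0 \<le> \<bar>v \<bullet> (x - y)\<bar> / (norm v * norm (x - y))" by simp
      ultimately show "0 \<le> r"
        using arccos_lbound[of "\<bar>v \<bullet> (x - y)\<bar> / (norm v * norm (x - y))"] unfolding line_angle_def by linarith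
    qed
    ultimately have "Inf ?S \<le> line_angle v u" by (rule cInf_lower)
    then show ?thesis using a by (simp add: line_plane_angle_def)
  qed
  define k where "k = (v \<bullet> m) / (norm m)\<^sup>2"
  define u where "u = v - k *\<^sub>R m"
  have mu: "m \<bullet> u = 0" using m0 by (simp add: u_def k_def inner_diff_right inner_commute dot_square_norm)
  \<comment> \<open>For \<open>u\<close> orthogonal to \<open>m\<close> the double cross product
    with \<open>m\<close> is \<open>- (norm m)\<^sup>2\<close> times \<open>u\<close>; expanding it
    with \<open>m\<close> as the product of \<open>v1\<close> and \<open>v2\<close> exhibits a
    combination of these two.\<close>
  have usp: "u \<in> span {v1,v2}"
  proof -
    have "m \<times> (m \<times> u) = - (norm m)\<^sup>2 *\<^sub>R u"
      using mu by (simp add: Lagrange dot_square_norm)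
    moreover have "m \<times> (m \<times> u) \<in> span {v1,v2}"
    proof -
      have "m \<times> (m \<times> u) = - ((m \<times> u) \<times> (v1 \<times> v2))" by (metis cross_skew m_def)
      then have "m \<times> (m \<times> u) = ((m \<times> u) \<bullet> v1) *\<^sub>R v2 - ((m \<times> u) \<bullet> v2) *\<^sub>R v1"
        by (simp add: Lagrange)
      then show ?thesis by (simp add: span_diff span_scale span_base)
    qed
    ultimately have "(- 1 / (norm m)\<^sup>2) *\<^sub>R (- (norm m)\<^sup>2 *\<^sub>R u) \<in> span {v1,v2}" by (metis span_scale)
    then show ?thesis using m0 by simp
  qed
  have vm: "v = u + k *\<^sub>R m" by (simp add: u_def)
  have one: "1 = (norm u)\<^sup>2 + (k * norm m)\<^sup>2"
  proof -
    have "1 = v \<bullet> v" using v by (simp add: dot_square_norm)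
    also have "\<dots> = u \<bullet> u + k\<^sup>2 * (m \<bullet> m)"
      unfolding vm using mu by (simp add: inner_add_left inner_add_right inner_commute power2_eq_square)
    finally show ?thesis by (simp add: dot_square_norm power_mult_distrib)
  qed
  have kn: "\<bar>k\<bar> * norm m \<ge> \<tau> / 2"
  proof -
    have s: "\<bar>k\<bar> * norm m = sqrt (1 - (norm u)\<^sup>2)"
      using one by (metis abs_mult abs_norm_cancel add_diff_cancel_left' real_sqrt_abs)
    have u1: "norm u \<le> 1" using one by (metis abs_norm_cancel abs_square_le_1 le_add_same_cancel1 zero_le_power2)
    show ?thesis
    \<comment> \<open>If \<open>v\<close> is normal to the plane, it has no projected direction;
      \<open>v1\<close>, at a right angle to \<open>v\<close>, takes its place.\<close>
    proof (cases "u = 0")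
      case True
      have "v1 \<noteq> 0" using v by auto
      then have "\<tau> \<le> line_angle v v1" by (intro angle) (auto intro: span_base)
      also have "v \<bullet> v1 = 0" using True vm perp[of v1] by (simp add: span_base)
      then have "line_angle v v1 = arccos 0" by (simp add: line_angle_def)
      finally show ?thesis using sin_arccos_ge[of 0 \<tau>] s True by simp
    next
      case False
      have "v \<bullet> u = u \<bullet> u + k * (m \<bullet> u)" unfolding vm by (simp add: inner_add_left)
      then have "v \<bullet> u = (norm u)\<^sup>2" using mu by (simp add: dot_square_norm)
      then have "line_angle v u = arccos (norm u)" using v False by (simp add: line_angle_def power2_eq_square)
      then show ?thesis using sin_arccos_ge[of "norm u" \<tau>] u1 angle[OF usp False] s by simp
    qed
  qed
  have vmk: "\<bar>v \<bullet> m\<bar> = \<bar>k\<bar> * norm m * norm m" using m0 by (simp add: k_def abs_mult power2_eq_square)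
  show ?thesis
  proof (cases "\<tau> \<ge> 0")
    case True
    have "\<beta> * (\<tau> / 2) \<le> norm m * (\<bar>k\<bar> * norm m)" using n kn True by (intro mult_mono) (auto simp: m_def)
    then show ?thesis using vmk by (simp add: m_def algebra_simps)
  next
    case False
    then have "\<beta> * (\<tau> / 2) \<le> 0" using n by (simp add: mult_nonneg_nonpos)
    then show ?thesis by linarith
  qed
qed

unbundle no cross3_syntax

section \<open>Greedy hitting sets\<close>

lemma popular_element:
  assumes "finite T" "finite Y" "\<And>Q. Q \<in> Y \<Longrightarrow> R Q \<subseteq> T \<and> real (card (R Q)) \<ge> r" "T \<noteq> {}"
  shows "\<exists>t\<in>T. real (card {Q\<in>Y. t \<in> R Q}) \<ge> real (card Y) * r / real (card T)"
proof (rule ccontr)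
  assume neg: "\<not> ?thesis"
  have c: "real (card T) > 0" using assms by (simp add: card_gt_0_iff)
  have "real (card Y) * r \<le> (\<Sum>Q\<in>Y. real (card (R Q)))"
    using sum_mono[of Y "\<lambda>_. r" "\<lambda>Q. real (card (R Q))"] assms(3) by simp
  also have "\<dots> = (\<Sum>Q\<in>Y. \<Sum>t\<in>T. if t \<in> R Q then 1 else 0)"
  proof (intro sum.cong refl)
    fix Q assume "Q \<in> Y"
    then have "R Q = {t\<in>T. t \<in> R Q}" using assms(3) by auto
    then show "real (card (R Q)) = (\<Sum>t\<in>T. if t \<in> R Q then 1 else 0)"
      using assms(1) by (simp add: sum.If_cases Int_def)
  qed
  also have "\<dots> = (\<Sum>t\<in>T. real (card {Q\<in>Y. t \<in> R Q}))"
    by (subst sum.swap) (use assms(2) in \<open>simp add: sum.If_cases Int_def\<close>)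
  also have "\<dots> < (\<Sum>t\<in>T. real (card Y) * r / real (card T))"
    using neg assms by (intro sum_strict_mono) (auto simp: not_le)
  also have "\<dots> = real (card Y) * r" using c by simp
  finally show False by simp
qed

text \<open>Among the sets \<open>R Q\<close> not yet hit, \<open>popular_element\<close> finds an
  element that lies in a share \<open>r / card T\<close> of them; adding it removes this
  share.\<close>

lemma greedy_hitting:
  assumes "finite T" "finite Y" "\<And>Q. Q \<in> Y \<Longrightarrow> R Q \<subseteq> T \<and> real (card (R Q)) \<ge> r" "T \<noteq> {}" "r \<le> real (card T)"
  shows "\<exists>S\<subseteq>T. card S \<le> k \<and> real (card {Q\<in>Y. R Q \<inter> S = {}}) \<le> (1 - r / real (card T)) ^ k * real (card Y)"
proof (induction k)
  case 0
  show ?case by (intro exI[of _ "{}"]) simp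
next
  case (Suc k)
  then obtain S where S: "S \<subseteq> T" "card S \<le> k"
    "real (card {Q\<in>Y. R Q \<inter> S = {}}) \<le> (1 - r / real (card T)) ^ k * real (card Y)" by (elim exE conjE)
  let ?Z = "{Q\<in>Y. R Q \<inter> S = {}}"
  have c: "real (card T) > 0" using assms by (simp add: card_gt_0_iff)
  obtain t where t: "t \<in> T" "real (card {Q\<in>?Z. t \<in> R Q}) \<ge> real (card ?Z) * r / real (card T)"
    using popular_element[of T ?Z R r] assms by auto
  have "{Q\<in>Y. R Q \<inter> insert t S = {}} = ?Z - {Q\<in>?Z. t \<in> R Q}" by auto
  then have "card {Q\<in>Y. R Q \<inter> insert t S = {}} = card ?Z - card {Q\<in>?Z. t \<in> R Q}"
    by (simp only:) (rule card_Diff_subset, use assms(2) in auto)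
  moreover have "card {Q\<in>?Z. t \<in> R Q} \<le> card ?Z"
    by (rule card_mono) (use assms(2) in auto)
  ultimately have "real (card {Q\<in>Y. R Q \<inter> insert t S = {}}) = real (card ?Z) - real (card {Q\<in>?Z. t \<in> R Q})"
    by simp
  also have "\<dots> \<le> (1 - r / real (card T)) * real (card ?Z)"
    using t(2) by (simp add: algebra_simps)
  also have "\<dots> \<le> (1 - r / real (card T)) * ((1 - r / real (card T)) ^ k * real (card Y))"
    using S(3) assms(5) c by (intro mult_left_mono) auto
  finally have "real (card {Q\<in>Y. R Q \<inter> insert t S = {}}) \<le> (1 - r / real (card T)) ^ Suc k * real (card Y)"
    by simp
  moreover have "card (insert t S) \<le> Suc k"
    using S(2) finite_subset[OF S(1) assms(1)] by (simp add: card_insert_if)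
  ultimately show ?case using S(1) t(1) by (intro exI[of _ "insert t S"]) simp
qed

text \<open>About \<open>card T / r\<close> greedy steps leave a share of at most
  \<open>exp (-1) <= 1/2\<close>; rounding up costs at most a factor 2 because
  \<open>r <= card T\<close>. In the application \<open>r\<close> is proportional to
  \<open>\<rho>\<close>, so the quotient no longer depends on \<open>\<rho>\<close>.\<close>

lemma hitting_half:
  assumes "finite T" "finite Y" "\<And>Q. Q \<in> Y \<Longrightarrow> R Q \<subseteq> T \<and> real (card (R Q)) \<ge> r" "T \<noteq> {}"
    "0 < r" "r \<le> real (card T)"
  obtains S where "S \<subseteq> T" "real (card S) \<le> 2 * real (card T) / r"
    "real (card {Q\<in>Y. R Q \<inter> S \<noteq> {}}) \<ge> real (card Y) / 2"
proof -
  have c: "real (card T) > 0" using assms by (simp add: card_gt_0_iff)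
  define k where "k = nat \<lceil>real (card T) / r\<rceil>"
  have k: "real k \<ge> real (card T) / r" "real k \<le> real (card T) / r + 1"
  proof -
    have "real_of_int \<lceil>real (card T) / r\<rceil> \<ge> 0" using c assms(5) by (simp only: of_int_0_le_iff zero_le_ceiling) (rule less_le_trans[of _ 0], auto)
    then have "real k = real_of_int \<lceil>real (card T) / r\<rceil>" unfolding k_def by simp
    then show "real k \<ge> real (card T) / r" "real k \<le> real (card T) / r + 1"
      using ceiling_correct[of "real (card T) / r"] by linarith+
  qed
  have "real (card T) / r \<ge> 1" using assms(5,6) by simp
  with k have k2: "real k \<le> 2 * real (card T) / r" by linarith
  have "\<exists>S\<subseteq>T. card S \<le> k \<and> real (card {Q\<in>Y. R Q \<inter> S = {}}) \<le> (1 - r / real (card T)) ^ k * real (card Y)"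
    by (rule greedy_hitting) (fact assms(1,2,4,6) assms(3))+
  then obtain S where S: "S \<subseteq> T" "card S \<le> k"
    "real (card {Q\<in>Y. R Q \<inter> S = {}}) \<le> (1 - r / real (card T)) ^ k * real (card Y)"
    by (elim exE conjE)
  have "(1 - r / real (card T)) ^ k \<le> exp (- (r / real (card T))) ^ k"
    using exp_ge_add_one_self[of "- (r / real (card T))"] assms(6) c by (intro power_mono) auto
  also have "\<dots> = exp (- (r / real (card T) * real k))" by (simp only: exp_of_nat_mult[symmetric]) (simp add: algebra_simps)
  also have "\<dots> \<le> exp (-1)"
    using k(1) c assms(5) by (simp add: field_simps)
  also have "\<dots> \<le> 1/2"
    using exp_ge_add_one_self[of 1] by (simp add: exp_minus field_simps)
  finally have "(1 - r / real (card T)) ^ k * real (card Y) \<le> 1/2 * real (card Y)"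
    by (intro mult_right_mono) auto
  moreover have "{Q\<in>Y. R Q \<inter> S \<noteq> {}} = Y - {Q\<in>Y. R Q \<inter> S = {}}" by auto
  then have "real (card {Q\<in>Y. R Q \<inter> S \<noteq> {}}) = real (card Y) - real (card {Q\<in>Y. R Q \<inter> S = {}})"
    using assms(2) by (simp add: card_Diff_subset of_nat_diff card_mono)
  ultimately show ?thesis using S k2 by (intro that[of S]) linarith+
qed

section \<open>Transverse tubes\<close>

lemma abs_mono3_le:
  assumes "norm x \<le> R" "1 \<le> R" "k \<le> d"
  shows "\<bar>mono3 m k x\<bar> \<le> R ^ (3 * d)"
proof -
  have c: "\<bar>x $ i\<bar> \<le> R" for i using component_le_norm_cart[of x i] assms(1) by linarith
  have "k mod m + k div m mod m + k div m div m \<le> 3 * d"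
  proof -
    have "k mod m \<le> k" "k div m mod m \<le> k" "k div m div m \<le> k"
      by (auto intro: order_trans[OF mod_less_eq_dividend] order_trans[OF div_le_dividend])
    then show ?thesis using assms(3) by linarith
  qed
  then have "R ^ (k mod m) * R ^ (k div m mod m) * R ^ (k div m div m) \<le> R ^ (3 * d)"
    using assms(2) by (simp add: power_add[symmetric] power_increasing)
  moreover have "\<bar>mono3 m k x\<bar> \<le> R ^ (k mod m) * R ^ (k div m mod m) * R ^ (k div m div m)"
    unfolding mono3_def abs_mult power_abs using c assms(2) by (intro mult_mono power_mono) auto
  ultimately show ?thesis by linarith
qed

text \<open>In the constant, \<open>2^32 * 216\<close> collects a factor \<open>64\<close> from the tiling, \<open>64\<close> from the fraction of
  balanced tiles, \<open>2^20\<close> from the crossing inequality and \<open>3 * 72\<close> from the bound for the three tubes,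
  and \<open>221184000 = 3^3 * 1024 * 20^3\<close> comes from the degree and the number of tiles.\<close>

lemma transverse_tubes_count:
  fixes X :: "'q set" and m :: "'q \<Rightarrow> real^3" and T1 T2 T3 :: "'q \<Rightarrow> 't" and base dir :: "'t \<Rightarrow> real^3"
  assumes X: "finite X" "X \<noteq> {}"
    and disj: "\<And>Q R. Q \<in> X \<Longrightarrow> R \<in> X \<Longrightarrow> Q \<noteq> R \<Longrightarrow> ball (m Q) (1/2) \<inter> ball (m R) (1/2) = {}"
    and S: "finite S" "\<And>Q. Q \<in> X \<Longrightarrow> T1 Q \<in> S" "\<And>Q. Q \<in> X \<Longrightarrow> T2 Q \<in> S" "\<And>Q. Q \<in> X \<Longrightarrow> T3 Q \<in> S"
    and dir: "\<And>t. t \<in> S \<Longrightarrow> norm (dir t) = 1"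
    and \<theta>: "\<theta> > 0" "\<And>Q. Q \<in> X \<Longrightarrow> \<theta> \<le> \<bar>dir (T1 Q) \<bullet> cross3 (dir (T2 Q)) (dir (T3 Q))\<bar>"
    and near: "\<And>Q t x. Q \<in> X \<Longrightarrow> t \<in> {T1 Q, T2 Q, T3 Q} \<Longrightarrow> x \<in> ball (m Q) (1/2) \<Longrightarrow> \<exists>s. dist x (base t + s *\<^sub>R dir t) \<le> 3"
  shows "\<theta> * (real (card X))\<^sup>2 \<le> (2^32 * 216)^3 * 221184000 * real (card S) ^ 3"
proof -
  \<comment> \<open>Edges of length \<open>1/20\<close> meet the requirement of
    \<open>tile_family\<close>; the triple product drops by the factor
    \<open>20^3 = 8000\<close>.\<close>
  define w1 where "w1 Q = (1/20) *\<^sub>R dir (T1 Q)" for Q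
  define w2 where "w2 Q = (1/20) *\<^sub>R dir (T2 Q)" for Q
  define w3 where "w3 Q = (1/20) *\<^sub>R dir (T3 Q)" for Q
  define \<Delta> where "\<Delta> Q = \<bar>w1 Q \<bullet> cross3 (w2 Q) (w3 Q)\<bar>" for Q
  have \<Delta>: "\<theta> / 8000 \<le> \<Delta> Q" if "Q \<in> X" for Q
    using \<theta>(2)[OF that] by (simp add: \<Delta>_def w1_def w2_def w3_def cross_mult_left cross_mult_right abs_mult)
  have \<Delta>0: "\<Delta> Q > 0" if "Q \<in> X" for Q using \<Delta>[OF that] \<theta>(1) by linarith
  have det: "w1 Q \<bullet> cross3 (w2 Q) (w3 Q) \<noteq> 0" if "Q \<in> X" for Q using \<Delta>0[OF that] by (auto simp: \<Delta>_def)
  define Tl where "Tl Q = tile (m Q) (w1 Q) (w2 Q) (w3 Q)" for Q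
  have "\<exists>K. finite K \<and> (\<forall>k\<in>K. Tl Q k ` unit3 \<subseteq> ball (m Q) (1/2)) \<and>
      (\<forall>k k'. k \<noteq> k' \<longrightarrow> Tl Q k ` unit3 \<inter> Tl Q k' ` unit3 = {}) \<and>
      real (card K) * \<Delta> Q \<le> 1 \<and> 1/64 \<le> real (card K) * \<Delta> Q" if Q: "Q \<in> X" for Q
  proof -
    have "norm (w1 Q) \<le> 1/20" "norm (w2 Q) \<le> 1/20" "norm (w3 Q) \<le> 1/20"
      using dir S Q by (auto simp: w1_def w2_def w3_def)
    from tile_family[OF det[OF Q] this, of "m Q"] obtain K where "finite K"
      "\<And>k. k \<in> K \<Longrightarrow> Tl Q k ` unit3 \<subseteq> ball (m Q) (1/2)"
      "\<And>k k'. k \<noteq> k' \<Longrightarrow> Tl Q k ` unit3 \<inter> Tl Q k' ` unit3 = {}"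
      "real (card K) * \<Delta> Q \<le> 1" "1/64 \<le> real (card K) * \<Delta> Q"
      unfolding Tl_def \<Delta>_def by metis
    then show ?thesis by (intro exI[of _ K]) simp
  qed
  then have "\<forall>Q\<in>X. \<exists>K. finite K \<and> (\<forall>k\<in>K. Tl Q k ` unit3 \<subseteq> ball (m Q) (1/2)) \<and>
      (\<forall>k k'. k \<noteq> k' \<longrightarrow> Tl Q k ` unit3 \<inter> Tl Q k' ` unit3 = {}) \<and>
      real (card K) * \<Delta> Q \<le> 1 \<and> 1/64 \<le> real (card K) * \<Delta> Q" by (rule ballI)
  from bchoice[OF this] obtain K where K: "\<forall>Q\<in>X. finite (K Q) \<and> (\<forall>k\<in>K Q. Tl Q k ` unit3 \<subseteq> ball (m Q) (1/2)) \<and>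
      (\<forall>k k'. k \<noteq> k' \<longrightarrow> Tl Q k ` unit3 \<inter> Tl Q k' ` unit3 = {}) \<and>
      real (card (K Q)) * \<Delta> Q \<le> 1 \<and> 1/64 \<le> real (card (K Q)) * \<Delta> Q" by (elim exE)
  define I where "I = Sigma X K"
  have finI: "finite I" unfolding I_def using X K by auto
  define J where "J = card I"
  obtain e where e: "bij_betw e {..<J} I"
    using ex_bij_betw_nat_finite[OF finI] unfolding J_def atLeast0LessThan by (elim exE)
  have eI: "e j \<in> I" if "j < J" for j using bij_betwE[OF e] that by auto
  define q where "q j = fst (e j)" for j
  define B where "B j = Tl (q j) (snd (e j)) ` unit3" for j
  have qX: "q j \<in> X" and kK: "snd (e j) \<in> K (q j)" if "j < J" for j
    using eI[OF that] by (auto simp: I_def q_def)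
  have Bb: "B j \<subseteq> ball (m (q j)) (1/2)" if "j < J" for j
    using K qX[OF that] kK[OF that] by (auto simp only: B_def)
  have Bdisj: "B i \<inter> B j = {}" if ij: "i < J" "j < J" "i \<noteq> j" for i j
  proof (cases "q i = q j")
    case True
    have "e i \<noteq> e j" using bij_betw_imp_inj_on[OF e] ij by (auto simp: inj_on_def)
    then have "snd (e i) \<noteq> snd (e j)" using True by (auto simp: q_def prod_eq_iff)
    then show ?thesis using K qX[OF ij(2)] True unfolding B_def by metis
  next
    case False
    then show ?thesis using disj[OF qX[OF ij(1)] qX[OF ij(2)] False] Bb[OF ij(1)] Bb[OF ij(2)] by blast
  qed
  have sumq: "(\<Sum>j<J. \<Delta> (q j)) = (\<Sum>Q\<in>X. real (card (K Q)) * \<Delta> Q)"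
  proof -
    have "(\<Sum>j<J. \<Delta> (q j)) = (\<Sum>p\<in>I. \<Delta> (fst p))"
      unfolding q_def by (rule sum.reindex_bij_betw[OF e])
    also have "\<dots> = (\<Sum>Q\<in>X. \<Sum>k\<in>K Q. \<Delta> Q)"
      unfolding I_def using X K by (subst sum.Sigma) (auto simp: case_prod_unfold)
    finally show ?thesis by simp
  qed
  define x where "x = real (card X)"
  have x0: "x > 0" using X by (simp add: x_def card_gt_0_iff)
  have Wge: "x / 64 \<le> (\<Sum>j<J. \<Delta> (q j))"
  proof -
    have "(\<Sum>Q\<in>X. 1/64) \<le> (\<Sum>Q\<in>X. real (card (K Q)) * \<Delta> Q)" by (rule sum_mono) (use K in auto)
    then show ?thesis by (simp add: sumq x_def)
  qed
  have Jle: "real J * \<theta> \<le> 8000 * x"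
  proof -
    have "real J * (\<theta> / 8000) = (\<Sum>j<J. \<theta> / 8000)" by simp
    also have "\<dots> \<le> (\<Sum>j<J. \<Delta> (q j))" by (rule sum_mono) (use \<Delta> qX in auto)
    also have "\<dots> \<le> (\<Sum>Q\<in>X. 1)" unfolding sumq by (rule sum_mono) (use K in auto)
    finally show ?thesis by (simp add: x_def)
  qed
  have J0: "J > 0"
  proof (rule ccontr)
    assume "\<not> J > 0"
    then show False using Wge x0 by simp
  qed
  \<comment> \<open>The least such \<open>M\<close>: \<open>M ^ 3\<close> is large enough for
    \<open>balanced_combination\<close>, while minimality bounds \<open>(M - 1) ^ 3\<close>, and the
    degree on lines is \<open>3 * (M - 1)\<close>.\<close>
  define M where "M = (LEAST M. 1024 * J \<le> M ^ 3)"
  have "1024 * J \<le> (1024 * J) ^ 3" by (rule self_le_power) (use J0 in auto)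
  then have M: "1024 * J \<le> M ^ 3" unfolding M_def by (rule LeastI)
  have M0: "M > 0" using M J0 by (cases "M = 0") auto
  have M1: "(M - 1) ^ 3 < 1024 * J"
    using not_less_Least[of "M - 1" "\<lambda>M. 1024 * J \<le> M ^ 3"] M0 by (simp add: M_def[symmetric] not_le)
  define d where "d = M ^ 3"
  define n where "n = 3 * (M - 1)"
  have tc: "continuous_on UNIV (Tl Q k)" for Q k
    unfolding Tl_def tile_def frame_def case_prod_unfold vector_3 by (intro continuous_intros)
  have mc: "continuous_on UNIV (\<lambda>s. mono3 M k (Tl Q k' s))" for k Q k'
    by (rule continuous_on_compose2[OF continuous_mono3 tc]) auto
  have [measurable]: "unit3 \<in> sets borel" using open_unit3 by simp
  \<comment> \<open>The indicator makes \<open>b\<close> bounded on the whole space, which is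
    \<open>UNIV\<close> for \<open>cube_measure\<close>; almost all \<open>s\<close> lie in
    \<open>unit3\<close>.\<close>
  define b where "b j k s = indicator unit3 s * mono3 M k (Tl (q j) (snd (e j)) s)" for j k s
  interpret prob_space cube_measure by (rule prob_space_cube_measure)
  define bal where "bal c j \<longleftrightarrow> prob {s \<in> space cube_measure. (\<Sum>k<d. c k * b j k s) > 0} \<ge> 1/1024 \<and>
                    prob {s \<in> space cube_measure. (\<Sum>k<d. c k * b j k s) < 0} \<ge> 1/1024" for c j
  define R where "R = 1 + (\<Sum>Q\<in>X. norm (m Q) + 1)"
  have mR: "norm (m Q) + 1 \<le> R" if "Q \<in> X" for Q
    using member_le_sum[of Q X "\<lambda>Q. norm (m Q) + 1"] that X by (simp add: R_def)
  have nonzero: "\<exists>p. (\<Sum>k<d. c k * mono3 M k p) \<noteq> 0" if c: "(\<Sum>k<d. (c k)\<^sup>2) = 1" for c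
  proof (rule ccontr)
    assume "\<not> ?thesis"
    then have "c k = 0" if "k < d" for k
      using mono3_independent[where m = M and c = c and k = k] that by (simp add: d_def)
    then show False using c by simp
  qed
  have lp: "line_poly n (\<lambda>x. \<Sum>k<d. c k * mono3 M k x)" for c
    unfolding n_def d_def by (intro line_poly_sum line_poly_mono3)
  have Pc: "continuous_on UNIV (\<lambda>x. \<Sum>k<d. c k * mono3 M k x)" for c :: "nat \<Rightarrow> real"
    by (intro continuous_intros continuous_mono3)
  \<comment> \<open>The weights are the volumes of the tiles, since tiles of different cubes differ
    in size and volumes are compared at the end.\<close>
  have "\<exists>c. (\<Sum>j | j < J \<and> bal c j. \<bar>\<Delta> (q j)\<bar>) \<ge> (\<Sum>j<J. \<bar>\<Delta> (q j)\<bar>) / 64"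
    unfolding bal_def
  proof (rule balanced_combination[where K = "R ^ (3 * d)"])
    show "b j k \<in> borel_measurable cube_measure" for j k
    proof -
      have [measurable]: "(\<lambda>s. mono3 M k (Tl (q j) (snd (e j)) s)) \<in> borel_measurable borel"
        by (rule borel_measurable_continuous_onI[OF mc])
      show ?thesis unfolding b_def by measurable
    qed
    show "\<bar>b j k s\<bar> \<le> R ^ (3 * d)" if "j < J" "k < d" "s \<in> space cube_measure" for j k s
    proof (cases "s \<in> unit3")
      case True
      then have "Tl (q j) (snd (e j)) s \<in> ball (m (q j)) (1/2)" using Bb[OF that(1)] by (auto simp: B_def)
      then have "dist (m (q j)) (Tl (q j) (snd (e j)) s) < 1/2" by simp
      then have "norm (Tl (q j) (snd (e j)) s) \<le> norm (m (q j)) + 1"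
        using norm_triangle_sub[of "Tl (q j) (snd (e j)) s" "m (q j)"] by (simp add: dist_norm norm_minus_commute)
      then have "norm (Tl (q j) (snd (e j)) s) \<le> R" using mR[OF qX[OF that(1)]] by linarith
      moreover have "1 \<le> R" unfolding R_def by (simp add: sum_nonneg)
      ultimately show ?thesis using True abs_mono3_le[of _ R k d M] that by (simp add: b_def)
    next
      case False
      have "1 \<le> R" unfolding R_def by (simp add: sum_nonneg)
      then show ?thesis using False by (simp add: b_def)
    qed
    show "AE s in cube_measure. (\<Sum>k<d. c k * b j k s) \<noteq> 0" if j: "j < J" and c1: "(\<Sum>k<d. (c k)\<^sup>2) = 1" for j c
    proof -
      obtain p where p: "(\<Sum>k<d. c k * mono3 M k p) \<noteq> 0" using nonzero[OF c1] by (elim exE)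
      have "AE s in cube_measure. (\<Sum>k<d. c k * mono3 M k (Tl (q j) (snd (e j)) s)) \<noteq> 0"
        unfolding Tl_def by (rule AE_line_poly_nonzero[OF lp Pc p det[OF qX[OF j]]])
      then show ?thesis using AE_cube_measure_unit3 by (rule eventually_elim2) (simp add: b_def)
    qed
    show "1024 * J \<le> d" using M by (simp add: d_def)
    show "J > 0" by (rule J0)
    show "\<bar>\<Delta> (q j)\<bar> \<ge> 0" for j by (rule abs_ge_zero)
  qed
  then obtain c where c: "(\<Sum>j<J. \<bar>\<Delta> (q j)\<bar>) / 64 \<le> (\<Sum>j | j < J \<and> bal c j. \<bar>\<Delta> (q j)\<bar>)" by (elim exE)
  have absd: "\<bar>\<Delta> (q j)\<bar> = \<Delta> (q j)" for j by (simp add: \<Delta>_def)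
  define P where "P = (\<lambda>x. \<Sum>k<d. c k * mono3 M k x)"
  have lpP: "line_poly n P" and PcP: "continuous_on UNIV P" unfolding P_def by (rule lp, rule Pc)
  have Bprop: "open (B j)" "convex (B j)"
    "\<Delta> (q j) * measure cube_measure (axis_cross1 (\<lambda>s. P (Tl (q j) (snd (e j)) s))) \<le> measure lebesgue (line_cross P (dir (T1 (q j))) (B j))"
    "\<Delta> (q j) * measure cube_measure (axis_cross2 (\<lambda>s. P (Tl (q j) (snd (e j)) s))) \<le> measure lebesgue (line_cross P (dir (T2 (q j))) (B j))"
    "\<Delta> (q j) * measure cube_measure (axis_cross3 (\<lambda>s. P (Tl (q j) (snd (e j)) s))) \<le> measure lebesgue (line_cross P (dir (T3 (q j))) (B j))"
    if j: "j < J" for j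
    using measure_cube_le_line_cross[OF det[OF qX[OF j]] PcP w1_def[of "q j"] w2_def[of "q j"] w3_def[of "q j"], of "m (q j)" "snd (e j)"]
    unfolding \<Delta>_def B_def Tl_def by blast+
  have each: "\<Delta> (q j) \<le> 2^20 * (measure lebesgue (line_cross P (dir (T1 (q j))) (B j))
     + measure lebesgue (line_cross P (dir (T2 (q j))) (B j)) + measure lebesgue (line_cross P (dir (T3 (q j))) (B j)))"
    if j: "j < J" and bj: "bal c j" for j
  proof -
    let ?F = "\<lambda>s. P (Tl (q j) (snd (e j)) s)"
    have Fc: "continuous_on UNIV ?F" by (rule continuous_on_compose2[OF PcP tc]) auto
    have Fo: "{s. ?F s > 0} \<in> sets borel" "{s. ?F s < 0} \<in> sets borel"
      by (intro borel_open open_Collect_less Fc continuous_on_const)+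
    have bF: "(\<Sum>k<d. c k * b j k s) = indicator unit3 s * ?F s" for s
      by (simp add: b_def P_def sum_distrib_left algebra_simps)
    have pos: "1/1024 \<le> prob {s. ?F s > 0}"
    proof -
      have "1/1024 \<le> prob {s \<in> space cube_measure. (\<Sum>k<d. c k * b j k s) > 0}" using bj by (simp add: bal_def)
      also have "\<dots> \<le> prob {s. ?F s > 0}"
        unfolding bF by (rule finite_measure_mono) (use Fo in \<open>auto simp: sets_cube_measure indicator_def split: if_splits\<close>)
      finally show ?thesis .
    qed
    have neg: "1/1024 \<le> prob {s. ?F s < 0}"
    proof -
      have "1/1024 \<le> prob {s \<in> space cube_measure. (\<Sum>k<d. c k * b j k s) < 0}" using bj by (simp add: bal_def)
      also have "\<dots> \<le> prob {s. ?F s < 0}"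
        unfolding bF by (rule finite_measure_mono) (use Fo in \<open>auto simp: sets_cube_measure indicator_def split: if_splits\<close>)
      finally show ?thesis .
    qed
    have "{s. ?F s > 0} \<noteq> {}"
    proof
      assume em: "{s. ?F s > 0} = {}"
      show False using pos unfolding em by simp
    qed
    then obtain s0 where "?F s0 > 0" by auto
    then have p0: "P (Tl (q j) (snd (e j)) s0) \<noteq> 0" by simp
    have null: "AE s in cube_measure. ?F s \<noteq> 0"
      unfolding Tl_def by (rule AE_line_poly_nonzero[OF lpP PcP p0 det[OF qX[OF j]]])
    have "(1/1024)\<^sup>2 \<le> prob (axis_cross1 ?F) + prob (axis_cross2 ?F) + prob (axis_cross3 ?F)"
      by (rule cube_crossing[OF Fc null pos neg]) simp
    then have "\<Delta> (q j) * (1/1024)\<^sup>2 \<le> \<Delta> (q j) * (prob (axis_cross1 ?F) + prob (axis_cross2 ?F) + prob (axis_cross3 ?F))"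
      using \<Delta>0[OF qX[OF j]] by (intro mult_left_mono) auto
    also have "\<dots> \<le> measure lebesgue (line_cross P (dir (T1 (q j))) (B j))
     + measure lebesgue (line_cross P (dir (T2 (q j))) (B j)) + measure lebesgue (line_cross P (dir (T3 (q j))) (B j))"
      using Bprop(3-5)[OF j] by (simp add: distrib_left)
    finally show ?thesis by (simp add: power2_eq_square)
  qed
  \<comment> \<open>Tiles are grouped by the tube assigned to their cube, so a tube is charged
    \<open>72 * n\<close> once for all of its tiles, however many cubes share it.\<close>
  have fam: "(\<Sum>j<J. measure lebesgue (line_cross P (dir (T (q j))) (B j))) \<le> real (card S) * (72 * real n)"
    if T: "\<And>Q. Q \<in> X \<Longrightarrow> T Q \<in> S" "\<And>Q. Q \<in> X \<Longrightarrow> T Q \<in> {T1 Q, T2 Q, T3 Q}" for T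
  proof -
    have "(\<Sum>j<J. measure lebesgue (line_cross P (dir (T (q j))) (B j)))
      = (\<Sum>t\<in>S. \<Sum>j | j \<in> {..<J} \<and> T (q j) = t. measure lebesgue (line_cross P (dir (T (q j))) (B j)))"
      by (rule sum.group[symmetric]) (use S(1) T(1) qX in auto)
    also have "\<dots> \<le> (\<Sum>t\<in>S. 72 * real n)"
    proof (rule sum_mono)
      fix t assume t: "t \<in> S"
      have "(\<Sum>j | j \<in> {..<J} \<and> T (q j) = t. measure lebesgue (line_cross P (dir t) (B j))) \<le> 72 * real n"
      proof (rule tube_crossing_bound[OF lpP PcP dir[OF t], where c = "base t"])
        fix i j assume "i \<in> {j. j \<in> {..<J} \<and> T (q j) = t}" "j \<in> {j. j \<in> {..<J} \<and> T (q j) = t}" "i \<noteq> j"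
        then show "B i \<inter> B j = {}" using Bdisj by auto
      next
        fix i p p' assume i: "i \<in> {j. j \<in> {..<J} \<and> T (q j) = t}" and p: "p \<in> B i" "p' \<in> B i"
        then have "dist (m (q i)) p < 1/2" "dist (m (q i)) p' < 1/2" using Bb[of i] by auto
        then show "dist p p' \<le> 1" using dist_triangle3[of p p' "m (q i)"] by linarith
      next
        fix i p assume i: "i \<in> {j. j \<in> {..<J} \<and> T (q j) = t}" and p: "p \<in> B i"
        have "p \<in> ball (m (q i)) (1/2)" using Bb[of i] i p by auto
        then show "\<exists>s. dist p (base t + s *\<^sub>R dir t) \<le> 3"
          using i by (intro near[of "q i"]) (use T(2)[of "q i"] qX[of i] in auto)
      next
        fix i assume i: "i \<in> {j. j \<in> {..<J} \<and> T (q j) = t}"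
        then have "i < J" by simp
        then show "open (B i)" "convex (B i)" by (rule Bprop(1), rule Bprop(2))
      qed simp
      moreover have "(\<Sum>j | j \<in> {..<J} \<and> T (q j) = t. measure lebesgue (line_cross P (dir (T (q j))) (B j)))
        = (\<Sum>j | j \<in> {..<J} \<and> T (q j) = t. measure lebesgue (line_cross P (dir t) (B j)))"
        by (rule sum.cong) auto
      ultimately show "(\<Sum>j | j \<in> {..<J} \<and> T (q j) = t. measure lebesgue (line_cross P (dir (T (q j))) (B j))) \<le> 72 * real n"
        by (simp only:)
    qed
    finally show ?thesis by simp
  qed
  have "x / 64 / 64 \<le> (\<Sum>j | j < J \<and> bal c j. \<Delta> (q j))" using c Wge unfolding absd by linarith
  also have "\<dots> \<le> (\<Sum>j | j < J \<and> bal c j. 2^20 * (measure lebesgue (line_cross P (dir (T1 (q j))) (B j))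
     + measure lebesgue (line_cross P (dir (T2 (q j))) (B j)) + measure lebesgue (line_cross P (dir (T3 (q j))) (B j))))"
    by (rule sum_mono, elim CollectE conjE, rule each)
  also have "\<dots> \<le> (\<Sum>j<J. 2^20 * (measure lebesgue (line_cross P (dir (T1 (q j))) (B j))
     + measure lebesgue (line_cross P (dir (T2 (q j))) (B j)) + measure lebesgue (line_cross P (dir (T3 (q j))) (B j))))"
    by (rule sum_mono2) auto
  also have "\<dots> = 2^20 * ((\<Sum>j<J. measure lebesgue (line_cross P (dir (T1 (q j))) (B j)))
     + (\<Sum>j<J. measure lebesgue (line_cross P (dir (T2 (q j))) (B j))) + (\<Sum>j<J. measure lebesgue (line_cross P (dir (T3 (q j))) (B j))))"
    by (simp add: sum.distrib sum_distrib_left[symmetric])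
  also have "\<dots> \<le> 2^20 * (real (card S) * (72 * real n) + real (card S) * (72 * real n) + real (card S) * (72 * real n))"
    by (intro mult_left_mono add_mono fam) (use S in auto)
  finally have main: "x \<le> (2^32 * 216) * real (card S) * real n" by (simp add: ac_simps)
  have n3: "real n ^ 3 * \<theta> \<le> 221184000 * x"
  proof -
    have "real ((M - 1) ^ 3) \<le> 1024 * real J" using M1 by linarith
    then have "real n ^ 3 \<le> 27648 * real J" by (simp add: n_def power_mult_distrib)
    then have "real n ^ 3 * \<theta> \<le> 27648 * real J * \<theta>" using \<theta>(1) by (intro mult_right_mono) auto
    then show ?thesis using Jle by linarith
  qed
  \<comment> \<open>Cubing \<open>main\<close> and multiplying by \<open>\<theta>\<close> produces
    \<open>\<theta> * n ^ 3\<close>, which \<open>n3\<close> bounds by a multiple of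
    \<open>x\<close>; one factor \<open>x\<close> then cancels.\<close>
  have "x ^ 3 \<le> ((2^32 * 216) * real (card S) * real n) ^ 3" using main x0 by (intro power_mono) auto
  then have "\<theta> * x ^ 3 \<le> \<theta> * ((2^32 * 216) * real (card S) * real n) ^ 3" using \<theta>(1) by (intro mult_left_mono) auto
  also have "\<dots> = (2^32 * 216)^3 * real (card S) ^ 3 * (real n ^ 3 * \<theta>)"
    by (simp only: power_mult_distrib ac_simps)
  also have "\<dots> \<le> (2^32 * 216)^3 * real (card S) ^ 3 * (221184000 * x)"
    by (intro mult_left_mono n3) auto
  finally have "(\<theta> * x\<^sup>2) * x \<le> ((2^32 * 216)^3 * 221184000 * real (card S) ^ 3) * x"
    by (simp only: power2_eq_square power3_eq_cube ac_simps)
  then show ?thesis using x0 unfolding x_def by (rule mult_right_le_imp_le)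
qed

section \<open>From cubes and tubes to transverse triples\<close>

text \<open>Cubes may be rotated, so their shape enters the proof only through the inscribed ball
  and a ball around the cube; half the diagonal is \<open>sqrt 3 / 2 <= 1\<close>.\<close>

lemma unit_cube_center:
  assumes "is_unit_cube Q"
  shows "\<exists>m. ball m (1/2) \<subseteq> Q \<and> Q \<subseteq> cball m 1"
proof -
  obtain c f where f: "orthogonal_transformation f" and Q: "Q = (\<lambda>x. c + f x) ` cbox 0 (1::real^3)"
    using assms unfolding is_unit_cube_def by (elim exE conjE)
  have lf: "linear f" using f by (simp add: orthogonal_transformation_def)
  have fn: "norm (f x) = norm x" for x using f by (simp add: orthogonal_transformation)
  define h where "h = (Finite_Cartesian_Product.vec (1/2) :: real^3)"
  show ?thesis
  proof (intro exI[of _ "c + f h"] conjI subsetI)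
    fix p assume p: "p \<in> ball (c + f h) (1/2)"
    obtain z where z: "f z = p - c" using orthogonal_transformation_surj[OF f] by (metis surjD)
    have "p - (c + f h) = f (z - h)" using z by (simp add: linear_diff[OF lf])
    then have "norm (z - h) < 1/2" using p fn[of "z - h"] by (simp add: dist_norm norm_minus_commute)
    then have "\<bar>(z - h) $ i\<bar> < 1/2" for i using component_le_norm_cart[of "z - h" i] by linarith
    then have "\<bar>z $ i - 1/2\<bar> < 1/2" for i by (simp add: h_def)
    then have "0 \<le> z $ i \<and> z $ i \<le> 1" for i by (smt (verit) field_sum_of_halves)
    then have "z \<in> cbox 0 1" by (simp add: mem_box_cart)
    moreover have "p = c + f z" using z by simp
    ultimately show "p \<in> Q" unfolding Q by (rule rev_image_eqI)
  next
    fix p assume "p \<in> Q"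
    then obtain z where z: "z \<in> cbox 0 1" "p = c + f z" unfolding Q by (rule imageE)
    have c: "\<bar>(z - h) $ i\<bar> \<le> 1/2" for i
    proof -
      have "0 \<le> z $ i \<and> z $ i \<le> 1" using z(1) by (simp add: mem_box_cart)
      then show ?thesis unfolding vector_minus_component h_def vec_component by linarith
    qed
    have "(norm (z - h))\<^sup>2 = (z - h) \<bullet> (z - h)" by (rule power2_norm_eq_inner)
    also have "\<dots> = ((z - h)$1)\<^sup>2 + ((z - h)$2)\<^sup>2 + ((z - h)$3)\<^sup>2"
      by (simp add: inner_vec_def sum_3 power2_eq_square)
    also have "\<dots> \<le> (1/2)\<^sup>2 + (1/2)\<^sup>2 + (1/2)\<^sup>2"
      using c by (intro add_mono) (metis power2_abs power_mono abs_ge_zero)+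
    also have "\<dots> \<le> 1\<^sup>2" by (simp add: power2_eq_square)
    finally have "norm (z - h) \<le> 1" by (rule power2_le_imp_le) simp
    moreover have "(c + f h) - p = f (h - z)" using z by (simp add: linear_diff[OF lf])
    ultimately show "p \<in> cball (c + f h) 1" using fn[of "h - z"] by (simp add: dist_norm norm_minus_commute)
  qed
qed

lemma tube_direction:
  assumes "is_tube l T" "l > 0"
  shows "norm (tube_direction T) = 1" "\<exists>a l. T = unit_cylinder l a (tube_direction T)"
proof -
  have "\<exists>v. norm v = 1 \<and> (\<exists>l a. l > 0 \<and> T = unit_cylinder l a v)"
    using assms unfolding is_tube_def by blast
  then have "norm (tube_direction T) = 1 \<and> (\<exists>l a. l > 0 \<and> T = unit_cylinder l a (tube_direction T))"
    unfolding tube_direction_def by (rule someI_ex)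
  then show "norm (tube_direction T) = 1" "\<exists>a l. T = unit_cylinder l a (tube_direction T)" by blast+
qed

lemma exists_plane_through: "\<exists>P. is_plane P \<and> q \<in> P"
proof -
  have "cross3 (axis 1 1) (axis 2 1) \<noteq> 0"
    by (simp add: cross3_def axis_def Finite_Cartesian_Product.vec_eq_iff forall_3)
  then have "is_plane (span_plane q (axis 1 1) (axis 2 1))" by (rule is_plane_span_plane)
  moreover have "q \<in> span_plane q (axis 1 1) (axis 2 1)"
    unfolding span_plane_def using span_zero by force
  ultimately show ?thesis by blast
qed

lemma card_filter_compl:
  assumes "finite A"
  shows "real (card {x\<in>A. P x}) + real (card {x\<in>A. \<not> P x}) = real (card A)"
proof -
  have "card A = card ({x\<in>A. P x} \<union> {x\<in>A. \<not> P x})" by (rule arg_cong[where f=card]) auto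
  also have "\<dots> = card {x\<in>A. P x} + card {x\<in>A. \<not> P x}"
    by (rule card_Un_disjoint) (use assms in auto)
  finally show ?thesis by simp
qed

lemma choose_hitting:
  assumes "finite T" "finite Y" "\<And>Q. Q \<in> Y \<Longrightarrow> R Q \<subseteq> T \<and> real (card (R Q)) \<ge> r" "T \<noteq> {}"
    "0 < r" "r \<le> real (card T)"
  shows "\<exists>S Y' g. S \<subseteq> T \<and> real (card S) \<le> 2 * real (card T) / r \<and> Y' \<subseteq> Y \<and>
    real (card Y') \<ge> real (card Y) / 2 \<and> (\<forall>Q\<in>Y'. g Q \<in> R Q \<inter> S)"
proof -
  obtain S where S: "S \<subseteq> T" "real (card S) \<le> 2 * real (card T) / r"
    "real (card {Q\<in>Y. R Q \<inter> S \<noteq> {}}) \<ge> real (card Y) / 2"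
    by (rule hitting_half[of T Y R r]) (use assms in auto)
  have "(SOME t. t \<in> R Q \<inter> S) \<in> R Q \<inter> S" if "Q \<in> {Q\<in>Y. R Q \<inter> S \<noteq> {}}" for Q
    using that by (intro some_in_eq[THEN iffD2]) simp
  then show ?thesis using S
    by (intro exI[of _ S] exI[of _ "{Q\<in>Y. R Q \<inter> S \<noteq> {}}"] exI[of _ "\<lambda>Q. SOME t. t \<in> R Q \<inter> S"]) auto
qed

text \<open>Double counting of the incidences between tubes and cubes.\<close>

lemma tube_count:
  assumes "finite TT" "finite X" "\<And>T. T \<in> TT \<Longrightarrow> N \<le> real (card {Q \<in> X. T \<inter> Q \<noteq> {}})"
    and "\<And>Q. Q \<in> X \<Longrightarrow> real (card (tubes_meeting TT Q)) \<le> C"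
  shows "real (card TT) * N \<le> C * real (card X)"
proof -
  have "real (card TT) * N \<le> (\<Sum>T\<in>TT. real (card {Q \<in> X. T \<inter> Q \<noteq> {}}))"
    using sum_mono[of TT "\<lambda>_. N"] assms(3) by simp
  also have "\<dots> = (\<Sum>T\<in>TT. \<Sum>Q\<in>X. if T \<inter> Q \<noteq> {} then 1 else 0)"
    using assms(2) by (simp add: sum.If_cases Int_def)
  also have "\<dots> = (\<Sum>Q\<in>X. \<Sum>T\<in>TT. if T \<inter> Q \<noteq> {} then 1 else 0)" by (rule sum.swap)
  also have "\<dots> = (\<Sum>Q\<in>X. real (card (tubes_meeting TT Q)))"
    using assms(1) by (simp add: sum.If_cases Int_def tubes_meeting_def)
  also have "\<dots> \<le> (\<Sum>Q\<in>X. C)" by (rule sum_mono) (rule assms(4))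
  finally show ?thesis by (simp add: mult.commute)
qed

text \<open>Three rounds of \<open>choose_hitting\<close>, each on the cubes kept by the previous
  one. The candidates are all tubes meeting \<open>Q\<close>, then those transverse to the chosen
  one by \<open>c4\<close>, then those away from the plane of the two chosen ones; this plane passes
  through \<open>Q\<close>, so \<open>bad\<close> applies to it. Each round keeps at least half of
  its cubes.\<close>

lemma bad_cubes_angle_bound:
  fixes E N \<epsilon> \<rho> \<tau> :: real and TT X Xb :: "(real^3) set set"
  assumes E: "E > 1" and N: "N > 0" and \<epsilon>: "\<epsilon> > 0" and \<tau>: "\<tau> > 0" and \<rho>: "\<rho> > 0"
    and tubes: "\<And>T. T \<in> TT \<Longrightarrow> is_tube (E * N) T" and finX: "finite X"
    and cubes: "\<And>Q. Q \<in> X \<Longrightarrow> is_unit_cube Q" and disj: "disjoint_cubes X"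
    and c1: "\<And>T. T \<in> TT \<Longrightarrow> N \<le> real (card {Q \<in> X. T \<inter> Q \<noteq> {}})"
    and c2: "\<And>Q. Q \<in> X \<Longrightarrow> finite (tubes_meeting TT Q) \<and> \<rho> \<le> real (card (tubes_meeting TT Q)) \<and>
                real (card (tubes_meeting TT Q)) \<le> E * \<rho>"
    and c4: "\<And>Q v. Q \<in> X \<Longrightarrow> norm v = 1 \<Longrightarrow>
         real (card {T \<in> tubes_meeting TT Q. line_angle (tube_direction T) v \<ge> 1 / E})
           \<ge> (1 / E) * real (card (tubes_meeting TT Q))"
    and Xb: "Xb \<subseteq> X" "real (card Xb) > \<epsilon> * real (card X)"
    and bad: "\<And>Q P. Q \<in> Xb \<Longrightarrow> is_plane P \<Longrightarrow> P \<inter> Q \<noteq> {} \<Longrightarrow>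
      real (card {T \<in> tubes_meeting TT Q. line_plane_angle (tube_direction T) P \<le> \<tau>}) < (1 - \<epsilon>) * real (card (tubes_meeting TT Q))"
  shows "\<tau> * N ^ 3 \<le> 55296 * ((2^32 * 216)^3 * 221184000) * E ^ 7 * (1 / \<epsilon>) ^ 5 * real (card X)"
proof -
  let ?d = tube_direction and ?M = "tubes_meeting TT"
  have EN: "E * N > 0" using E N by simp
  have Xb_ne: "Xb \<noteq> {}"
  proof
    assume "Xb = {}"
    then have "\<epsilon> * real (card X) < 0" using Xb(2) by simp
    then show False using \<epsilon> by (simp add: mult_less_0_iff)
  qed
  have X_ne: "X \<noteq> {}" using Xb_ne Xb(1) by blast
  have finXb: "finite Xb" using finite_subset[OF Xb(1) finX] .
  have cX: "real (card X) > 0" using X_ne finX by (simp add: card_gt_0_iff)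
  have "real (card Xb) \<le> real (card X)" using card_mono[OF finX Xb(1)] by simp
  then have "\<epsilon> * real (card X) < 1 * real (card X)" using Xb(2) by simp
  then have \<epsilon>1: "\<epsilon> < 1" using cX by (simp only: mult_less_cancel_right_pos)
  have finT: "finite TT"
  proof (rule finite_subset)
    show "TT \<subseteq> (\<Union>Q\<in>X. ?M Q)"
    proof
      fix T assume T: "T \<in> TT"
      have "{Q \<in> X. T \<inter> Q \<noteq> {}} \<noteq> {}"
      proof
        assume "{Q \<in> X. T \<inter> Q \<noteq> {}} = {}"
        then show False using c1[OF T] N by (simp only: card.empty)
      qed
      then show "T \<in> (\<Union>Q\<in>X. ?M Q)" using T by (auto simp: tubes_meeting_def)
    qed
    show "finite (\<Union>Q\<in>X. ?M Q)" using finX c2 by blast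
  qed
  have MT: "?M Q \<subseteq> TT" for Q by (auto simp: tubes_meeting_def)
  \<comment> \<open>One lower bound for all rounds, whose candidate sets have at least
    \<open>\<rho>\<close>, \<open>\<rho> / E\<close> and \<open>\<epsilon> * \<rho>\<close>
    tubes.\<close>
  define r where "r = \<rho> * \<epsilon> / E"
  have r0: "r > 0" using \<rho> \<epsilon> E by (simp add: r_def)
  have r1: "r \<le> \<rho>" "r \<le> (1/E) * \<rho>" "r \<le> \<epsilon> * \<rho>"
  proof -
    have "\<epsilon> * \<rho> \<le> 1 * \<rho>" using \<epsilon>1 \<rho> by (intro mult_right_mono) auto
    then show "r \<le> (1/E) * \<rho>" using E by (simp add: r_def divide_right_mono mult.commute)
    have "\<epsilon> * \<rho> / E \<le> \<epsilon> * \<rho> / 1" using E \<epsilon> \<rho> by (intro divide_left_mono) auto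
    then show "r \<le> \<epsilon> * \<rho>" by (simp add: r_def mult.commute)
    then show "r \<le> \<rho>" using \<open>\<epsilon> * \<rho> \<le> 1 * \<rho>\<close> by simp
  qed
  obtain Q0 where Q0: "Q0 \<in> X" using X_ne by blast
  have "real (card (?M Q0)) \<le> real (card TT)" using card_mono[OF finT MT] by simp
  then have rn: "r \<le> real (card TT)" using c2[OF Q0] r1(1) by linarith
  have T_ne: "TT \<noteq> {}" using rn r0 by auto
  define L where "L = 2 * real (card TT) / r"
  have dn: "norm (?d T) = 1" if "T \<in> TT" for T using tube_direction(1)[OF tubes[OF that] EN] .
  have "\<exists>S Y' g. S \<subseteq> TT \<and> real (card S) \<le> L \<and> Y' \<subseteq> Xb \<and>
    real (card Y') \<ge> real (card Xb) / 2 \<and> (\<forall>Q\<in>Y'. g Q \<in> ?M Q \<inter> S)"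
    unfolding L_def
  proof (rule choose_hitting[OF finT finXb _ T_ne r0 rn, of ?M])
    fix Q assume "Q \<in> Xb"
    then have "Q \<in> X" using Xb(1) by blast
    then have "\<rho> \<le> real (card (?M Q))" using c2 by blast
    then show "?M Q \<subseteq> TT \<and> r \<le> real (card (?M Q))" using MT r1(1) by (intro conjI) auto
  qed
  then obtain S1 Y1 g1 where S1: "S1 \<subseteq> TT" "real (card S1) \<le> L" "Y1 \<subseteq> Xb"
    "real (card Y1) \<ge> real (card Xb) / 2" "\<forall>Q\<in>Y1. g1 Q \<in> ?M Q \<inter> S1"
    by (elim exE conjE)
  note S1 = S1(1-4) S1(5)[rule_format]
  have fY1: "finite Y1" using finite_subset[OF S1(3) finXb] .
  define R2 where "R2 Q = {T \<in> ?M Q. line_angle (?d T) (?d (g1 Q)) \<ge> 1 / E}" for Q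
  have "\<exists>S Y' g. S \<subseteq> TT \<and> real (card S) \<le> L \<and> Y' \<subseteq> Y1 \<and>
    real (card Y') \<ge> real (card Y1) / 2 \<and> (\<forall>Q\<in>Y'. g Q \<in> R2 Q \<inter> S)"
    unfolding L_def
  proof (rule choose_hitting[OF finT fY1 _ T_ne r0 rn, of R2])
    fix Q assume Q: "Q \<in> Y1"
    then have QX: "Q \<in> X" using S1(3) Xb(1) by blast
    have "g1 Q \<in> TT" using S1(5)[OF Q] MT by blast
    then have "(1 / E) * real (card (?M Q)) \<le> real (card (R2 Q))" unfolding R2_def by (intro c4 QX dn)
    moreover have "(1 / E) * \<rho> \<le> (1 / E) * real (card (?M Q))" using c2[OF QX] E by (intro mult_left_mono) auto
    ultimately have "r \<le> real (card (R2 Q))" using r1(2) by linarith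
    moreover have "R2 Q \<subseteq> TT" using MT by (auto simp: R2_def)
    ultimately show "R2 Q \<subseteq> TT \<and> r \<le> real (card (R2 Q))" by (rule conjI[rotated])
  qed
  then obtain S2 Y2 g2 where S2: "S2 \<subseteq> TT" "real (card S2) \<le> L" "Y2 \<subseteq> Y1"
    "real (card Y2) \<ge> real (card Y1) / 2" "\<forall>Q\<in>Y2. g2 Q \<in> R2 Q \<inter> S2"
    by (elim exE conjE)
  note S2 = S2(1-4) S2(5)[rule_format]
  have fY2: "finite Y2" using finite_subset[OF S2(3) fY1] .
  have tr: "norm (cross3 (?d (g2 Q)) (?d (g1 Q))) \<ge> 1 / (2 * E)" if Q: "Q \<in> Y2" for Q
  proof -
    have "g1 Q \<in> TT" using S1(5) S2(3) Q MT by blast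
    moreover have "g2 Q \<in> TT" using S2(5)[OF Q] S2(1) by blast
    moreover have "1 / E \<le> line_angle (?d (g2 Q)) (?d (g1 Q))" using S2(5)[OF Q] by (auto simp: R2_def)
    ultimately show ?thesis using norm_cross_ge_angle[of "?d (g2 Q)" "?d (g1 Q)" "1/E"] dn by simp
  qed
  define pt where "pt Q = (SOME q. q \<in> Q)" for Q :: "(real^3) set"
  define PL where "PL Q = span_plane (pt Q) (?d (g2 Q)) (?d (g1 Q))" for Q
  define R3 where "R3 Q = {T \<in> ?M Q. \<not> line_plane_angle (?d T) (PL Q) \<le> \<tau>}" for Q
  have "\<exists>S Y' g. S \<subseteq> TT \<and> real (card S) \<le> L \<and> Y' \<subseteq> Y2 \<and>
    real (card Y') \<ge> real (card Y2) / 2 \<and> (\<forall>Q\<in>Y'. g Q \<in> R3 Q \<inter> S)"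
    unfolding L_def
  proof (rule choose_hitting[OF finT fY2 _ T_ne r0 rn, of R3])
    fix Q assume Q: "Q \<in> Y2"
    then have QX: "Q \<in> X" and QXb: "Q \<in> Xb" using S2(3) S1(3) Xb(1) by blast+
    have "0 < 1 / (2 * E)" using E by simp
    then have "cross3 (?d (g2 Q)) (?d (g1 Q)) \<noteq> 0" using tr[OF Q] by auto
    then have pl: "is_plane (PL Q)" unfolding PL_def by (rule is_plane_span_plane)
    obtain m where "ball m (1/2) \<subseteq> Q" using unit_cube_center[OF cubes[OF QX]] by blast
    then have "Q \<noteq> {}" by auto
    then have "pt Q \<in> Q" unfolding pt_def by (simp add: some_in_eq)
    moreover have "pt Q \<in> PL Q" unfolding PL_def span_plane_def using span_zero by force
    ultimately have "PL Q \<inter> Q \<noteq> {}" by blast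
    from bad[OF QXb pl this] have "real (card (R3 Q)) > \<epsilon> * real (card (?M Q))"
      using card_filter_compl[of "?M Q" "\<lambda>T. line_plane_angle (?d T) (PL Q) \<le> \<tau>"] c2[OF QX]
      unfolding R3_def by (simp add: algebra_simps)
    moreover have "\<epsilon> * \<rho> \<le> \<epsilon> * real (card (?M Q))" using c2[OF QX] \<epsilon> by (intro mult_left_mono) auto
    ultimately have "r \<le> real (card (R3 Q))" using r1(3) by linarith
    moreover have "R3 Q \<subseteq> TT" using MT by (auto simp: R3_def)
    ultimately show "R3 Q \<subseteq> TT \<and> r \<le> real (card (R3 Q))" by (rule conjI[rotated])
  qed
  then obtain S3 Y3 g3 where S3: "S3 \<subseteq> TT" "real (card S3) \<le> L" "Y3 \<subseteq> Y2"
    "real (card Y3) \<ge> real (card Y2) / 2" "\<forall>Q\<in>Y3. g3 Q \<in> R3 Q \<inter> S3"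
    by (elim exE conjE)
  note S3 = S3(1-4) S3(5)[rule_format]
  have Y3X: "Y3 \<subseteq> X" using S3(3) S2(3) S1(3) Xb(1) by blast
  have fY3: "finite Y3" using finite_subset[OF Y3X finX] .
  have y: "real (card Y3) \<ge> \<epsilon> * real (card X) / 8" using S3(4) S2(4) S1(4) Xb(2) by linarith
  have "\<epsilon> * real (card X) / 8 > 0" using \<epsilon> cX by simp
  then have "real (card Y3) > 0" using y by linarith
  then have Y3_ne: "Y3 \<noteq> {}" by auto
  have "\<forall>Q\<in>X. \<exists>m. ball m (1/2) \<subseteq> Q \<and> Q \<subseteq> cball m 1" using unit_cube_center[OF cubes] by blast
  from bchoice[OF this] obtain m where m: "\<forall>Q\<in>X. ball (m Q) (1/2) \<subseteq> Q \<and> Q \<subseteq> cball (m Q) 1" by (elim exE)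
  have "\<forall>T\<in>TT. \<exists>a. \<exists>l. T = unit_cylinder l a (?d T)" using tube_direction(2)[OF tubes EN] by blast
  from bchoice[OF this] obtain base where base: "\<forall>T\<in>TT. \<exists>l. T = unit_cylinder l (base T) (?d T)" by (elim exE)
  define S where "S = S1 \<union> S2 \<union> S3"
  have finS: "finite S" unfolding S_def using S1(1) S2(1) S3(1) finT by (auto intro: finite_subset)
  have ST: "S \<subseteq> TT" using S1(1) S2(1) S3(1) by (simp add: S_def)
  have g: "g1 Q \<in> ?M Q \<inter> S1" "g2 Q \<in> ?M Q \<inter> S2" "g3 Q \<in> ?M Q \<inter> S3" if Q: "Q \<in> Y3" for Q
    using S1(5)[of Q] S2(5)[of Q] S3(5)[of Q] Q S3(3) S2(3) by (auto simp: R2_def R3_def)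
  have "\<tau> / (4 * E) * (real (card Y3))\<^sup>2 \<le> (2^32 * 216)^3 * 221184000 * real (card S) ^ 3"
  proof (rule transverse_tubes_count[OF fY3 Y3_ne _ finS, where m = m and ?T1.0 = g3 and ?T2.0 = g2 and ?T3.0 = g1 and base = base and dir = ?d])
    show "ball (m Q) (1/2) \<inter> ball (m R) (1/2) = {}" if QR: "Q \<in> Y3" "R \<in> Y3" "Q \<noteq> R" for Q R
    proof -
      have "disjnt (interior Q) (interior R)"
        using disj QR Y3X unfolding disjoint_cubes_def pairwise_def by blast
      moreover have "ball (m P) (1/2) \<subseteq> interior P" if "P \<in> X" for P
        using m that by (intro interior_maximal open_ball) blast
      then have "ball (m Q) (1/2) \<subseteq> interior Q" "ball (m R) (1/2) \<subseteq> interior R"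
        using QR Y3X by blast+
      ultimately show ?thesis unfolding disjnt_def by blast
    qed
    show "g3 Q \<in> S" "g2 Q \<in> S" "g1 Q \<in> S" if "Q \<in> Y3" for Q using g[OF that] by (auto simp: S_def)
    show "norm (?d t) = 1" if "t \<in> S" for t using dn ST that by blast
    show "0 < \<tau> / (4 * E)" using \<tau> E by simp
    \<comment> \<open>The product of \<open>1 / (2 * E)\<close>, the bound for the cross product of
      two directions, and \<open>\<tau> / 2\<close> for the third.\<close>
    show "\<tau> / (4 * E) \<le> \<bar>?d (g3 Q) \<bullet> cross3 (?d (g2 Q)) (?d (g1 Q))\<bar>" if Q: "Q \<in> Y3" for Q
    proof -
      have "g3 Q \<in> R3 Q" using S3(5)[OF Q] by blast
      then have "\<tau> < line_plane_angle (?d (g3 Q)) (span_plane (pt Q) (?d (g2 Q)) (?d (g1 Q)))"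
        by (auto simp: R3_def PL_def)
      moreover have "norm (?d (g3 Q)) = 1" "norm (?d (g2 Q)) = 1" "norm (?d (g1 Q)) = 1"
        using g[OF Q] MT by (auto intro!: dn)
      moreover have "1 / (2 * E) > 0" using E by simp
      ultimately have "1 / (2 * E) * (\<tau> / 2) \<le> \<bar>?d (g3 Q) \<bullet> cross3 (?d (g2 Q)) (?d (g1 Q))\<bar>"
        using tr[of Q] Q S3(3) by (intro triple_product_ge) auto
      then show ?thesis by simp
    qed
    \<comment> \<open>Less than \<open>1/2\<close> from \<open>x\<close> to the centre, at most
      \<open>1\<close> from there to a common point of cube and tube, at most \<open>1\<close> from
      it to the central line.\<close>
    show "\<exists>s. dist x (base t + s *\<^sub>R ?d t) \<le> 3"
      if Q: "Q \<in> Y3" and t: "t \<in> {g3 Q, g2 Q, g1 Q}" and x: "x \<in> ball (m Q) (1/2)" for Q t x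
    proof -
      have "t \<in> ?M Q" using g[OF Q] t by auto
      then obtain p where p: "p \<in> t" "p \<in> Q" and tT: "t \<in> TT" by (auto simp: tubes_meeting_def)
      obtain l where "t = unit_cylinder l (base t) (?d t)" using base tT by blast
      then have "p \<in> unit_cylinder l (base t) (?d t)" using p(1) by simp
      then obtain s w where w: "p = base t + s *\<^sub>R ?d t + w" "norm w \<le> 1" by (auto simp: unit_cylinder_def)
      have "dist (m Q) p \<le> 1" using m Q Y3X p(2) by (auto simp: subset_iff)
      moreover have "dist p (base t + s *\<^sub>R ?d t) \<le> 1" using w by (simp add: dist_norm)
      moreover have "dist x (m Q) < 1/2" using x by (simp add: dist_commute)
      ultimately have "dist x (base t + s *\<^sub>R ?d t) \<le> 3"
        using dist_triangle[of x "base t + s *\<^sub>R ?d t" "m Q"] dist_triangle[of "m Q" "base t + s *\<^sub>R ?d t" p] by linarith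
      then show ?thesis by (rule exI)
    qed
  qed
  moreover have "real (card S) \<le> 6 * E\<^sup>2 * real (card X) / (\<epsilon> * N)"
  proof -
    have "card S \<le> card S1 + card S2 + card S3"
      unfolding S_def by (rule order_trans[OF card_Un_le]) (simp add: card_Un_le)
    then have "real (card S) \<le> 3 * L" using S1(2) S2(2) S3(2) by linarith
    also have "\<dots> = 6 * E * real (card TT) / (\<rho> * \<epsilon>)" by (simp add: L_def r_def)
    also have "\<dots> \<le> 6 * E * (E * \<rho> * real (card X) / N) / (\<rho> * \<epsilon>)"
    proof -
      have "real (card TT) * N \<le> E * \<rho> * real (card X)" by (rule tube_count[OF finT finX c1]) (use c2 in auto)
      then have "real (card TT) \<le> E * \<rho> * real (card X) / N" using N by (simp add: pos_le_divide_eq)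
      then show ?thesis using E \<rho> \<epsilon> by (intro divide_right_mono mult_left_mono) auto
    qed
    also have "\<dots> = 6 * E\<^sup>2 * real (card X) / (\<epsilon> * N)" using \<rho> by (simp add: power2_eq_square ac_simps)
    finally show ?thesis .
  qed
  moreover define x where "x = real (card X)"
  moreover define C :: real where "C = (2^32 * 216)^3 * 221184000"
  ultimately have 1: "\<tau> / (4 * E) * (real (card Y3))\<^sup>2 \<le> C * real (card S) ^ 3" and 2: "real (card S) \<le> 6 * E\<^sup>2 * x / (\<epsilon> * N)"
    by (simp_all only:)
  have C0: "C > 0" by (simp add: C_def)
  have x0: "x > 0" using cX by (simp add: x_def)
  have "\<tau> / (4 * E) * (\<epsilon> * x / 8)\<^sup>2 \<le> \<tau> / (4 * E) * (real (card Y3))\<^sup>2"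
    using y \<tau> E \<epsilon> x0 by (intro mult_left_mono power_mono) (auto simp: x_def)
  also have "\<dots> \<le> C * (6 * E\<^sup>2 * x / (\<epsilon> * N)) ^ 3"
    by (rule order_trans[OF 1]) (use C0 2 in \<open>auto intro!: mult_left_mono power_mono\<close>)
  finally have f: "\<tau> / (4 * E) * (\<epsilon> * x / 8)\<^sup>2 \<le> C * (6 * E\<^sup>2 * x / (\<epsilon> * N)) ^ 3" .
  \<comment> \<open>The factor isolates \<open>\<tau> * N ^ 3\<close> on the left. The constant is
    \<open>55296 = 4 * 8^2 * 6^3\<close>, and the power \<open>(1 / \<epsilon>) ^ 5\<close> comes
    from two factors through the share of cubes kept and three through the number of selected
    tubes.\<close>
  have l: "\<tau> / (4 * E) * (\<epsilon> * x / 8)\<^sup>2 * (256 * E * N ^ 3 / (\<epsilon>\<^sup>2 * x\<^sup>2)) = \<tau> * N ^ 3"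
    using E \<epsilon> x0 by (simp add: power2_eq_square divide_simps)
  have rr: "C * (6 * E\<^sup>2 * x / (\<epsilon> * N)) ^ 3 * (256 * E * N ^ 3 / (\<epsilon>\<^sup>2 * x\<^sup>2)) = 55296 * C * E ^ 7 * (1 / \<epsilon>) ^ 5 * x"
    using E \<epsilon> x0 N by (simp add: power2_eq_square power3_eq_cube eval_nat_numeral divide_simps)
  have "0 \<le> 256 * E * N ^ 3 / (\<epsilon>\<^sup>2 * x\<^sup>2)" using E N by simp
  from mult_right_mono[OF f this] have "\<tau> * N ^ 3 \<le> 55296 * C * E ^ 7 * (1 / \<epsilon>) ^ 5 * x" unfolding l rr .
  then show ?thesis unfolding C_def x_def .
qed

theorem proposition0p3:
  shows "\<exists>p :: real poly poly.
    \<forall>(E::real) (N::real) (\<sigma>::real) (\<epsilon>::real) (\<rho>::real)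
      (c :: real^3) (TT :: (real^3) set set) (X :: (real^3) set set).
      E > 1 \<longrightarrow> N > 0 \<longrightarrow> \<epsilon> > 0 \<longrightarrow>
      (\<forall>T\<in>TT. is_tube (E * N) T \<and> T \<subseteq> cball c (E * N)) \<longrightarrow>
      finite X \<longrightarrow> real (card X) = N powr (3 - \<sigma>) \<longrightarrow>
      (\<forall>Q\<in>X. is_unit_cube Q \<and> Q \<subseteq> cball c (E * N)) \<longrightarrow>
      disjoint_cubes X \<longrightarrow>
      (\<forall>T\<in>TT. N \<le> real (card {Q \<in> X. T \<inter> Q \<noteq> {}}) \<and>
                real (card {Q \<in> X. T \<inter> Q \<noteq> {}}) \<le> E * N) \<longrightarrow>
      \<rho> \<ge> 3 \<longrightarrow>
      (\<forall>Q\<in>X. finite (tubes_meeting TT Q) \<and>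
                \<rho> \<le> real (card (tubes_meeting TT Q)) \<and>
                real (card (tubes_meeting TT Q)) \<le> E * \<rho>) \<longrightarrow>
      (\<forall>x. finite {T \<in> TT. x \<in> T} \<and> real (card {T \<in> TT. x \<in> T}) \<le> E * \<rho>) \<longrightarrow>
      (\<forall>Q\<in>X. \<forall>v1 v2. norm v1 = 1 \<longrightarrow> norm v2 = 1 \<longrightarrow>
         real (card {T \<in> tubes_meeting TT Q.
                       line_angle (tube_direction T) v1 \<ge> 1 / E \<and>
                       line_angle (tube_direction T) v2 \<ge> 1 / E})
           \<ge> (1 / E) * real (card (tubes_meeting TT Q))) \<longrightarrow>
      (\<exists>pl :: (real^3) set \<Rightarrow> (real^3) set.
         (\<forall>Q\<in>X. is_plane (pl Q) \<and> pl Q \<inter> Q \<noteq> {}) \<and>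
         real (card {Q \<in> X.
             real (card {T \<in> tubes_meeting TT Q.
                 line_plane_angle (tube_direction T) (pl Q)
                   \<le> poly_two p E (1 / \<epsilon>) * N powr (- \<sigma>)})
               \<ge> (1 - \<epsilon>) * real (card (tubes_meeting TT Q))})
           \<ge> (1 - \<epsilon>) * real (card X))"
proof -
  define C :: real where "C = 55296 * ((2^32 * 216)^3 * 221184000)"
  \<comment> \<open>The outer variable is the second one. \<open>C + 1\<close> in place of
    \<open>C\<close> makes \<open>\<tau>\<close> strictly larger than the bound derived for it, as
    the contradiction requires.\<close>
  define p :: "real poly poly" where "p = Polynomial.monom (Polynomial.monom (C + 1) 7) 5"
  have p: "poly_two p x y = (C + 1) * x ^ 7 * y ^ 5" for x y
    by (simp add: poly_two_def p_def poly_monom)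
  show ?thesis
  proof (rule exI[of _ p], intro allI impI, goal_cases)
    case (1 E N \<sigma> \<epsilon> \<rho> c TT X)
    note E = 1(1) and N = 1(2) and \<epsilon> = 1(3) and tubes = 1(4) and finX = 1(5) and cardX = 1(6)
      and cubes = 1(7) and disj = 1(8) and c1 = 1(9) and \<rho> = 1(10) and c2 = 1(11) and c4 = 1(13)
    define \<tau> where "\<tau> = poly_two p E (1 / \<epsilon>) * N powr (- \<sigma>)"
    have Cp: "C > 0" by (simp add: C_def)
    then have \<tau>: "\<tau> > 0" using E \<epsilon> N by (simp add: \<tau>_def p)
    define good where "good Q P \<longleftrightarrow> (1 - \<epsilon>) * real (card (tubes_meeting TT Q)) \<le>
      real (card {T \<in> tubes_meeting TT Q. line_plane_angle (tube_direction T) P \<le> \<tau>})" for Q P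
    define adm where "adm Q P \<longleftrightarrow> is_plane P \<and> P \<inter> Q \<noteq> {}" for P Q :: "(real^3) set"
    \<comment> \<open>A good plane is taken whenever one exists, so a cube on which
      \<open>pl\<close> fails has no good plane at all; such a cube gets any plane through
      it.\<close>
    define pl where "pl Q = (if \<exists>P. adm Q P \<and> good Q P then SOME P. adm Q P \<and> good Q P else SOME P. adm Q P)" for Q
    have ex: "\<exists>P. adm Q P" if "Q \<in> X" for Q
    proof -
      obtain m where "ball m (1/2) \<subseteq> Q" using unit_cube_center[of Q] cubes \<open>Q \<in> X\<close> by blast
      then have "m \<in> Q" by auto
      then show ?thesis using exists_plane_through[of m] unfolding adm_def by blast
    qed
    have adm_pl: "adm Q (pl Q)" if "Q \<in> X" for Q
      using someI_ex[of "\<lambda>P. adm Q P \<and> good Q P"] someI_ex[OF ex[OF that]] by (auto simp: pl_def)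
    have good_pl: "good Q (pl Q)" if "\<exists>P. adm Q P \<and> good Q P" for Q
      using someI_ex[OF that] that by (simp add: pl_def)
    have "(1 - \<epsilon>) * real (card X) \<le> real (card {Q \<in> X. good Q (pl Q)})"
    proof (rule ccontr)
      assume "\<not> ?thesis"
      then have lt: "real (card {Q \<in> X. good Q (pl Q)}) < (1 - \<epsilon>) * real (card X)" by simp
      define Xb where "Xb = {Q \<in> X. \<not> good Q (pl Q)}"
      have "real (card Xb) > \<epsilon> * real (card X)"
        using lt card_filter_compl[OF finX, of "\<lambda>Q. good Q (pl Q)"] unfolding Xb_def by (simp add: algebra_simps)
      moreover have "\<rho> > 0" using \<rho> by simp
      moreover have "real (card {T \<in> tubes_meeting TT Q. line_plane_angle (tube_direction T) P \<le> \<tau>}) < (1 - \<epsilon>) * real (card (tubes_meeting TT Q))"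
        if "Q \<in> Xb" "is_plane P" "P \<inter> Q \<noteq> {}" for Q P
      proof -
        have "\<not> good Q (pl Q)" using that by (simp add: Xb_def)
        then have "\<not> good Q P" using good_pl[of Q] that unfolding adm_def by blast
        then show ?thesis by (simp add: good_def)
      qed
      moreover have "(1 / E) * real (card (tubes_meeting TT Q)) \<le> real (card {T \<in> tubes_meeting TT Q. line_angle (tube_direction T) v \<ge> 1 / E})"
        if "Q \<in> X" "norm v = 1" for Q v
        using c4 that by fastforce
      ultimately have "\<tau> * N ^ 3 \<le> 55296 * ((2^32 * 216)^3 * 221184000) * E ^ 7 * (1 / \<epsilon>) ^ 5 * real (card X)"
        using tubes cubes c1 c2
        by (intro bad_cubes_angle_bound[OF E N \<epsilon> \<tau> _ _ finX _ disj, of \<rho> TT Xb]) (auto simp: Xb_def)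
      also have "\<dots> = C * E ^ 7 * (1 / \<epsilon>) ^ 5 * (N powr (3 - \<sigma>))" by (simp add: C_def cardX)
      also have "N powr (3 - \<sigma>) = N powr (- \<sigma>) * N ^ 3"
        using N by (simp add: powr_diff powr_minus_divide powr_numeral)
      finally have "\<tau> * N ^ 3 \<le> (C * E ^ 7 * (1 / \<epsilon>) ^ 5 * N powr (- \<sigma>)) * N ^ 3" by (simp add: mult.assoc)
      then have "\<tau> \<le> C * E ^ 7 * (1 / \<epsilon>) ^ 5 * N powr (- \<sigma>)" using N by (simp only: mult_le_cancel_right_pos zero_less_power)
      moreover have "\<tau> = C * E ^ 7 * (1 / \<epsilon>) ^ 5 * N powr (- \<sigma>) + E ^ 7 * (1 / \<epsilon>) ^ 5 * N powr (- \<sigma>)"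
        by (simp add: \<tau>_def p algebra_simps)
      moreover have "E ^ 7 * (1 / \<epsilon>) ^ 5 * N powr (- \<sigma>) > 0" using E \<epsilon> N by simp
      ultimately show False by linarith
    qed
    then show ?case
      using adm_pl unfolding good_def adm_def \<tau>_def by (intro exI[of _ pl]) blast
  qed
qed

end
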